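(* Let $0<\alpha<1$, $0<\epsilon\le1/4$, and let $r\ge4$ be an integer (with $r\le 2^n$). Consider the task of estimating $\Lambda_\alpha(\rho,\rho_{\mathtt U})$ to within additive error $\epsilon$, where $\rho$ is an $n$-qubit quantum state of rank $r$ and $\rho_{\mathtt U}$ is the state that is uniform on the support of $\rho$. In the worst case over such $\rho$: (1) (Queries) in the purified quantum access model, the quantum query complexity is $\Omega\big(r^{\frac1\alpha-1}/\epsilon^{\frac1\alpha}\big)$; (2) (Samples) the quantum sample complexity is $\Omega\big(r^{\frac2\alpha-1}/\epsilon^{\frac2\alpha}\big)$.
   Context: $\Lambda_\alpha(\rho_0,\rho_1)=\frac12\mathrm{tr}(|\rho_0-\rho_1|^\alpha)$, with $|A|=(A^\dagger A)^{1/2}$. For $\rho$ of rank $r$, $\rho_{\mathtt U}=\Pi/r$ where $\Pi$ is the orthogonal projector onto the support of $\rho$. Purified quantum access model: the algorithm makes queries to unitaries (and their inverses and controlled versions) preparing purifications of $\rho$ and $\rho_{\mathtt U}$ from the all-zero state; query complexity is the number of queries. In the sample model the algorithm receives independent copies of $\rho$ and $\rho_{\mathtt U}$; sample complexity is the number of copies. Algorithms must succeed with probability at least $2/3$. The constants in $\Omega(\cdot)$ may depend on $\alpha$. *)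

theory Defs
  imports
    "Jordan_Normal_Form.Schur_Decomposition"
    "Jordan_Normal_Form.DL_Rank"
    "HOL-Library.Extended_Real"
begin

text \<open>
  All systems are finite-dimensional with the computational basis indexed by \<open>{..<d}\<close>;
  \<open>n\<close> qubits have \<open>d = 2 ^ n\<close>, and in a composite system the left tensor factor is the most
  significant digit of the index.
\<close>


section \<open>Matrices\<close>

definition trace :: "complex mat \<Rightarrow> complex" where
  "trace A = (\<Sum>i<dim_row A. A $$ (i, i))"

definition unitary_mat :: "nat \<Rightarrow> complex mat \<Rightarrow> bool" where
  "unitary_mat d U \<longleftrightarrow>
     U \<in> carrier_mat d d \<and> mat_adjoint U * U = 1\<^sub>m d \<and> U * mat_adjoint U = 1\<^sub>m d"

definition psd_mat :: "nat \<Rightarrow> complex mat \<Rightarrow> bool" where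
  "psd_mat d A \<longleftrightarrow>
     A \<in> carrier_mat d d \<and> mat_adjoint A = A \<and>
     (\<forall>v \<in> carrier_vec d. 0 \<le> Re ((A *\<^sub>v v) \<bullet>c v))"

definition kron :: "complex mat \<Rightarrow> complex mat \<Rightarrow> complex mat" where
  "kron A B = mat (dim_row A * dim_row B) (dim_col A * dim_col B)
     (\<lambda>(i, j). A $$ (i div dim_row B, j div dim_col B) * B $$ (i mod dim_row B, j mod dim_col B))"

definition kron_power :: "complex mat \<Rightarrow> nat \<Rightarrow> complex mat" where
  "kron_power A k = (kron A ^^ k) (1\<^sub>m 1)"

text \<open>Partial trace over the right factor of a system of dimension \<open>d * d'\<close>.\<close>

definition partial_trace :: "nat \<Rightarrow> nat \<Rightarrow> complex mat \<Rightarrow> complex mat" where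
  "partial_trace d d' A = mat d d (\<lambda>(i, j). \<Sum>k<d'. A $$ (i * d' + k, j * d' + k))"

definition pure_state :: "complex vec \<Rightarrow> complex mat" where
  "pure_state \<psi> = mat (dim_vec \<psi>) (dim_vec \<psi>) (\<lambda>(i, j). \<psi> $ i * cnj (\<psi> $ j))"

text \<open>
  Functional calculus for a Hermitian matrix: \<open>f\<close> is applied to the eigenvalues in a unitary
  diagonalization. One exists by the spectral theorem, and the result does not depend on it.
\<close>

definition spectral_map :: "(real \<Rightarrow> real) \<Rightarrow> complex mat \<Rightarrow> complex mat" where
  "spectral_map f A = (THE B. \<exists>U d. unitary_mat (dim_row A) U \<and>
     A = U * mat_diag (dim_row A) (\<lambda>i. complex_of_real (d i)) * mat_adjoint U \<and>
     B = U * mat_diag (dim_row A) (\<lambda>i. complex_of_real (f (d i))) * mat_adjoint U)"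

text \<open>
  Used for positive semidefinite matrices and exponents \<open>s > 0\<close>, where \<open>0 powr s = 0\<close> is
  the intended value on the kernel.
\<close>

definition mat_powr :: "complex mat \<Rightarrow> real \<Rightarrow> complex mat" where
  "mat_powr A s = spectral_map (\<lambda>x. x powr s) A"

definition mat_abs :: "complex mat \<Rightarrow> complex mat" where
  "mat_abs A = mat_powr (mat_adjoint A * A) (1 / 2)"


section \<open>States\<close>

definition density_mat :: "nat \<Rightarrow> complex mat \<Rightarrow> bool" where
  "density_mat d \<rho> \<longleftrightarrow> psd_mat d \<rho> \<and> trace \<rho> = 1"

abbreviation mat_rank :: "complex mat \<Rightarrow> nat" where
  "mat_rank A \<equiv> vec_space.rank (dim_row A) A"

text \<open>The support is the orthogonal complement of the kernel.\<close>

definition support :: "complex mat \<Rightarrow> complex vec set" where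
  "support A = {v \<in> carrier_vec (dim_col A).
     \<forall>w \<in> carrier_vec (dim_col A). A *\<^sub>v w = 0\<^sub>v (dim_row A) \<longrightarrow> v \<bullet>c w = 0}"

text \<open>A Hermitian idempotent is determined by its range.\<close>

definition support_projector :: "complex mat \<Rightarrow> complex mat" where
  "support_projector A = (THE P. P \<in> carrier_mat (dim_col A) (dim_col A) \<and>
     mat_adjoint P = P \<and> P * P = P \<and> (\<lambda>v. P *\<^sub>v v) ` carrier_vec (dim_col A) = support A)"

definition uniform_on_support :: "complex mat \<Rightarrow> complex mat" where
  "uniform_on_support \<rho> = (1 / of_nat (mat_rank \<rho>)) \<cdot>\<^sub>m support_projector \<rho>"

definition Lambda :: "real \<Rightarrow> complex mat \<Rightarrow> complex mat \<Rightarrow> real" where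
  "Lambda \<alpha> \<rho>\<^sub>0 \<rho>\<^sub>1 = 1 / 2 * Re (trace (mat_powr (mat_abs (\<rho>\<^sub>0 - \<rho>\<^sub>1)) \<alpha>))"

definition admissible_state :: "nat \<Rightarrow> nat \<Rightarrow> complex mat \<Rightarrow> bool" where
  "admissible_state n r \<rho> \<longleftrightarrow> density_mat (2 ^ n) \<rho> \<and> mat_rank \<rho> = r"


section \<open>Purified query access\<close>

text \<open>
  \<open>Q\<close> acts on \<open>n\<close> system qubits followed by \<open>a\<close> purifying qubits and maps the all-zero state to
  a purification of \<open>\<rho>\<close>.
\<close>

definition prepares_purification :: "nat \<Rightarrow> nat \<Rightarrow> complex mat \<Rightarrow> complex mat \<Rightarrow> bool" where
  "prepares_purification n a Q \<rho> \<longleftrightarrow> unitary_mat (2 ^ (n + a)) Q \<and>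
     partial_trace (2 ^ n) (2 ^ a) (pure_state (Q *\<^sub>v unit_vec (2 ^ (n + a)) 0)) = \<rho>"

datatype preparation = Prepare_State | Prepare_Uniform

datatype query = Query (target: preparation) (inverted: bool) (with_control: bool)

definition controlled :: "complex mat \<Rightarrow> complex mat" where
  "controlled U =
     four_block_mat (1\<^sub>m (dim_row U)) (0\<^sub>m (dim_row U) (dim_col U)) (0\<^sub>m (dim_row U) (dim_col U)) U"

definition query_unitary :: "complex mat \<Rightarrow> complex mat \<Rightarrow> query \<Rightarrow> complex mat" where
  "query_unitary Q\<^sub>0 Q\<^sub>1 q =
     (let Q = (case target q of Prepare_State \<Rightarrow> Q\<^sub>0 | Prepare_Uniform \<Rightarrow> Q\<^sub>1);
          Q' = (if inverted q then mat_adjoint Q else Q)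
      in if with_control q then controlled Q' else Q')"

text \<open>
  A query algorithm on \<open>width\<close> qubits starts in the all-zero state, applies \<open>initial\<close>, then for
  each \<open>(q, V)\<close> in \<open>steps\<close> the query \<open>q\<close> followed by the oracle-independent unitary \<open>V\<close>, and
  finally measures all qubits in the computational basis, reporting \<open>estimate i\<close> on outcome \<open>i\<close>.
  Queries act on the leading qubits; since the interleaved unitaries are arbitrary (in particular
  they may permute qubits), this is no restriction.
\<close>

record query_algorithm =
  width :: nat
  initial :: "complex mat"
  steps :: "(query \<times> complex mat) list"
  estimate :: "nat \<Rightarrow> real"

definition query_algorithm_wf :: "nat \<Rightarrow> query_algorithm \<Rightarrow> bool" where
  "query_algorithm_wf m A \<longleftrightarrow> m \<le> width A \<and> unitary_mat (2 ^ width A) (initial A) \<and>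
     (\<forall>(q, V) \<in> set (steps A). unitary_mat (2 ^ width A) V)"

definition on_leading_qubits :: "nat \<Rightarrow> complex mat \<Rightarrow> complex mat" where
  "on_leading_qubits w G = kron G (1\<^sub>m (2 ^ w div dim_row G))"

definition final_state :: "query_algorithm \<Rightarrow> complex mat \<Rightarrow> complex mat \<Rightarrow> complex vec" where
  "final_state A Q\<^sub>0 Q\<^sub>1 =
     foldl (\<lambda>\<psi> (q, V). V *\<^sub>v (on_leading_qubits (width A) (query_unitary Q\<^sub>0 Q\<^sub>1 q) *\<^sub>v \<psi>))
       (initial A *\<^sub>v unit_vec (2 ^ width A) 0) (steps A)"

definition query_success_prob ::
    "query_algorithm \<Rightarrow> complex mat \<Rightarrow> complex mat \<Rightarrow> real \<Rightarrow> real \<Rightarrow> real" where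
  "query_success_prob A Q\<^sub>0 Q\<^sub>1 x \<epsilon> =
     (\<Sum>i \<in> {i. i < 2 ^ width A \<and> \<bar>estimate A i - x\<bar> \<le> \<epsilon>}. (cmod (final_state A Q\<^sub>0 Q\<^sub>1 $ i))\<^sup>2)"

text \<open>
  \<open>a\<close> and \<open>b\<close> are the numbers of purifying qubits of the two oracles. The width leaves room
  for the larger oracle and a control qubit.
\<close>

definition query_estimator ::
    "real \<Rightarrow> real \<Rightarrow> nat \<Rightarrow> nat \<Rightarrow> nat \<Rightarrow> nat \<Rightarrow> query_algorithm \<Rightarrow> bool" where
  "query_estimator \<alpha> \<epsilon> n r a b A \<longleftrightarrow> query_algorithm_wf (n + max a b + 1) A \<and>
     (\<forall>\<rho> Q\<^sub>0 Q\<^sub>1. admissible_state n r \<rho> \<and>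
        prepares_purification n a Q\<^sub>0 \<rho> \<and>
        prepares_purification n b Q\<^sub>1 (uniform_on_support \<rho>) \<longrightarrow>
        2 / 3 \<le> query_success_prob A Q\<^sub>0 Q\<^sub>1 (Lambda \<alpha> \<rho> (uniform_on_support \<rho>)) \<epsilon>)"

text \<open>The infimum is taken in \<^typ>\<open>enat\<close>, so that it is \<open>\<infinity>\<close> if there is no algorithm.\<close>

definition query_complexity :: "real \<Rightarrow> real \<Rightarrow> nat \<Rightarrow> nat \<Rightarrow> nat \<Rightarrow> nat \<Rightarrow> enat" where
  "query_complexity \<alpha> \<epsilon> n r a b =
     Inf {enat (length (steps A)) | A. query_estimator \<alpha> \<epsilon> n r a b A}"


section \<open>Sample access\<close>

text \<open>
  A sample algorithm performs a POVM with elements \<open>effect i\<close>, \<open>i < outcomes\<close>, jointly on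
  \<open>state_copies\<close> copies of \<open>\<rho>\<close> and \<open>uniform_copies\<close> copies of the uniform state.
\<close>

record sample_algorithm =
  state_copies :: nat
  uniform_copies :: nat
  outcomes :: nat
  effect :: "nat \<Rightarrow> complex mat"
  estimate_of :: "nat \<Rightarrow> real"

definition copies :: "sample_algorithm \<Rightarrow> nat" where
  "copies A = state_copies A + uniform_copies A"

definition povm :: "nat \<Rightarrow> nat \<Rightarrow> (nat \<Rightarrow> complex mat) \<Rightarrow> bool" where
  "povm d m E \<longleftrightarrow> (\<forall>i<m. psd_mat d (E i)) \<and> mat d d (\<lambda>ij. \<Sum>i<m. E i $$ ij) = 1\<^sub>m d"

definition sample_success_prob ::
    "sample_algorithm \<Rightarrow> complex mat \<Rightarrow> complex mat \<Rightarrow> real \<Rightarrow> real \<Rightarrow> real" where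
  "sample_success_prob A \<rho>\<^sub>0 \<rho>\<^sub>1 x \<epsilon> =
     (\<Sum>i \<in> {i. i < outcomes A \<and> \<bar>estimate_of A i - x\<bar> \<le> \<epsilon>}.
        Re (trace (effect A i *
          kron (kron_power \<rho>\<^sub>0 (state_copies A)) (kron_power \<rho>\<^sub>1 (uniform_copies A)))))"

definition sample_estimator ::
    "real \<Rightarrow> real \<Rightarrow> nat \<Rightarrow> nat \<Rightarrow> sample_algorithm \<Rightarrow> bool" where
  "sample_estimator \<alpha> \<epsilon> n r A \<longleftrightarrow> povm ((2 ^ n) ^ copies A) (outcomes A) (effect A) \<and>
     (\<forall>\<rho>. admissible_state n r \<rho> \<longrightarrow>
        2 / 3 \<le> sample_success_prob A \<rho> (uniform_on_support \<rho>)
                  (Lambda \<alpha> \<rho> (uniform_on_support \<rho>)) \<epsilon>)"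

definition sample_complexity :: "real \<Rightarrow> real \<Rightarrow> nat \<Rightarrow> nat \<Rightarrow> enat" where
  "sample_complexity \<alpha> \<epsilon> n r = Inf {enat (copies A) | A. sample_estimator \<alpha> \<epsilon> n r A}"

end

theory Submission
  imports Defs "HOL-Analysis.L2_Norm"
begin

text \<open>
  Both bounds compare the uniform state on the first \<open>r\<close> basis vectors with perturbations of relative size
  \<open>\<delta> \<approx> \<epsilon>\<^sup>1\<^sup>/\<^sup>\<alpha> r\<^sup>1\<^sup>-\<^sup>1\<^sup>/\<^sup>\<alpha>\<close>, which is the size at which \<open>\<Lambda>\<^sub>\<alpha>\<close> moves by more than \<open>2 \<epsilon>\<close>.

  Queries: a diagonal perturbation and the uniform state have purifications at distance \<open>O(\<delta>)\<close>, prepared by reflections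
  at Frobenius distance \<open>O(\<delta>)\<close>. Each query moves the state of the algorithm by at most that much, so
  \<open>\<Omega>(1 / \<delta>)\<close> queries are necessary.

  Samples: conjugate a Hadamard matrix by a random diagonal sign matrix to obtain an involution \<open>B\<close> and use the state
  \<open>(\<Pi> + \<delta> B) / r\<close>. Two independent such involutions have Hilbert--Schmidt inner product \<open>(\<Sum>\<^sub>x u\<^sub>x)\<^sup>2 / D\<close> with random signs
  \<open>u\<close>, which is of order \<open>1\<close> instead of the worst case \<open>D\<close>. Therefore the \<open>\<chi>\<^sup>2\<close> distance between
  the average of \<open>N\<close> copies and the uniform state is about \<open>exp (2 N \<delta>\<^sup>2 / r) - 1\<close>, and \<open>\<Omega>(r / \<delta>\<^sup>2)\<close> copies are necessary.
\<close>

section \<open>Matrices and their adjoints\<close>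

text \<open>All states compared have the same support, so the uniform state, its oracle and its
  copies are common to both hypotheses and only the access to \<rho> can tell them apart. Two fixed
  states at relative distance \<delta> may be distinguished with about 1/\<delta>^2 copies; the
  extra factor r of the sample bound therefore requires an ensemble hidden behind its average. The
  constants come from a conflict: the perturbed states have to keep rank exactly r, which is ensured
  by \<delta> < 1, while \<Lambda>_\<alpha> has to exceed 2 \<epsilon>. Writing r
  (\<delta>/r)^\<alpha> = K \<epsilon>, the query bound has room for a K above 4 with \<delta> < 1
  throughout. Sylvester matrices only have orders 2^m, and the largest such block inside the support
  may barely exceed r/2. This costs a factor 2 and leads to K = 8; then \<delta> < 1 may fail, but
  only for r bounded in terms of \<alpha>, where it is enough that one copy is needed.\<close>

lemma index_mult_mat_sum:
  assumes "A \<in> carrier_mat m k" "B \<in> carrier_mat k n" "i < m" "j < n"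
  shows "(A * B) $$ (i, j) = (\<Sum>l<k. A $$ (i, l) * B $$ (l, j))"
  using assms by (auto simp: scalar_prod_def atLeast0LessThan intro!: sum.cong)

lemma index_mult_mat_vec_sum:
  assumes "A \<in> carrier_mat m n" "v \<in> carrier_vec n" "i < m"
  shows "(A *\<^sub>v v) $ i = (\<Sum>j<n. A $$ (i, j) * v $ j)"
  using assms by (auto simp: scalar_prod_def atLeast0LessThan intro!: sum.cong)

lemma cscalar_prod_sum:
  fixes v w :: "complex vec"
  assumes "v \<in> carrier_vec n" "w \<in> carrier_vec n"
  shows "v \<bullet>c w = (\<Sum>i<n. v $ i * cnj (w $ i))"
  using assms by (auto simp: scalar_prod_def atLeast0LessThan intro!: sum.cong)

lemma dim_mat_adjoint [simp]:
  "dim_row (mat_adjoint A) = dim_col A" "dim_col (mat_adjoint A) = dim_row A"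
  by (simp_all add: mat_adjoint_def)

lemma mat_adjoint_carrier [simp]:
  "A \<in> carrier_mat m n \<Longrightarrow> mat_adjoint A \<in> carrier_mat n m"
  by (auto intro: carrier_matI)

lemma index_mat_adjoint [simp]:
  fixes A :: "complex mat"
  assumes "i < dim_col A" "j < dim_row A"
  shows "mat_adjoint A $$ (i, j) = cnj (A $$ (j, i))"
  using assms by (simp add: mat_adjoint_def mat_of_rows_def)

lemma mat_adjoint_mat_adjoint [simp]:
  fixes A :: "complex mat"
  shows "mat_adjoint (mat_adjoint A) = A"
  by (rule eq_matI) auto

lemma mat_adjoint_one [simp]: "mat_adjoint (1\<^sub>m d) = (1\<^sub>m d :: complex mat)"
  by (rule eq_matI) auto

lemma mat_adjoint_diag: "mat_adjoint (mat_diag d f) = mat_diag d (\<lambda>i. cnj (f i))"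
  by (rule eq_matI) (auto simp: mat_diag_def)

lemma mat_adjoint_mult:
  fixes A B :: "complex mat"
  assumes "A \<in> carrier_mat m k" "B \<in> carrier_mat k n"
  shows "mat_adjoint (A * B) = mat_adjoint B * mat_adjoint A"
proof (rule eq_matI)
  fix i j assume "i < dim_row (mat_adjoint B * mat_adjoint A)" "j < dim_col (mat_adjoint B * mat_adjoint A)"
  hence ij: "i < n" "j < m" using assms by auto
  have "mat_adjoint (A * B) $$ (i, j) = cnj ((A * B) $$ (j, i))"
    using ij assms by (subst index_mat_adjoint) auto
  also have "\<dots> = (\<Sum>l<k. cnj (A $$ (j, l)) * cnj (B $$ (l, i)))"
    using ij by (simp add: index_mult_mat_sum[OF assms])
  also have "\<dots> = (mat_adjoint B * mat_adjoint A) $$ (i, j)"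
    using ij assms
    by (subst index_mult_mat_sum[of _ n k _ m]) (auto intro!: sum.cong)
  finally show "mat_adjoint (A * B) $$ (i, j) = (mat_adjoint B * mat_adjoint A) $$ (i, j)" .
qed (use assms in auto)

lemma cscalar_prod_mat_adjoint:
  fixes A :: "complex mat"
  assumes "A \<in> carrier_mat m n" "v \<in> carrier_vec n" "w \<in> carrier_vec m"
  shows "(A *\<^sub>v v) \<bullet>c w = v \<bullet>c (mat_adjoint A *\<^sub>v w)"
proof -
  have "(A *\<^sub>v v) \<bullet>c w = (\<Sum>i<m. \<Sum>j<n. A $$ (i, j) * v $ j * cnj (w $ i))"
    using assms by (subst cscalar_prod_sum[of _ m])
      (auto simp: index_mult_mat_vec_sum[OF assms(1,2)] sum_distrib_right simp del: index_mult_mat_vec intro!: sum.cong)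
  also have "\<dots> = (\<Sum>j<n. \<Sum>i<m. A $$ (i, j) * v $ j * cnj (w $ i))"
    by (rule sum.swap)
  also have "\<dots> = (\<Sum>j<n. v $ j * cnj (\<Sum>i<m. mat_adjoint A $$ (j, i) * w $ i))"
    using assms by (auto simp: sum_distrib_left mult_ac intro!: sum.cong)
  also have "\<dots> = v \<bullet>c (mat_adjoint A *\<^sub>v w)"
    using assms mult_mat_vec_carrier[OF mat_adjoint_carrier[OF assms(1)] assms(3)]
    by (subst cscalar_prod_sum[of _ n])
      (auto simp: index_mult_mat_vec_sum[of _ n m] simp del: index_mult_mat_vec intro!: sum.cong)
  finally show ?thesis .
qed


section \<open>Functional calculus\<close>

text \<open>The description operator needs uniqueness. Comparing entries of
  \<open>?D x * U = U * ?D e\<close> shows that \<open>U $$ (i, j)\<close> vanishes unless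
  \<open>x i = e j\<close>, and then the same identity holds after f is applied to both
  spectra.\<close>

lemma spectral_map_diag:
  "spectral_map f (mat_diag d (\<lambda>i. complex_of_real (x i))) = mat_diag d (\<lambda>i. complex_of_real (f (x i)))"
proof -
  let ?D = "\<lambda>y. mat_diag d (\<lambda>i. complex_of_real (y i))"
  have dim: "dim_row (?D x) = d" by (simp add: mat_diag_def)
  show ?thesis unfolding spectral_map_def dim
  proof (rule the_equality)
    show "\<exists>U da. unitary_mat d U \<and> ?D x = U * ?D da * mat_adjoint U \<and>
       ?D (\<lambda>i. f (x i)) = U * ?D (\<lambda>i. f (da i)) * mat_adjoint U"
      by (intro exI[of _ "1\<^sub>m d"] exI[of _ x]) (auto simp: unitary_mat_def left_mult_one_mat[OF mat_diag_dim] right_mult_one_mat[OF mat_diag_dim])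
  next
    fix B assume "\<exists>U e. unitary_mat d U \<and> ?D x = U * ?D e * mat_adjoint U \<and>
       B = U * ?D (\<lambda>i. f (e i)) * mat_adjoint U"
    then obtain U e where U: "unitary_mat d U" and x: "?D x = U * ?D e * mat_adjoint U"
      and B: "B = U * ?D (\<lambda>i. f (e i)) * mat_adjoint U" by blast
    have Uc [simp]: "U \<in> carrier_mat d d" and U1: "mat_adjoint U * U = 1\<^sub>m d"
      and U2: "U * mat_adjoint U = 1\<^sub>m d" using U by (auto simp: unitary_mat_def)
    have "?D x * U = U * ?D e * (mat_adjoint U * U)"
      unfolding x by (rule assoc_mult_mat[of _ d d _ d _ d]) (auto intro!: mult_carrier_mat[of _ d d])
    hence eq: "?D x * U = U * ?D e" using right_mult_one_mat[of "U * ?D e" d d] mult_carrier_mat[of U d d "?D e" d] by (simp add: U1)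
    have "U * ?D (\<lambda>i. f (e i)) = ?D (\<lambda>i. f (x i)) * U"
    proof (rule eq_matI)
      fix i j assume "i < dim_row (?D (\<lambda>i. f (x i)) * U)" "j < dim_col (?D (\<lambda>i. f (x i)) * U)"
      hence ij: "i < d" "j < d" using carrier_matD(2)[OF Uc] by (auto simp: mat_diag_def)
      have "complex_of_real (x i) * U $$ (i, j) = U $$ (i, j) * complex_of_real (e j)"
        using arg_cong[OF eq, of "\<lambda>M. M $$ (i, j)"] ij
        by (simp add: mat_diag_mult_left[OF Uc] mat_diag_mult_right[OF Uc])
      hence "U $$ (i, j) = 0 \<or> x i = e j" by auto
      thus "(U * ?D (\<lambda>i. f (e i))) $$ (i, j) = (?D (\<lambda>i. f (x i)) * U) $$ (i, j)"
        using ij by (auto simp: mat_diag_mult_left[OF Uc] mat_diag_mult_right[OF Uc])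
    qed (use carrier_matD[OF Uc] in \<open>auto simp: mat_diag_def\<close>)
    hence "B = ?D (\<lambda>i. f (x i)) * U * mat_adjoint U" by (simp add: B)
    also have "\<dots> = ?D (\<lambda>i. f (x i)) * (U * mat_adjoint U)"
      by (rule assoc_mult_mat[of _ d d _ d _ d]) auto
    finally show "B = ?D (\<lambda>i. f (x i))" by (simp add: U2 right_mult_one_mat[OF mat_diag_dim])
  qed
qed

text \<open>Only the square of the difference has to be diagonal, because \<open>mat_abs\<close>
  starts from \<open>mat_adjoint A * A\<close>. This covers the Hadamard perturbations, which are
  not diagonal themselves, without diagonalizing them.\<close>

lemma Lambda_eq_sum:
  assumes "mat_adjoint (\<rho> - \<sigma>) * (\<rho> - \<sigma>) = mat_diag d (\<lambda>i. complex_of_real ((x i)\<^sup>2))"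
  shows "Lambda \<alpha> \<rho> \<sigma> = 1 / 2 * (\<Sum>i<d. \<bar>x i\<bar> powr \<alpha>)"
proof -
  have "((x i)\<^sup>2) powr (1 / 2) = \<bar>x i\<bar>" for i
    by (simp add: powr_half_sqrt)
  hence "mat_abs (\<rho> - \<sigma>) = mat_diag d (\<lambda>i. complex_of_real \<bar>x i\<bar>)"
    unfolding mat_abs_def mat_powr_def assms spectral_map_diag by presburger
  hence "mat_powr (mat_abs (\<rho> - \<sigma>)) \<alpha> = mat_diag d (\<lambda>i. complex_of_real (\<bar>x i\<bar> powr \<alpha>))"
    by (simp only: mat_powr_def spectral_map_diag)
  thus ?thesis
    by (simp add: Lambda_def trace_def mat_diag_def)
qed


section \<open>Rank and support from the kernel\<close>

abbreviation leading_projector :: "nat \<Rightarrow> nat \<Rightarrow> complex mat" where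
  "leading_projector d r \<equiv> mat_diag d (\<lambda>i. if i < r then 1 else 0)"

lemma mat_diag_mult_vec:
  "v \<in> carrier_vec d \<Longrightarrow> mat_diag d f *\<^sub>v v = vec d (\<lambda>i. f i * v $ i)"
  by (rule eq_vecI) (auto simp: mat_diag_def scalar_prod_def if_distrib[of "\<lambda>x. x * _"] cong: if_cong)

lemma mat_eq_by_mult_vec:
  fixes A B :: "complex mat"
  assumes A: "A \<in> carrier_mat m n" and B: "B \<in> carrier_mat m n"
    and eq: "\<And>v. v \<in> carrier_vec n \<Longrightarrow> A *\<^sub>v v = B *\<^sub>v v"
  shows "A = B"
proof (rule eq_matI)
  fix i j assume ij: "i < dim_row B" "j < dim_col B"
  have "(A *\<^sub>v unit_vec n j) $ i = (B *\<^sub>v unit_vec n j) $ i" by (simp add: eq)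
  thus "A $$ (i, j) = B $$ (i, j)" using ij A B by simp
qed (use A B in auto)

text \<open>Equal ranges give \<open>Q * P = P\<close> and \<open>P * Q = Q\<close>; the adjoint of
  the first identity is \<open>P = P * Q\<close>.\<close>

lemma hermitian_idempotent_eqI:
  fixes P Q :: "complex mat"
  assumes P: "P \<in> carrier_mat d d" "mat_adjoint P = P" "P * P = P"
    and Q: "Q \<in> carrier_mat d d" "mat_adjoint Q = Q" "Q * Q = Q"
    and range: "(\<lambda>v. P *\<^sub>v v) ` carrier_vec d = (\<lambda>v. Q *\<^sub>v v) ` carrier_vec d"
  shows "P = Q"
proof -
  have absorb: "B * A = A" if A: "A \<in> carrier_mat d d" and B: "B \<in> carrier_mat d d" "B * B = B"
    and sub: "(\<lambda>v. A *\<^sub>v v) ` carrier_vec d \<subseteq> (\<lambda>v. B *\<^sub>v v) ` carrier_vec d" for A B :: "complex mat"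
  proof (rule mat_eq_by_mult_vec)
    show "B * A \<in> carrier_mat d d" "A \<in> carrier_mat d d" using A B by auto
    fix v :: "complex vec" assume v: "v \<in> carrier_vec d"
    then obtain w where w: "w \<in> carrier_vec d" "A *\<^sub>v v = B *\<^sub>v w" using sub by blast
    have "(B * A) *\<^sub>v v = B *\<^sub>v (B *\<^sub>v w)" using A B v w by (simp add: assoc_mult_mat_vec[of B d d A d])
    also have "\<dots> = A *\<^sub>v v" using B w by (simp flip: assoc_mult_mat_vec[of B d d B d])
    finally show "(B * A) *\<^sub>v v = A *\<^sub>v v" .
  qed
  have "P = mat_adjoint (Q * P)" using absorb[of P Q] P Q range by simp
  also have "\<dots> = P * Q" using P Q by (simp add: mat_adjoint_mult[of Q d d P d])
  also have "\<dots> = Q" using absorb[of Q P] P Q range by simp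
  finally show ?thesis .
qed

text \<open>By \<open>ker\<close>, the kernel is spanned by the unit vectors with index at least r,
  and orthogonality to these is the vanishing of the corresponding coordinates.\<close>

lemma support_eq:
  assumes A: "A \<in> carrier_mat d d" and r: "r \<le> d"
    and ker: "\<And>v. v \<in> carrier_vec d \<Longrightarrow> A *\<^sub>v v = 0\<^sub>v d \<longleftrightarrow> (\<forall>i<r. v $ i = 0)"
  shows "support A = {v \<in> carrier_vec d. \<forall>i<d. r \<le> i \<longrightarrow> v $ i = 0}"
proof -
  have "(\<forall>w \<in> carrier_vec d. A *\<^sub>v w = 0\<^sub>v d \<longrightarrow> v \<bullet>c w = 0) \<longleftrightarrow> (\<forall>i<d. r \<le> i \<longrightarrow> v $ i = 0)"
    (is "?L \<longleftrightarrow> ?R") if v: "v \<in> carrier_vec d" for v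
  proof
    assume L: ?L
    show ?R
    proof (intro allI impI)
      fix i assume i: "i < d" "r \<le> i"
      have "A *\<^sub>v unit_vec d i = 0\<^sub>v d" using i by (subst ker) auto
      hence "v \<bullet>c unit_vec d i = 0" using L by auto
      thus "v $ i = 0" using i v
        by (simp add: cscalar_prod_sum[of _ d] unit_vec_def if_distrib[of cnj] if_distrib[of "\<lambda>x. _ * x"] cong: if_cong)
    qed
  next
    assume R: ?R
    show ?L
    proof (intro ballI impI)
      fix w :: "complex vec" assume w: "w \<in> carrier_vec d" "A *\<^sub>v w = 0\<^sub>v d"
      hence "w $ i = 0" if "i < r" for i using ker[OF w(1)] that by auto
      thus "v \<bullet>c w = 0" using v w R
        by (subst cscalar_prod_sum[of _ d]) (auto intro!: sum.neutral simp: not_less[symmetric])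
    qed
  qed
  thus ?thesis using A by (auto simp: support_def)
qed

lemma support_projector_eq:
  assumes A: "A \<in> carrier_mat d d" and r: "r \<le> d"
    and ker: "\<And>v. v \<in> carrier_vec d \<Longrightarrow> A *\<^sub>v v = 0\<^sub>v d \<longleftrightarrow> (\<forall>i<r. v $ i = 0)"
  shows "support_projector A = leading_projector d r"
proof -
  let ?P = "leading_projector d r"
  have P: "?P \<in> carrier_mat d d" "mat_adjoint ?P = ?P" "?P * ?P = ?P"
    by (auto simp: mat_adjoint_diag if_distrib cong: if_cong)
  have "(\<lambda>v. ?P *\<^sub>v v) ` carrier_vec d = {v \<in> carrier_vec d. \<forall>i<d. r \<le> i \<longrightarrow> v $ i = 0}"
  proof (intro equalityI subsetI)
    fix v assume "v \<in> (\<lambda>v. ?P *\<^sub>v v) ` carrier_vec d"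
    thus "v \<in> {v \<in> carrier_vec d. \<forall>i<d. r \<le> i \<longrightarrow> v $ i = 0}"
      by (auto simp: mat_diag_mult_vec)
  next
    fix v :: "complex vec" assume "v \<in> {v \<in> carrier_vec d. \<forall>i<d. r \<le> i \<longrightarrow> v $ i = 0}"
    hence "v \<in> carrier_vec d" "?P *\<^sub>v v = v" by (auto simp: mat_diag_mult_vec intro!: eq_vecI)
    thus "v \<in> (\<lambda>v. ?P *\<^sub>v v) ` carrier_vec d" by (metis imageI)
  qed
  hence range: "(\<lambda>v. ?P *\<^sub>v v) ` carrier_vec d = support A" by (simp add: support_eq[OF assms])
  have "dim_col A = d" using A by simp
  thus ?thesis unfolding support_projector_def using P range
    by (intro the_equality) (simp_all add: hermitian_idempotent_eqI[of _ d ?P])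
qed

text \<open>The rank is the size of a maximal independent set of columns. The first r columns are
  distinct and independent because the kernel contains no nonzero vector supported on those
  coordinates; the other columns vanish, so nothing can be added.\<close>

lemma rank_eq:
  assumes A: "A \<in> carrier_mat d d" and r: "r \<le> d"
    and ker: "\<And>v. v \<in> carrier_vec d \<Longrightarrow> A *\<^sub>v v = 0\<^sub>v d \<longleftrightarrow> (\<forall>i<r. v $ i = 0)"
  shows "mat_rank A = r"
proof -
  interpret V: vec_space "TYPE(complex)" d .
  have col_eq: "A *\<^sub>v unit_vec d i = col A i" if "i < d" for i
    using A that by (intro eq_vecI) auto
  define B where "B = mat d r (\<lambda>(i, j). A $$ (i, j))"
  have B: "B \<in> carrier_mat d r" by (simp add: B_def)
  have col_B: "col B i = col A i" if "i < r" for i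
    using that A r by (intro eq_vecI) (auto simp: B_def)
  have mult_B: "B *\<^sub>v v = A *\<^sub>v vec d (\<lambda>i. if i < r then v $ i else 0)" if "v \<in> carrier_vec r" for v
  proof (rule eq_vecI)
    fix i assume "i < dim_vec (A *\<^sub>v vec d (\<lambda>i. if i < r then v $ i else 0))"
    hence i: "i < d" using A by auto
    have "(\<Sum>j<d. A $$ (i, j) * (if j < r then v $ j else 0)) = (\<Sum>j<r. A $$ (i, j) * v $ j)"
      using r by (intro sum.mono_neutral_cong_right) auto
    thus "(B *\<^sub>v v) $ i = (A *\<^sub>v vec d (\<lambda>i. if i < r then v $ i else 0)) $ i"
      using i that r
      by (simp add: index_mult_mat_vec_sum[OF B that i] index_mult_mat_vec_sum[OF A _ i] del: index_mult_mat_vec)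
        (simp add: B_def)
  qed (use A B in auto)
  have dist: "distinct (cols B)"
  proof -
    have "i = j" if "i < r" "j < r" "col B i = col B j" for i j
    proof (rule ccontr)
      assume "i \<noteq> j"
      have "A *\<^sub>v (unit_vec d i - unit_vec d j) = 0\<^sub>v d"
        using that r A minus_cancel_vec[of "col B j" d] B
        by (simp add: mult_minus_distrib_mat_vec[OF A] col_eq col_B[symmetric])
      hence "(unit_vec d i - unit_vec d j) $ i = (0::complex)"
        using that r ker[OF minus_carrier_vec[OF unit_vec_carrier[of d i] unit_vec_carrier[of d j]]] by blast
      thus False using that r \<open>i \<noteq> j\<close> by auto
    qed
    thus ?thesis using B by (auto simp: distinct_conv_nth cols_def)
  qed
  have indep: "V.lin_indpt (set (cols B))"
  proof
    assume "V.lin_dep (set (cols B))"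
    then obtain v where v: "v \<in> carrier_vec r" "v \<noteq> 0\<^sub>v r" "B *\<^sub>v v = 0\<^sub>v d"
      using V.lin_depE[OF B _ dist] by blast
    hence "\<forall>i<r. vec d (\<lambda>i. if i < r then v $ i else 0) $ i = 0"
      using ker[of "vec d (\<lambda>i. if i < r then v $ i else 0)"] mult_B by auto
    hence "v = 0\<^sub>v r" using v(1) r by (intro eq_vecI) auto
    thus False using v by simp
  qed
  have sub: "set (cols B) \<subseteq> set (cols A)"
    using A B r by (auto simp: cols_def col_B)
  have zero: "col A i = 0\<^sub>v d" if "r \<le> i" "i < d" for i
    using ker[of "unit_vec d i"] that by (auto simp: col_eq)
  have sup: "set (cols A) \<subseteq> insert (0\<^sub>v d) (set (cols B))"
  proof
    fix c assume "c \<in> set (cols A)"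
    then obtain i where i: "i < d" "c = col A i" using A by (auto simp: cols_def)
    show "c \<in> insert (0\<^sub>v d) (set (cols B))"
    proof (cases "i < r")
      case True
      hence "c = col B i" by (simp add: i col_B)
      thus ?thesis using True B by (auto simp: cols_def)
    qed (use i zero in auto)
  qed
  have "maximal (set (cols B)) (\<lambda>T. T \<subseteq> set (cols A) \<and> V.lin_indpt T)"
    unfolding maximal_def
  proof (intro conjI allI impI)
    fix T assume T: "set (cols B) \<subseteq> T \<and> T \<subseteq> set (cols A) \<and> V.lin_indpt T"
    moreover have "T \<subseteq> carrier_vec d" using T cols_dim[of A] A by auto
    moreover have "(UNIV :: complex set) \<noteq> {0}" by (metis UNIV_I singletonD zero_neq_one)
    ultimately have "0\<^sub>v d \<notin> T" using V.zero_nin_lin_indpt[of T] by auto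
    thus "T = set (cols B)" using T sup by auto
  qed (use sub indep in auto)
  hence "V.rank A = card (set (cols B))" by (rule V.rank_card_indpt[OF A])
  also have "\<dots> = r" using dist B by (simp add: distinct_card)
  finally show ?thesis using A by simp
qed

lemma uniform_on_support_eq:
  assumes "A \<in> carrier_mat d d" and "r \<le> d"
    and "\<And>v. v \<in> carrier_vec d \<Longrightarrow> A *\<^sub>v v = 0\<^sub>v d \<longleftrightarrow> (\<forall>i<r. v $ i = 0)"
  shows "uniform_on_support A = mat_diag d (\<lambda>i. if i < r then complex_of_real (1 / r) else 0)"
proof -
  have "mat_rank A = r" by (rule rank_eq[OF assms])
  moreover have "support_projector A = leading_projector d r" by (rule support_projector_eq[OF assms])
  ultimately show ?thesis unfolding uniform_on_support_def by (intro eq_matI) (auto simp: mat_diag_def)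
qed

section \<open>Tensor products and the Hilbert--Schmidt inner product\<close>

text \<open>Splits the index of a composite system into its two digits; sums over tensor products
  are turned into double sums by it.\<close>

lemma sum_div_mod:
  fixes f :: "nat \<Rightarrow> nat \<Rightarrow> 'a :: comm_monoid_add"
  shows "(\<Sum>k<a * b. f (k div b) (k mod b)) = (\<Sum>i<a. \<Sum>j<b. f i j)"
proof -
  have "(\<Sum>k<a * b. f (k div b) (k mod b)) = (\<Sum>i<a. \<Sum>k = i * b..<i * b + b. f (k div b) (k mod b))"
    by (rule sum.nat_group[symmetric])
  also have "\<dots> = (\<Sum>i<a. \<Sum>j<b. f i j)"
  proof (rule sum.cong[OF refl])
    fix i
    have "(\<Sum>k = i * b..<i * b + b. f (k div b) (k mod b)) = (\<Sum>j = 0..<b. f ((j + i * b) div b) ((j + i * b) mod b))"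
      using sum.shift_bounds_nat_ivl[of "\<lambda>k. f (k div b) (k mod b)" 0 "i * b" b] by (simp add: add.commute)
    thus "(\<Sum>k = i * b..<i * b + b. f (k div b) (k mod b)) = (\<Sum>j<b. f i j)"
      by (auto simp: atLeast0LessThan intro!: sum.cong)
  qed
  finally show ?thesis .
qed

lemma div_mod_less_mult:
  assumes "(i::nat) < a * b"
  shows "i div b < a" "i mod b < b" "0 < b"
proof -
  show "0 < b" using assms by (cases b) auto
  thus "i mod b < b" by simp
  show "i div b < a" using assms by (simp add: less_mult_imp_div_less)
qed

lemma dim_kron [simp]:
  "dim_row (kron A B) = dim_row A * dim_row B" "dim_col (kron A B) = dim_col A * dim_col B"
  by (simp_all add: kron_def)

lemma kron_carrier [simp]:
  "A \<in> carrier_mat a a' \<Longrightarrow> B \<in> carrier_mat b b' \<Longrightarrow> kron A B \<in> carrier_mat (a * b) (a' * b')"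
  by (auto intro!: carrier_matI)

lemma index_kron:
  assumes "A \<in> carrier_mat a a'" "B \<in> carrier_mat b b'" "i < a * b" "j < a' * b'"
  shows "kron A B $$ (i, j) = A $$ (i div b, j div b') * B $$ (i mod b, j mod b')"
  using assms by (simp add: kron_def)

lemma kron_mult:
  assumes A: "A \<in> carrier_mat a a'" and B: "B \<in> carrier_mat b b'"
    and C: "C \<in> carrier_mat a' a''" and D: "D \<in> carrier_mat b' b''"
  shows "kron A B * kron C D = kron (A * C) (B * D)"
proof (rule eq_matI)
  have AC: "A * C \<in> carrier_mat a a''" and BD: "B * D \<in> carrier_mat b b''" using assms by auto
  fix i j assume "i < dim_row (kron (A * C) (B * D))" "j < dim_col (kron (A * C) (B * D))"
  hence i: "i < a * b" and j: "j < a'' * b''" using assms by auto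
  note i' = div_mod_less_mult[OF i] and j' = div_mod_less_mult[OF j]
  have "(kron A B * kron C D) $$ (i, j) = (\<Sum>k<a' * b'. kron A B $$ (i, k) * kron C D $$ (k, j))"
    by (rule index_mult_mat_sum[of _ "a * b" _ _ "a'' * b''"]) (use assms i j in auto)
  also have "\<dots> = (\<Sum>k<a' * b'. (\<lambda>u v. A $$ (i div b, u) * B $$ (i mod b, v) *
      (C $$ (u, j div b'') * D $$ (v, j mod b''))) (k div b') (k mod b'))"
    using i j by (intro sum.cong) (simp_all add: index_kron[OF A B] index_kron[OF C D])
  also have "\<dots> = (\<Sum>u<a'. \<Sum>v<b'. A $$ (i div b, u) * B $$ (i mod b, v) * (C $$ (u, j div b'') * D $$ (v, j mod b'')))"
    by (rule sum_div_mod)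
  also have "\<dots> = (A * C) $$ (i div b, j div b'') * (B * D) $$ (i mod b, j mod b'')"
    using i' j' by (simp add: index_mult_mat_sum[OF A C] index_mult_mat_sum[OF B D] sum_product ac_simps del: index_mult_mat(1))
  also have "\<dots> = kron (A * C) (B * D) $$ (i, j)" using i j by (simp add: index_kron[OF AC BD])
  finally show "(kron A B * kron C D) $$ (i, j) = kron (A * C) (B * D) $$ (i, j)" .
qed (use assms in auto)

lemma mat_adjoint_kron: "mat_adjoint (kron A B) = kron (mat_adjoint A) (mat_adjoint B)"
proof (rule eq_matI)
  fix i j
  assume "i < dim_row (kron (mat_adjoint A) (mat_adjoint B))" "j < dim_col (kron (mat_adjoint A) (mat_adjoint B))"
  hence "i < dim_col A * dim_col B" "j < dim_row A * dim_row B" by auto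
  with this[THEN div_mod_less_mult(1)] this[THEN div_mod_less_mult(2)]
  show "mat_adjoint (kron A B) $$ (i, j) = kron (mat_adjoint A) (mat_adjoint B) $$ (i, j)"
    by (simp add: kron_def)
qed auto

lemma kron_smult: "kron (c \<cdot>\<^sub>m A) (e \<cdot>\<^sub>m B) = (c * e) \<cdot>\<^sub>m kron A B"
proof (rule eq_matI)
  fix i j assume "i < dim_row ((c * e) \<cdot>\<^sub>m kron A B)" "j < dim_col ((c * e) \<cdot>\<^sub>m kron A B)"
  hence "i < dim_row A * dim_row B" "j < dim_col A * dim_col B" by auto
  with this[THEN div_mod_less_mult(1)] this[THEN div_mod_less_mult(2)]
  show "kron (c \<cdot>\<^sub>m A) (e \<cdot>\<^sub>m B) $$ (i, j) = ((c * e) \<cdot>\<^sub>m kron A B) $$ (i, j)"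
    by (simp add: kron_def)
qed auto

lemma kron_one: "kron (1\<^sub>m a) (1\<^sub>m b) = 1\<^sub>m (a * b)"
proof (rule eq_matI)
  fix i j assume ij: "i < dim_row (1\<^sub>m (a * b))" "j < dim_col (1\<^sub>m (a * b))"
  have "i div b = j div b \<and> i mod b = j mod b \<longleftrightarrow> i = j" by (metis div_mult_mod_eq)
  moreover have "kron (1\<^sub>m a) (1\<^sub>m b) $$ (i, j) =
      (if i div b = j div b then 1 else 0) * (if i mod b = j mod b then 1 else 0)"
    using ij div_mod_less_mult[of i a b] div_mod_less_mult[of j a b] by (simp add: kron_def)
  ultimately show "kron (1\<^sub>m a) (1\<^sub>m b) $$ (i, j) = 1\<^sub>m (a * b) $$ (i, j)"
    using ij by (cases "i = j") auto
qed auto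

definition hs_inner :: "complex mat \<Rightarrow> complex mat \<Rightarrow> complex" where
  "hs_inner A B = (\<Sum>i<dim_row A. \<Sum>j<dim_col A. A $$ (i, j) * cnj (B $$ (i, j)))"

lemma hs_inner_kron:
  assumes A: "A \<in> carrier_mat a a'" and B: "B \<in> carrier_mat b b'"
    and C: "C \<in> carrier_mat a a'" and D: "D \<in> carrier_mat b b'"
  shows "hs_inner (kron A B) (kron C D) = hs_inner A C * hs_inner B D"
proof -
  let ?f = "\<lambda>i k j l. A $$ (i, j) * B $$ (k, l) * cnj (C $$ (i, j) * D $$ (k, l))"
  have "hs_inner (kron A B) (kron C D) = (\<Sum>i<a * b. \<Sum>j<a' * b'. kron A B $$ (i, j) * cnj (kron C D $$ (i, j)))"
    using assms by (simp add: hs_inner_def)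
  also have "\<dots> = (\<Sum>i<a * b. \<Sum>j<a' * b'. ?f (i div b) (i mod b) (j div b') (j mod b'))"
    by (intro sum.cong) (simp_all add: index_kron[OF A B] index_kron[OF C D])
  also have "\<dots> = (\<Sum>i<a * b. \<Sum>j<a'. \<Sum>l<b'. ?f (i div b) (i mod b) j l)"
    by (intro sum.cong refl sum_div_mod)
  also have "\<dots> = (\<Sum>i<a. \<Sum>k<b. \<Sum>j<a'. \<Sum>l<b'. ?f i k j l)"
    by (rule sum_div_mod)
  also have "\<dots> = hs_inner A C * hs_inner B D"
    using assms by (simp add: hs_inner_def sum_product ac_simps)
  finally show ?thesis .
qed

lemma trace_mult_hermitian:
  assumes A: "A \<in> carrier_mat d d" and B: "B \<in> carrier_mat d d" "mat_adjoint B = B"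
  shows "trace (A * B) = hs_inner A B"
proof -
  have "trace (A * B) = (\<Sum>i<d. \<Sum>j<d. A $$ (i, j) * B $$ (j, i))"
    using A B by (simp add: trace_def index_mult_mat_sum[OF A B(1)] del: index_mult_mat(1))
  also have "\<dots> = (\<Sum>i<d. \<Sum>j<d. A $$ (i, j) * cnj (B $$ (i, j)))"
  proof (intro sum.cong refl)
    fix i j assume "i \<in> {..<d}" "j \<in> {..<d}"
    hence "B $$ (j, i) = cnj (B $$ (i, j))" using B index_mat_adjoint[of j B i] by simp
    thus "A $$ (i, j) * B $$ (j, i) = A $$ (i, j) * cnj (B $$ (i, j))" by (rule arg_cong)
  qed
  finally show ?thesis using A by (simp add: hs_inner_def)
qed

lemma kron_power_0 [simp]: "kron_power A 0 = 1\<^sub>m 1"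
  and kron_power_Suc [simp]: "kron_power A (Suc k) = kron A (kron_power A k)"
  by (simp_all add: kron_power_def)

lemma kron_power_carrier [simp]:
  "A \<in> carrier_mat d d \<Longrightarrow> kron_power A k \<in> carrier_mat (d ^ k) (d ^ k)"
  by (induction k) auto

lemma kron_power_mult:
  assumes "A \<in> carrier_mat d d" "B \<in> carrier_mat d d"
  shows "kron_power A k * kron_power B k = kron_power (A * B) k"
proof (induction k)
  case (Suc k)
  thus ?case using assms by (simp add: kron_mult[of _ d d _ "d ^ k" "d ^ k" _ d _ "d ^ k"])
qed auto

lemma mat_adjoint_kron_power: "mat_adjoint (kron_power A k) = kron_power (mat_adjoint A) k"
  by (induction k) (auto simp: mat_adjoint_kron)

lemma kron_power_smult: "kron_power (c \<cdot>\<^sub>m A) k = c ^ k \<cdot>\<^sub>m kron_power A k"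
  by (induction k) (auto simp: kron_smult)

lemma hs_inner_kron_power:
  assumes "A \<in> carrier_mat d d" "B \<in> carrier_mat d d"
  shows "hs_inner (kron_power A k) (kron_power B k) = hs_inner A B ^ k"
proof (induction k)
  case 0
  show ?case by (simp add: hs_inner_def)
next
  case (Suc k)
  thus ?case using assms by (simp add: hs_inner_kron[of _ d d _ "d ^ k" "d ^ k"])
qed

lemma hs_inner_cols:
  assumes "A \<in> carrier_mat m n" "B \<in> carrier_mat m n"
  shows "hs_inner A B = (\<Sum>j<n. col A j \<bullet>c col B j)"
proof -
  have "hs_inner A B = (\<Sum>j<n. \<Sum>i<m. A $$ (i, j) * cnj (B $$ (i, j)))"
    using assms by (simp add: hs_inner_def) (rule sum.swap)
  thus ?thesis using assms by (simp add: cscalar_prod_sum[of _ m])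
qed

lemma cscalar_prod_self:
  fixes v :: "complex vec"
  shows "v \<bullet>c v = complex_of_real (\<Sum>i<dim_vec v. (cmod (v $ i))\<^sup>2)"
  by (simp add: cscalar_prod_sum[of _ "dim_vec v"] complex_norm_square[symmetric])

lemma hs_inner_self:
  "hs_inner A A = complex_of_real (\<Sum>i<dim_row A. \<Sum>j<dim_col A. (cmod (A $$ (i, j)))\<^sup>2)"
  by (simp add: hs_inner_def complex_norm_square[symmetric])

lemma hs_inner_cnj:
  assumes "A \<in> carrier_mat m n" "B \<in> carrier_mat m n"
  shows "hs_inner B A = cnj (hs_inner A B)"
  using assms by (simp add: hs_inner_def mult.commute)

lemma Re_hs_inner_Cauchy_Schwarz:
  assumes "A \<in> carrier_mat m n" "B \<in> carrier_mat m n"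
  shows "(Re (hs_inner A B))\<^sup>2 \<le> Re (hs_inner A A) * Re (hs_inner B B)"
proof -
  let ?I = "{..<m} \<times> {..<n}"
  let ?a = "\<lambda>x. cmod (A $$ x)" and ?b = "\<lambda>x. cmod (B $$ x)"
  have flat: "hs_inner A B = (\<Sum>x\<in>?I. A $$ x * cnj (B $$ x))"
    using assms by (simp add: hs_inner_def sum.cartesian_product case_prod_unfold)
  have sq: "Re (hs_inner C C) = (L2_set (\<lambda>x. cmod (C $$ x)) ?I)\<^sup>2" if "C \<in> carrier_mat m n" for C
    using that by (simp add: hs_inner_self L2_set_def sum_nonneg sum.cartesian_product case_prod_unfold)
  have "\<bar>Re (hs_inner A B)\<bar> \<le> (\<Sum>x\<in>?I. cmod (A $$ x * cnj (B $$ x)))"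
    unfolding flat by (rule order_trans[OF abs_Re_le_cmod norm_sum])
  also have "\<dots> \<le> L2_set ?a ?I * L2_set ?b ?I"
    using L2_set_mult_ineq[of ?a ?b ?I] by (simp add: norm_mult)
  finally have "\<bar>Re (hs_inner A B)\<bar>\<^sup>2 \<le> (L2_set ?a ?I * L2_set ?b ?I)\<^sup>2"
    by (intro power_mono) auto
  thus ?thesis using assms by (simp add: sq power_mult_distrib)
qed

section \<open>Tests\<close>

text \<open>An effect 0 \<le> E \<le> 1, the accepting part of a two-outcome measurement, with the
  upper bound phrased through quadratic forms.\<close>

definition test_mat :: "nat \<Rightarrow> complex mat \<Rightarrow> bool" where
  "test_mat d E \<longleftrightarrow> psd_mat d E \<and> (\<forall>v \<in> carrier_vec d. Re ((E *\<^sub>v v) \<bullet>c v) \<le> Re (v \<bullet>c v))"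

text \<open>
  The operator inequality \<open>E\<^sup>2 \<le> E\<close>, read off from
  \<open>E - E\<^sup>2 = E (1 - E) E + (1 - E) E (1 - E)\<close>.
\<close>

lemma test_mat_contraction:
  assumes E: "test_mat d E" and v: "v \<in> carrier_vec d"
  shows "Re ((E *\<^sub>v v) \<bullet>c (E *\<^sub>v v)) \<le> Re (v \<bullet>c v)"
proof -
  have Ec: "E \<in> carrier_mat d d" and Eh: "mat_adjoint E = E"
    and pos: "\<And>v. v \<in> carrier_vec d \<Longrightarrow> 0 \<le> Re ((E *\<^sub>v v) \<bullet>c v)"
    and le: "\<And>v. v \<in> carrier_vec d \<Longrightarrow> Re ((E *\<^sub>v v) \<bullet>c v) \<le> Re (v \<bullet>c v)"
    using E by (auto simp: test_mat_def psd_mat_def)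
  define w where "w = E *\<^sub>v v"
  define z where "z = E *\<^sub>v w"
  have c: "w \<in> carrier_vec d" "z \<in> carrier_vec d"
    using Ec v by (auto simp: w_def z_def)
  have zv: "z \<bullet>c v = w \<bullet>c w"
    using cscalar_prod_mat_adjoint[OF Ec c(1) v] by (simp add: z_def Eh w_def)
  have "E *\<^sub>v (v - w) = w - z"
    using mult_minus_distrib_mat_vec[OF Ec v c(1)] by (simp add: w_def z_def)
  hence "0 \<le> Re ((w - z) \<bullet>c (v - w))" using pos[of "v - w"] v c by simp
  also have "(w - z) \<bullet>c (v - w) = w \<bullet>c v - w \<bullet>c w - z \<bullet>c v + z \<bullet>c w"
    using v c by (simp add: cscalar_prod_sum[of _ d] algebra_simps sum.distrib sum_subtractf)
  finally have "2 * Re (w \<bullet>c w) \<le> Re (w \<bullet>c v) + Re (z \<bullet>c w)" by (simp add: zv)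
  moreover have "Re (z \<bullet>c w) \<le> Re (w \<bullet>c w)" using le[OF c(1)] by (simp add: z_def)
  moreover have "Re (w \<bullet>c v) \<le> Re (v \<bullet>c v)" using le[OF v] by (simp add: w_def)
  ultimately show ?thesis by (simp add: w_def)
qed

lemma hs_inner_test_mat_le:
  assumes E: "test_mat d E" and P: "P \<in> carrier_mat d n"
  shows "Re (hs_inner (E * P) (E * P)) \<le> Re (hs_inner P P)"
proof -
  have Ec: "E \<in> carrier_mat d d" using E by (auto simp: test_mat_def psd_mat_def)
  have "Re (hs_inner (E * P) (E * P)) = (\<Sum>j<n. Re ((E *\<^sub>v col P j) \<bullet>c (E *\<^sub>v col P j)))"
    unfolding hs_inner_cols[OF mult_carrier_mat[OF Ec P] mult_carrier_mat[OF Ec P]] Re_sum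
    by (intro sum.cong refl) (simp only: lessThan_iff col_mult2[OF Ec P])
  also have "\<dots> \<le> (\<Sum>j<n. Re (col P j \<bullet>c col P j))"
    by (rule sum_mono, rule test_mat_contraction[OF E]) (use P in auto)
  also have "\<dots> = Re (hs_inner P P)" using P by (simp add: hs_inner_cols[of _ d n])
  finally show ?thesis .
qed

text \<open>With \<open>P * P = P\<close> the trace becomes the sum of the quadratic forms of E on
  the columns of P. This suffices because the joint uniform state is a multiple of a projector, so
  no square root of a state is needed.\<close>

lemma trace_mult_projector_nonneg:
  assumes E: "psd_mat d E" and P: "P \<in> carrier_mat d d" "mat_adjoint P = P" "P * P = P"
  shows "0 \<le> Re (trace (E * P))"
proof -
  have Ec: "E \<in> carrier_mat d d" using E by (auto simp: psd_mat_def)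
  have "E * P = E * P * P" using assoc_mult_mat[OF Ec P(1) P(1)] P(3) by simp
  hence "trace (E * P) = hs_inner (E * P) P"
    using trace_mult_hermitian[of "E * P" d P] Ec P by simp
  also have "\<dots> = (\<Sum>j<d. (E *\<^sub>v col P j) \<bullet>c col P j)"
    unfolding hs_inner_cols[OF mult_carrier_mat[OF Ec P(1)] P(1)]
    by (intro sum.cong refl) (simp only: lessThan_iff col_mult2[OF Ec P(1)])
  finally show ?thesis using E P by (auto simp: psd_mat_def intro!: sum_nonneg)
qed

text \<open>Let D be the sum of the differences \<open>\<sigma> s - \<tau>\<close>. The total gap is
  at most the inner product of \<open>E * P\<close> with D, which Cauchy-Schwarz and
  \<open>hs_inner_test_mat_le\<close> bound by the norms of P and D. As every overlap with \<tau>
  equals q, the squared norm of D is the double sum of g minus q. For \<tau> = P / rank P, dividing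
  the right-hand side by \<open>(card S)\<^sup>2\<close> gives the \<chi>^2 distance of the average
  from \<tau>.\<close>

lemma chi_square_bound:
  fixes \<sigma> :: "'s \<Rightarrow> complex mat" and g :: "'s \<Rightarrow> 's \<Rightarrow> real" and q \<gamma> :: real
  assumes E: "test_mat d E" and P: "P \<in> carrier_mat d d" and S: "finite S"
    and \<tau>: "\<tau> \<in> carrier_mat d d" "mat_adjoint \<tau> = \<tau>" "P * \<tau> = \<tau>"
    and \<sigma>: "\<And>s. s \<in> S \<Longrightarrow> \<sigma> s \<in> carrier_mat d d" "\<And>s. s \<in> S \<Longrightarrow> mat_adjoint (\<sigma> s) = \<sigma> s"
      "\<And>s. s \<in> S \<Longrightarrow> P * \<sigma> s = \<sigma> s"
    and gap: "\<And>s. s \<in> S \<Longrightarrow> \<gamma> \<le> Re (trace (E * \<sigma> s)) - Re (trace (E * \<tau>))" and \<gamma>: "0 \<le> \<gamma>"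
    and q: "hs_inner \<tau> \<tau> = complex_of_real q" "\<And>s. s \<in> S \<Longrightarrow> hs_inner (\<sigma> s) \<tau> = complex_of_real q"
    and g: "\<And>s t. s \<in> S \<Longrightarrow> t \<in> S \<Longrightarrow> hs_inner (\<sigma> s) (\<sigma> t) = complex_of_real (g s t)"
  shows "(\<gamma> * card S)\<^sup>2 \<le> Re (hs_inner P P) * ((\<Sum>s\<in>S. \<Sum>t\<in>S. g s t) - (card S)\<^sup>2 * q)"
proof -
  have Ec: "E \<in> carrier_mat d d" using E by (auto simp: test_mat_def psd_mat_def)
  hence EP: "E * P \<in> carrier_mat d d" using P by auto
  define D where "D = mat d d (\<lambda>x. \<Sum>s\<in>S. \<sigma> s $$ x - \<tau> $$ x)"
  have D: "D \<in> carrier_mat d d" by (simp add: D_def)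
  have right: "hs_inner X D = (\<Sum>s\<in>S. hs_inner X (\<sigma> s) - hs_inner X \<tau>)" if X: "X \<in> carrier_mat d d" for X
  proof -
    have "hs_inner X D = (\<Sum>i<d. \<Sum>j<d. \<Sum>s\<in>S. X $$ (i, j) * cnj (\<sigma> s $$ (i, j)) - X $$ (i, j) * cnj (\<tau> $$ (i, j)))"
      using X by (simp add: hs_inner_def D_def sum_distrib_left right_diff_distrib)
    also have "\<dots> = (\<Sum>i<d. \<Sum>s\<in>S. \<Sum>j<d. X $$ (i, j) * cnj (\<sigma> s $$ (i, j)) - X $$ (i, j) * cnj (\<tau> $$ (i, j)))"
      by (rule sum.cong[OF refl], rule sum.swap)
    also have "\<dots> = (\<Sum>s\<in>S. \<Sum>i<d. \<Sum>j<d. X $$ (i, j) * cnj (\<sigma> s $$ (i, j)) - X $$ (i, j) * cnj (\<tau> $$ (i, j)))"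
      by (rule sum.swap)
    finally show ?thesis using X by (simp add: hs_inner_def sum_subtractf)
  qed
  \<comment> \<open>P fixes the states, so the test can be cut down to the support. The
    Cauchy-Schwarz factor is then \<open>hs_inner P P\<close>, a rank in the application, instead of
    the full dimension d.\<close>
  have tr: "trace (E * X) = hs_inner (E * P) X"
    if "X \<in> carrier_mat d d" "mat_adjoint X = X" "P * X = X" for X
  proof -
    have "E * X = E * P * X" using assoc_mult_mat[OF Ec P that(1)] that by simp
    thus ?thesis using trace_mult_hermitian[OF EP that(1,2)] by simp
  qed
  have "\<gamma> * card S = (\<Sum>s\<in>S. \<gamma>)" by simp
  also have "\<dots> \<le> (\<Sum>s\<in>S. Re (trace (E * \<sigma> s)) - Re (trace (E * \<tau>)))"
    by (rule sum_mono) (rule gap)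
  also have "\<dots> = Re (hs_inner (E * P) D)"
    unfolding right[OF EP] Re_sum by (rule sum.cong) (use \<sigma> \<tau> in \<open>auto simp: tr\<close>)
  finally have "(\<gamma> * card S)\<^sup>2 \<le> (Re (hs_inner (E * P) D))\<^sup>2"
    using \<gamma> by (intro power_mono) auto
  also have "\<dots> \<le> Re (hs_inner (E * P) (E * P)) * Re (hs_inner D D)"
    by (rule Re_hs_inner_Cauchy_Schwarz[OF EP D])
  also have "\<dots> \<le> Re (hs_inner P P) * Re (hs_inner D D)"
    using hs_inner_test_mat_le[OF E P] by (intro mult_right_mono) (auto simp: hs_inner_self intro!: sum_nonneg)
  also have "hs_inner D D = (\<Sum>s\<in>S. cnj (hs_inner (\<sigma> s) D) - cnj (hs_inner \<tau> D))"
    using \<sigma> \<tau> D by (simp add: right[OF D] hs_inner_cnj[of _ d d D])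
  also have "\<dots> = (\<Sum>s\<in>S. \<Sum>t\<in>S. complex_of_real (g s t) - complex_of_real q)"
  proof (rule sum.cong[OF refl])
    fix s assume s: "s \<in> S"
    have "hs_inner \<tau> (\<sigma> t) = complex_of_real q" if "t \<in> S" for t
      using hs_inner_cnj[of "\<sigma> t" d d \<tau>] \<tau> \<sigma> q that by simp
    thus "cnj (hs_inner (\<sigma> s) D) - cnj (hs_inner \<tau> D) = (\<Sum>t\<in>S. complex_of_real (g s t) - complex_of_real q)"
      using s \<sigma> \<tau> q g by (simp add: right sum_subtractf)
  qed
  also have "Re \<dots> = (\<Sum>s\<in>S. \<Sum>t\<in>S. g s t) - (card S)\<^sup>2 * q"
    by (simp add: sum_subtractf power2_eq_square)
  finally show ?thesis by simp
qed

section \<open>Random signs\<close>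

text \<open>The power series are compared term by term, using (2n)! \<ge> 2^n n!.\<close>

lemma cosh_le_exp_half_square: "cosh (x :: real) \<le> exp (x\<^sup>2 / 2)"
proof -
  \<comment> \<open>The series of cosh in \<open>cosh_converges\<close> runs over all n with zeros
    at the odd places; reindexing by 2n removes them.\<close>
  have "strict_mono (\<lambda>n::nat. 2 * n)" by (rule strict_monoI) simp
  moreover have "(if even n then x ^ n /\<^sub>R fact n else 0) = 0" if "n \<notin> range (\<lambda>n. 2 * n)" for n
    using that by (auto elim!: evenE)
  ultimately have "(\<lambda>n. x ^ (2 * n) / fact (2 * n)) sums cosh x"
    using sums_mono_reindex[of "\<lambda>n. 2 * n" "\<lambda>n. if even n then x ^ n /\<^sub>R fact n else 0" "cosh x"] cosh_converges[of x]
    by (simp add: field_simps)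
  moreover have "(\<lambda>n. (x\<^sup>2 / 2) ^ n / fact n) sums exp (x\<^sup>2 / 2)"
    using exp_converges[of "x\<^sup>2 / 2"] by (simp add: field_simps)
  moreover have "x ^ (2 * n) / fact (2 * n) \<le> (x\<^sup>2 / 2) ^ n / fact n" for n
  proof -
    have "(2::real) ^ n * fact n \<le> fact (2 * n)"
    proof (induction n)
      case (Suc n)
      have "(2::real) ^ Suc n * fact (Suc n) = (2 * real n + 2) * (2 ^ n * fact n)" by (simp add: algebra_simps)
      also have "\<dots> \<le> (2 * real n + 2) * ((2 * real n + 1) * fact (2 * n))"
        using Suc by (intro mult_left_mono) (auto intro: order_trans simp: mult_le_cancel_right1 algebra_simps)
      also have "\<dots> = fact (2 * Suc n)" by (simp add: algebra_simps)
      finally show ?case .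
    qed simp
    hence "(x\<^sup>2) ^ n / fact (2 * n) \<le> (x\<^sup>2) ^ n / (2 ^ n * fact n)"
      by (intro divide_left_mono) auto
    thus ?thesis by (simp add: power_mult power_divide)
  qed
  ultimately show ?thesis
    using sums_le[of "\<lambda>n. x ^ (2 * n) / fact (2 * n)" "\<lambda>n. (x\<^sup>2 / 2) ^ n / fact n"] by blast
qed

text \<open>A sign vector is encoded by the set of its negative coordinates, so that averaging over
  signs is a sum over a power set.\<close>

definition flip_sign :: "nat set \<Rightarrow> nat \<Rightarrow> real" where
  "flip_sign T x = (if x \<in> T then -1 else 1)"

lemma flip_sign_square [simp]: "flip_sign T x * flip_sign T x = 1" "(flip_sign T x)\<^sup>2 = 1"
  by (auto simp: flip_sign_def)

lemma abs_flip_sign [simp]: "\<bar>flip_sign T x\<bar> = 1"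
  by (auto simp: flip_sign_def)

lemma sum_Pow_lessThan_Suc:
  fixes f :: "nat set \<Rightarrow> 'a :: comm_monoid_add"
  shows "(\<Sum>T\<in>Pow {..<Suc k}. f T) = (\<Sum>T\<in>Pow {..<k}. f T) + (\<Sum>T\<in>Pow {..<k}. f (insert k T))"
proof -
  have "Pow {..<Suc k} = Pow {..<k} \<union> insert k ` Pow {..<k}"
    by (simp add: lessThan_Suc Pow_insert)
  hence "(\<Sum>T\<in>Pow {..<Suc k}. f T) = (\<Sum>T\<in>Pow {..<k}. f T) + (\<Sum>T\<in>insert k ` Pow {..<k}. f T)"
    by (simp only:) (rule sum.union_disjoint, auto)
  also have "(\<Sum>T\<in>insert k ` Pow {..<k}. f T) = (\<Sum>T\<in>Pow {..<k}. f (insert k T))"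
  proof (rule sum.reindex[unfolded o_def], rule inj_onI)
    fix S T assume "S \<in> Pow {..<k}" "T \<in> Pow {..<k}" "insert k S = insert k T"
    moreover have "k \<notin> S" "k \<notin> T" using calculation by auto
    ultimately show "S = T" by (simp add: insert_ident)
  qed
  finally show ?thesis .
qed

text \<open>
  Averaging over one more sign turns \<open>exp (b z\<^sup>2)\<close> into at most \<open>exp (b + (b + 2 b\<^sup>2) z\<^sup>2)\<close>; as long as
  \<open>8 a k \<le> 1\<close> this only increases the coefficient \<open>b \<le> 2 a\<close> by at most \<open>8 a\<^sup>2\<close>.
\<close>

lemma sum_exp_sign_sum_le:
  fixes a y :: real
  assumes a: "0 \<le> a" "8 * a * k \<le> 1" and c: "\<And>x. \<bar>c x\<bar> = 1"
  shows "(\<Sum>T\<in>Pow {..<k}. exp (a * (y + (\<Sum>x<k. flip_sign T x * c x))\<^sup>2))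
    \<le> 2 ^ k * exp (2 * a * k + a * (1 + 8 * a * k) * y\<^sup>2)"
  using a(2)
\<comment> \<open>The last sign is absorbed into the shift y, which is why the statement carries
  one; the application has y = 0.\<close>
proof (induction k arbitrary: y)
  case 0
  show ?case by simp
next
  case (Suc k)
  define b where "b = a * (1 + 8 * a * k)"
  define F where "F y = (\<Sum>T\<in>Pow {..<k}. exp (a * (y + (\<Sum>x<k. flip_sign T x * c x))\<^sup>2))" for y
  have ak: "8 * a * k \<le> 1" using Suc.prems a(1) by (simp add: algebra_simps)
  have b: "0 \<le> b" "b \<le> 2 * a"
    using a(1) ak mult_left_mono[of "8 * a * k" 1 a] by (auto simp: b_def algebra_simps)
  have "(\<Sum>T\<in>Pow {..<k}. exp (a * (y + (\<Sum>x<Suc k. flip_sign T x * c x))\<^sup>2)) = F (y + c k)"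
    unfolding F_def by (intro sum.cong refl) (auto simp: flip_sign_def algebra_simps)
  moreover have "(\<Sum>T\<in>Pow {..<k}. exp (a * (y + (\<Sum>x<Suc k. flip_sign (insert k T) x * c x))\<^sup>2)) = F (y - c k)"
    unfolding F_def
  proof (intro sum.cong refl)
    fix T
    have "(\<Sum>x<k. flip_sign (insert k T) x * c x) = (\<Sum>x<k. flip_sign T x * c x)"
      by (intro sum.cong refl) (auto simp: flip_sign_def)
    thus "exp (a * (y + (\<Sum>x<Suc k. flip_sign (insert k T) x * c x))\<^sup>2) = exp (a * (y - c k + (\<Sum>x<k. flip_sign T x * c x))\<^sup>2)"
      by (simp add: flip_sign_def algebra_simps)
  qed
  ultimately have "(\<Sum>T\<in>Pow {..<Suc k}. exp (a * (y + (\<Sum>x<Suc k. flip_sign T x * c x))\<^sup>2)) = F (y + c k) + F (y - c k)"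
    by (simp only: sum_Pow_lessThan_Suc)
  also have "\<dots> \<le> 2 ^ k * exp (2 * a * k + b * (y + c k)\<^sup>2) + 2 ^ k * exp (2 * a * k + b * (y - c k)\<^sup>2)"
    unfolding F_def b_def by (intro add_mono Suc.IH ak)
  \<comment> \<open>Since \<open>(c k)\<^sup>2 = 1\<close>, both values of the last sign share the
    square terms, and the two opposite cross terms combine to twice a cosh.\<close>
  also have "\<dots> = 2 ^ Suc k * (exp (2 * a * k + b + b * y\<^sup>2) * cosh (2 * b * y * c k))"
  proof -
    have "(c k)\<^sup>2 = 1" using c[of k] by (metis one_power2 power2_abs)
    hence "exp (2 * a * k + b * (y + c k)\<^sup>2) = exp (2 * a * k + b + b * y\<^sup>2) * exp (2 * b * y * c k)"
      "exp (2 * a * k + b * (y - c k)\<^sup>2) = exp (2 * a * k + b + b * y\<^sup>2) * exp (- (2 * b * y * c k))"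
      by (simp_all add: exp_add[symmetric] power2_sum power2_diff algebra_simps)
    thus ?thesis by (simp add: cosh_field_def algebra_simps)
  qed
  also have "\<dots> \<le> 2 ^ Suc k * (exp (2 * a * k + b + b * y\<^sup>2) * exp (2 * b\<^sup>2 * y\<^sup>2))"
  proof -
    have "(c k)\<^sup>2 = 1" using c[of k] by (metis one_power2 power2_abs)
    hence "(2 * b * y * c k)\<^sup>2 / 2 = 2 * b\<^sup>2 * y\<^sup>2" by (simp add: power_mult_distrib)
    with cosh_le_exp_half_square[of "2 * b * y * c k"]
    have "cosh (2 * b * y * c k) \<le> exp (2 * b\<^sup>2 * y\<^sup>2)" by (simp only:)
    thus ?thesis by (intro mult_left_mono) auto
  qed
  also have "\<dots> = 2 ^ Suc k * exp (2 * a * k + b + (b + 2 * b\<^sup>2) * y\<^sup>2)"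
    by (simp add: exp_add[symmetric] algebra_simps)
  also have "\<dots> \<le> 2 ^ Suc k * exp (2 * a * Suc k + a * (1 + 8 * a * Suc k) * y\<^sup>2)"
  proof -
    have "b\<^sup>2 \<le> (2 * a)\<^sup>2" using b by (intro power_mono) auto
    hence "b + 2 * b\<^sup>2 \<le> a * (1 + 8 * a * Suc k)" by (simp add: b_def algebra_simps power2_eq_square)
    hence "(b + 2 * b\<^sup>2) * y\<^sup>2 \<le> a * (1 + 8 * a * Suc k) * y\<^sup>2" by (rule mult_right_mono) simp
    thus ?thesis using b by (simp add: algebra_simps)
  qed
  finally show ?case .
qed


section \<open>Sylvester's Hadamard matrices\<close>

text \<open>For indices below 2^m the entry is -1 to the power of the number of common binary ones:
  the comparison with \<open>2 ^ m\<close> reads the leading bit. The normalisation is left to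
  \<open>signed_hadamard\<close>.\<close>

fun hadamard :: "nat \<Rightarrow> nat \<Rightarrow> nat \<Rightarrow> real" where
  "hadamard 0 x y = 1"
| "hadamard (Suc m) x y =
     (if 2 ^ m \<le> x \<and> 2 ^ m \<le> y then -1 else 1) * hadamard m (x mod 2 ^ m) (y mod 2 ^ m)"

lemma hadamard_commute: "hadamard m x y = hadamard m y x"
  by (induction m arbitrary: x y) auto

lemma hadamard_square [simp]: "(hadamard m x y)\<^sup>2 = 1"
  by (induction m arbitrary: x y) (auto simp: power_mult_distrib)

lemma sum_lessThan_double:
  "(\<Sum>z<2 ^ Suc m. f z) = (\<Sum>z<2 ^ m. f z + f (2 ^ m + z))" for f :: "nat \<Rightarrow> 'a :: comm_monoid_add"
proof -
  have "(\<Sum>z<2 * 2 ^ m. f z) = (\<Sum>i<2. \<Sum>z<2 ^ m. f (i * 2 ^ m + z))"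
    using sum_div_mod[where f = "\<lambda>i z. f (i * 2 ^ m + z)" and a = 2 and b = "2 ^ m"] by (simp only: div_mult_mod_eq)
  moreover have "{..<2::nat} = {0, 1}" by auto
  ultimately show ?thesis by (simp add: sum.distrib)
qed

text \<open>The two diagonal blocks are H and -H, whose traces cancel. For m = 0 the trace is
  1.\<close>

lemma hadamard_trace: "0 < m \<Longrightarrow> (\<Sum>x<2 ^ m. hadamard m x x) = 0"
proof (cases m)
  case (Suc k)
  have "(\<Sum>x<2 ^ m. hadamard m x x) = (\<Sum>x<(2::nat) ^ k. 0)"
    unfolding Suc sum_lessThan_double by (rule sum.cong) auto
  thus ?thesis by simp
qed simp

text \<open>Splitting z by its leading bit gives the inner product of one order lower times
  \<open>1 + s x * s y\<close>, which is 2 or 0 according to whether the leading bits of x and y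
  agree.\<close>

lemma hadamard_orthogonal:
  assumes "x < 2 ^ m" "y < 2 ^ m"
  shows "(\<Sum>z<2 ^ m. hadamard m x z * hadamard m z y) = (if x = y then 2 ^ m else 0)"
  using assms
proof (induction m arbitrary: x y)
  case 0
  thus ?case by simp
next
  case (Suc m)
  define s where "s u = (if 2 ^ m \<le> u then -1 else 1 :: real)" for u :: nat
  have "(\<Sum>z<2 ^ Suc m. hadamard (Suc m) x z * hadamard (Suc m) z y)
    = (\<Sum>z<2 ^ m. (1 + s x * s y) * (hadamard m (x mod 2 ^ m) z * hadamard m z (y mod 2 ^ m)))"
    unfolding sum_lessThan_double
    by (rule sum.cong) (auto simp: s_def algebra_simps)
  also have "\<dots> = (1 + s x * s y) * (if x mod 2 ^ m = y mod 2 ^ m then 2 ^ m else 0)"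
    by (simp only: sum_distrib_left[symmetric] Suc.IH mod_less_divisor zero_less_power zero_less_numeral)
  also have "\<dots> = (if x = y then 2 ^ Suc m else 0)"
  proof -
    have eq: "x = y \<longleftrightarrow> x mod 2 ^ m = y mod 2 ^ m \<and> (2 ^ m \<le> x \<longleftrightarrow> 2 ^ m \<le> y)"
      using Suc.prems
      by (cases "2 ^ m \<le> x"; cases "2 ^ m \<le> y") (auto simp: le_mod_geq)
    show ?thesis unfolding eq by (simp add: s_def)
  qed
  finally show ?case .
qed

section \<open>States supported on the leading coordinates\<close>

abbreviation uniform_state :: "nat \<Rightarrow> nat \<Rightarrow> complex mat" where
  "uniform_state d r \<equiv> mat_diag d (\<lambda>i. if i < r then complex_of_real (1 / r) else 0)"

text \<open>One coercivity estimate on the first r coordinates yields positivity and, with the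
  vanishing columns, the exact kernel; rank, support and uniform state follow from the kernel. Both
  families of perturbed states enter through this lemma.\<close>

lemma leading_support_state:
  assumes \<rho>: "\<rho> \<in> carrier_mat (2 ^ n) (2 ^ n)" "mat_adjoint \<rho> = \<rho>" "trace \<rho> = 1" and r: "r \<le> 2 ^ n"
    and zero: "\<And>x y. x < 2 ^ n \<Longrightarrow> y < 2 ^ n \<Longrightarrow> r \<le> y \<Longrightarrow> \<rho> $$ (x, y) = 0"
    and \<kappa>: "0 < \<kappa>" and coercive: "\<And>v. v \<in> carrier_vec (2 ^ n) \<Longrightarrow>
      \<kappa> * (\<Sum>i<r. (cmod (v $ i))\<^sup>2) \<le> Re ((\<rho> *\<^sub>v v) \<bullet>c v)"
  shows "admissible_state n r \<rho>" "uniform_on_support \<rho> = uniform_state (2 ^ n) r"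
proof -
  have ker: "\<rho> *\<^sub>v v = 0\<^sub>v (2 ^ n) \<longleftrightarrow> (\<forall>i<r. v $ i = 0)" if v: "v \<in> carrier_vec (2 ^ n)" for v
  proof
    assume "\<rho> *\<^sub>v v = 0\<^sub>v (2 ^ n)"
    hence "\<kappa> * (\<Sum>i<r. (cmod (v $ i))\<^sup>2) \<le> 0" using coercive[OF v] v by simp
    hence "(\<Sum>i<r. (cmod (v $ i))\<^sup>2) \<le> 0" using \<kappa> by (simp add: mult_le_0_iff)
    hence "(\<Sum>i<r. (cmod (v $ i))\<^sup>2) = 0" by (intro antisym sum_nonneg) auto
    thus "\<forall>i<r. v $ i = 0" by (auto simp: sum_nonneg_eq_0_iff)
  next
    assume "\<forall>i<r. v $ i = 0"
    hence "\<rho> $$ (x, y) * v $ y = 0" if "x < 2 ^ n" "y < 2 ^ n" for x y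
      using zero[OF that] by (cases "y < r") auto
    thus "\<rho> *\<^sub>v v = 0\<^sub>v (2 ^ n)" using \<rho>(1)
      by (intro eq_vecI) (auto simp: index_mult_mat_vec_sum[OF \<rho>(1) v] simp del: index_mult_mat_vec intro!: sum.neutral)
  qed
  have "0 \<le> Re ((\<rho> *\<^sub>v v) \<bullet>c v)" if "v \<in> carrier_vec (2 ^ n)" for v
    using coercive[OF that] \<kappa> by (intro order_trans[OF _ coercive[OF that]]) (auto intro!: mult_nonneg_nonneg sum_nonneg)
  thus "admissible_state n r \<rho>"
    using rank_eq[OF \<rho>(1) r ker] \<rho> by (auto simp: admissible_state_def density_mat_def psd_mat_def)
  show "uniform_on_support \<rho> = uniform_state (2 ^ n) r"
    by (rule uniform_on_support_eq[OF \<rho>(1) r ker])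
qed

lemma trace_mat_diag: "trace (mat_diag d f) = (\<Sum>i<d. f i)"
  by (simp add: trace_def mat_diag_def)

lemma sum_if_less:
  fixes f :: "nat \<Rightarrow> 'a :: comm_monoid_add"
  assumes "r \<le> d"
  shows "(\<Sum>i<d. if i < r then f i else 0) = (\<Sum>i<r. f i)"
  using assms by (intro sum.mono_neutral_cong_right) auto

lemma diag_state:
  assumes r: "r \<le> 2 ^ n" and p: "\<And>i. i < r \<Longrightarrow> 0 < p i" "\<And>i. r \<le> i \<Longrightarrow> p i = 0" "(\<Sum>i<r. p i) = 1"
  defines "\<rho> \<equiv> mat_diag (2 ^ n) (\<lambda>i. complex_of_real (p i))"
  shows "admissible_state n r \<rho>" "uniform_on_support \<rho> = uniform_state (2 ^ n) r"
    and "Lambda \<alpha> \<rho> (uniform_state (2 ^ n) r) = 1 / 2 * (\<Sum>i<r. \<bar>p i - 1 / r\<bar> powr \<alpha>)"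
proof -
  have "0 < r" using p(3) by (cases r) auto
  define \<kappa> where "\<kappa> = Min (p ` {..<r})"
  have \<kappa>: "0 < \<kappa>" unfolding \<kappa>_def using \<open>0 < r\<close> p(1) by (subst Min_gr_iff) auto
  have \<kappa>_le: "\<kappa> \<le> p i" if "i < r" for i unfolding \<kappa>_def using that by (intro Min_le) auto
  have tr: "trace \<rho> = 1"
  proof -
    have "(\<Sum>i<2 ^ n. p i) = (\<Sum>i<2 ^ n. if i < r then p i else 0)"
      using p(2) by (intro sum.cong) auto
    thus ?thesis unfolding \<rho>_def trace_mat_diag of_real_sum[symmetric] using p(3) sum_if_less[OF r, of p] by simp
  qed
  have coercive: "\<kappa> * (\<Sum>i<r. (cmod (v $ i))\<^sup>2) \<le> Re ((\<rho> *\<^sub>v v) \<bullet>c v)" if v: "v \<in> carrier_vec (2 ^ n)" for v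
  proof -
    have "(\<rho> *\<^sub>v v) \<bullet>c v = (\<Sum>i<2 ^ n. complex_of_real (p i * (cmod (v $ i))\<^sup>2))"
      unfolding \<rho>_def mat_diag_mult_vec[OF v] using v
      by (subst cscalar_prod_sum[of _ "2 ^ n"]) (auto simp: mult.assoc complex_norm_square[symmetric] intro!: sum.cong)
    hence "Re ((\<rho> *\<^sub>v v) \<bullet>c v) = (\<Sum>i<2 ^ n. p i * (cmod (v $ i))\<^sup>2)" by simp
    also have "\<dots> = (\<Sum>i<2 ^ n. if i < r then p i * (cmod (v $ i))\<^sup>2 else 0)"
      using p(2) by (intro sum.cong) auto
    also have "\<dots> = (\<Sum>i<r. p i * (cmod (v $ i))\<^sup>2)" by (rule sum_if_less[OF r])
    finally show ?thesis using \<kappa>_le by (auto simp: sum_distrib_left intro!: sum_mono mult_right_mono)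
  qed
  have herm: "mat_adjoint \<rho> = \<rho>" by (simp add: \<rho>_def mat_adjoint_diag)
  have carr: "\<rho> \<in> carrier_mat (2 ^ n) (2 ^ n)" by (simp add: \<rho>_def)
  have zero: "\<rho> $$ (x, y) = 0" if "x < 2 ^ n" "y < 2 ^ n" "r \<le> y" for x y
    using that p(2) by (auto simp: \<rho>_def mat_diag_def)
  show "admissible_state n r \<rho>" "uniform_on_support \<rho> = uniform_state (2 ^ n) r"
    by (rule leading_support_state[OF carr herm tr r zero \<kappa> coercive]; assumption)+
  let ?x = "\<lambda>i. if i < r then p i - 1 / r else 0"
  have diff: "\<rho> - uniform_state (2 ^ n) r = mat_diag (2 ^ n) (\<lambda>i. complex_of_real (?x i))"
    using p(2) by (intro eq_matI) (auto simp: \<rho>_def mat_diag_def)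
  have "Lambda \<alpha> \<rho> (uniform_state (2 ^ n) r) = 1 / 2 * (\<Sum>i<2 ^ n. \<bar>?x i\<bar> powr \<alpha>)"
    by (rule Lambda_eq_sum) (simp add: diff mat_adjoint_diag power2_eq_square del: of_real_diff)
  also have "(\<Sum>i<2 ^ n. \<bar>?x i\<bar> powr \<alpha>) = (\<Sum>i<2 ^ n. if i < r then \<bar>p i - 1 / r\<bar> powr \<alpha> else 0)"
    by (intro sum.cong) auto
  finally show "Lambda \<alpha> \<rho> (uniform_state (2 ^ n) r) = 1 / 2 * (\<Sum>i<r. \<bar>p i - 1 / r\<bar> powr \<alpha>)"
    by (simp add: sum_if_less[OF r])
qed


section \<open>The random-sign ensemble\<close>

text \<open>The block is padded by zeros because its size is a power of two while r is arbitrary;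
  for 2^m < r the rest of the support is left unperturbed.\<close>

definition signed_hadamard :: "nat \<Rightarrow> nat \<Rightarrow> nat set \<Rightarrow> complex mat" where
  "signed_hadamard d m T = mat d d (\<lambda>(x, y). if x < 2 ^ m \<and> y < 2 ^ m
     then complex_of_real (flip_sign T x * flip_sign T y * hadamard m x y / sqrt (2 ^ m)) else 0)"

lemma signed_hadamard_carrier [simp]: "signed_hadamard d m T \<in> carrier_mat d d"
  by (simp add: signed_hadamard_def)

lemma mat_adjoint_signed_hadamard: "mat_adjoint (signed_hadamard d m T) = signed_hadamard d m T"
  by (rule eq_matI) (auto simp: signed_hadamard_def hadamard_commute mult_ac)

text \<open>In the product the sign of the summation index occurs squared and disappears, which
  leaves the orthogonality of the Hadamard matrix. On the diagonal the two outer signs coincide and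
  cancel as well.\<close>

lemma signed_hadamard_square:
  assumes m: "2 ^ m \<le> d"
  shows "signed_hadamard d m T * signed_hadamard d m T = leading_projector d (2 ^ m)"
proof (rule eq_matI)
  let ?B = "signed_hadamard d m T"
  fix x y assume "x < dim_row (leading_projector d (2 ^ m))" "y < dim_col (leading_projector d (2 ^ m))"
  hence xy: "x < d" "y < d" by (auto simp: mat_diag_def)
  have "(?B * ?B) $$ (x, y) = (\<Sum>z<d. ?B $$ (x, z) * ?B $$ (z, y))"
    by (rule index_mult_mat_sum[of _ d d _ d]) (use xy in auto)
  also have "\<dots> = (\<Sum>z<d. if z < 2 ^ m then ?B $$ (x, z) * ?B $$ (z, y) else 0)"
    using xy by (intro sum.cong refl) (auto simp: signed_hadamard_def)
  also have "\<dots> = (\<Sum>z<2 ^ m. ?B $$ (x, z) * ?B $$ (z, y))"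
    by (rule sum_if_less[OF m])
  also have "\<dots> = (\<Sum>z<2 ^ m. if x < 2 ^ m \<and> y < 2 ^ m then
      complex_of_real (flip_sign T x * flip_sign T y / 2 ^ m * (hadamard m x z * hadamard m z y)) else 0)"
  proof (intro sum.cong refl)
    fix z :: nat assume z: "z \<in> {..<2 ^ m}"
    have "flip_sign T x * flip_sign T z * hadamard m x z / sqrt (2 ^ m) * (flip_sign T z * flip_sign T y * hadamard m z y / sqrt (2 ^ m))
      = (flip_sign T z * flip_sign T z) * (flip_sign T x * flip_sign T y * (hadamard m x z * hadamard m z y)) / (sqrt (2 ^ m) * sqrt (2 ^ m))"
      by (simp only: times_divide_times_eq mult_ac)
    hence eq: "flip_sign T x * flip_sign T z * hadamard m x z / sqrt (2 ^ m) * (flip_sign T z * flip_sign T y * hadamard m z y / sqrt (2 ^ m))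
      = flip_sign T x * flip_sign T y / 2 ^ m * (hadamard m x z * hadamard m z y)"
      by (simp only: flip_sign_square) simp
    show "?B $$ (x, z) * ?B $$ (z, y) = (if x < 2 ^ m \<and> y < 2 ^ m then
      complex_of_real (flip_sign T x * flip_sign T y / 2 ^ m * (hadamard m x z * hadamard m z y)) else 0)"
      unfolding eq[symmetric] using xy z m by (auto simp: signed_hadamard_def simp del: of_real_mult of_real_divide simp flip: of_real_mult)
  qed
  also have "\<dots> = (if x < 2 ^ m \<and> y < 2 ^ m then
      complex_of_real (flip_sign T x * flip_sign T y / 2 ^ m * (\<Sum>z<2 ^ m. hadamard m x z * hadamard m z y)) else 0)"
    unfolding sum_distrib_left of_real_sum by (cases "x < 2 ^ m \<and> y < 2 ^ m") (simp_all only: if_True if_False sum.neutral_const simp_thms)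
  also have "\<dots> = leading_projector d (2 ^ m) $$ (x, y)"
    using xy by (auto simp: hadamard_orthogonal mat_diag_def)
  finally show "(?B * ?B) $$ (x, y) = leading_projector d (2 ^ m) $$ (x, y)" .
qed (auto simp: signed_hadamard_def mat_diag_def)

lemma trace_signed_hadamard:
  assumes "2 ^ m \<le> d" "0 < m"
  shows "trace (signed_hadamard d m T) = 0"
proof -
  have "trace (signed_hadamard d m T) = (\<Sum>x<d. if x < 2 ^ m then complex_of_real (hadamard m x x / sqrt (2 ^ m)) else 0)"
    by (auto simp: trace_def signed_hadamard_def intro!: sum.cong)
  also have "\<dots> = complex_of_real ((\<Sum>x<2 ^ m. hadamard m x x) / sqrt (2 ^ m))"
    unfolding sum_if_less[OF assms(1)] by (simp add: sum_divide_distrib)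
  finally show ?thesis using hadamard_trace[OF assms(2)] by simp
qed

text \<open>All entries of the Hadamard matrix have the same modulus, so the inner product factorizes.\<close>

lemma hs_inner_signed_hadamard:
  assumes "2 ^ m \<le> d"
  shows "hs_inner (signed_hadamard d m S) (signed_hadamard d m T) =
    complex_of_real ((\<Sum>x<2 ^ m. flip_sign S x * flip_sign T x)\<^sup>2 / 2 ^ m)"
proof -
  let ?u = "\<lambda>x. flip_sign S x * flip_sign T x"
  have "hs_inner (signed_hadamard d m S) (signed_hadamard d m T) =
    (\<Sum>x<d. if x < 2 ^ m then (\<Sum>y<d. if y < 2 ^ m then complex_of_real (?u x * ?u y / 2 ^ m) else 0) else 0)"
    unfolding hs_inner_def
  proof (rule sum.cong)
    fix x assume "x \<in> {..<d}"
    have "hadamard m x y * hadamard m x y = 1" for y using hadamard_square[of m x y] by (simp only: power2_eq_square)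
    moreover have "flip_sign S x * flip_sign S y * hadamard m x y / sqrt (2 ^ m) * (flip_sign T x * flip_sign T y * hadamard m x y / sqrt (2 ^ m))
      = (hadamard m x y * hadamard m x y) * (?u x * ?u y) / (sqrt (2 ^ m) * sqrt (2 ^ m))" for y
      by (simp only: times_divide_times_eq mult_ac)
    ultimately have eq: "flip_sign S x * flip_sign S y * hadamard m x y / sqrt (2 ^ m) * (flip_sign T x * flip_sign T y * hadamard m x y / sqrt (2 ^ m))
      = ?u x * ?u y / 2 ^ m" for y by simp
    show "(\<Sum>j<dim_col (signed_hadamard d m S). signed_hadamard d m S $$ (x, j) * cnj (signed_hadamard d m T $$ (x, j))) =
      (if x < 2 ^ m then (\<Sum>y<d. if y < 2 ^ m then complex_of_real (?u x * ?u y / 2 ^ m) else 0) else 0)"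
      unfolding eq[symmetric] using \<open>x \<in> {..<d}\<close>
      by (auto simp: signed_hadamard_def simp del: of_real_mult of_real_divide simp flip: of_real_mult intro!: sum.cong)
  qed (simp add: signed_hadamard_def)
  also have "\<dots> = (\<Sum>x<2 ^ m. \<Sum>y<2 ^ m. complex_of_real (?u x * ?u y / 2 ^ m))"
    by (simp only: sum_if_less[OF assms])
  also have "\<dots> = complex_of_real ((\<Sum>x<2 ^ m. \<Sum>y<2 ^ m. ?u x * ?u y) / 2 ^ m)"
    by (simp only: of_real_sum sum_divide_distrib)
  finally show ?thesis by (simp only: power2_eq_square sum_product)
qed

definition perturbed_state :: "nat \<Rightarrow> nat \<Rightarrow> real \<Rightarrow> nat \<Rightarrow> nat set \<Rightarrow> complex mat" where
  "perturbed_state d r \<delta> m T = mat d d (\<lambda>x. complex_of_real (1 / r) *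
     (leading_projector d r $$ x + complex_of_real \<delta> * signed_hadamard d m T $$ x))"

lemma perturbed_state_carrier [simp]: "perturbed_state d r \<delta> m T \<in> carrier_mat d d"
  by (simp add: perturbed_state_def)

text \<open>Having the uniform state as the case \<delta> = 0 lets its overlaps and its
  admissibility be read off from the general formulas.\<close>

lemma perturbed_state_0: "perturbed_state d r 0 m T = uniform_state d r"
  by (rule eq_matI) (auto simp: perturbed_state_def mat_diag_def)

lemma mat_adjoint_perturbed_state: "mat_adjoint (perturbed_state d r \<delta> m T) = perturbed_state d r \<delta> m T"
  by (rule eq_matI) (auto simp: perturbed_state_def signed_hadamard_def mat_diag_def hadamard_commute mult_ac)

lemma leading_projector_mult_perturbed_state:
  assumes "2 ^ m \<le> r"
  shows "leading_projector d r * perturbed_state d r \<delta> m T = perturbed_state d r \<delta> m T"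
  unfolding mat_diag_mult_left[OF perturbed_state_carrier]
  by (rule eq_matI) (use assms in \<open>auto simp: perturbed_state_def signed_hadamard_def mat_diag_def\<close>)

lemma trace_perturbed_state:
  assumes "2 ^ m \<le> r" "r \<le> d" "0 < m"
  shows "trace (perturbed_state d r \<delta> m T) = 1"
proof -
  have "0 < r" using assms(1) by (metis gr0I le_zero_eq power_not_zero zero_neq_numeral)
  have "trace (perturbed_state d r \<delta> m T) = complex_of_real (1 / r) *
      (trace (leading_projector d r) + complex_of_real \<delta> * trace (signed_hadamard d m T))"
    by (simp add: trace_def perturbed_state_def sum.distrib sum_distrib_left distrib_left signed_hadamard_def mat_diag_def)
  also have "trace (leading_projector d r) = of_nat r"
    using sum_if_less[OF assms(2), of "\<lambda>_. 1::complex"] by (simp add: trace_mat_diag)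
  finally show ?thesis using assms \<open>0 < r\<close> by (simp add: trace_signed_hadamard)
qed

text \<open>The cross terms are traces of a traceless matrix. Separate parameters on the two sides
  allow \<eta> = 0, which gives 1/r as the overlap with the uniform state, the same as the overlap
  of that state with itself. This is the common value q required by
  \<open>chi_square_bound\<close>.\<close>

lemma hs_inner_perturbed_state:
  assumes "2 ^ m \<le> r" "r \<le> d" "0 < m"
  shows "hs_inner (perturbed_state d r \<delta> m S) (perturbed_state d r \<eta> m T) =
    complex_of_real (1 / r + \<delta> * \<eta> / ((real r)\<^sup>2 * 2 ^ m) * (\<Sum>x<2 ^ m. flip_sign S x * flip_sign T x)\<^sup>2)"
proof -
  have "0 < r" using assms(1) by (metis gr0I le_zero_eq power_not_zero zero_neq_numeral)
  let ?P = "leading_projector d r" and ?B = "signed_hadamard d m"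
  have PB: "hs_inner ?P (?B T) = 0" "hs_inner (?B T) ?P = 0" for T
  proof -
    have "hs_inner (?B T) ?P = trace (?B T * ?P)"
      by (rule trace_mult_hermitian[of _ d, symmetric]) (auto simp: mat_adjoint_diag if_distrib cong: if_cong)
    also have "?B T * ?P = ?B T"
      unfolding mat_diag_mult_right[OF signed_hadamard_carrier]
      by (rule eq_matI) (use assms in \<open>auto simp: signed_hadamard_def\<close>)
    finally show "hs_inner (?B T) ?P = 0" using assms by (simp add: trace_signed_hadamard)
    thus "hs_inner ?P (?B T) = 0"
      using hs_inner_cnj[of "?B T" d d ?P] by simp
  qed
  have PP: "hs_inner ?P ?P = of_nat r"
  proof -
    have "hs_inner ?P ?P = trace (?P * ?P)"
      by (rule trace_mult_hermitian[of _ d, symmetric]) (auto simp: mat_adjoint_diag if_distrib cong: if_cong)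
    also have "?P * ?P = ?P" by (simp add: if_distrib cong: if_cong)
    finally show ?thesis using sum_if_less[OF assms(2), of "\<lambda>_. 1::complex"] by (simp add: trace_mat_diag)
  qed
  have "hs_inner (perturbed_state d r \<delta> m S) (perturbed_state d r \<eta> m T) =
    complex_of_real ((1 / r)\<^sup>2) * (hs_inner ?P ?P + complex_of_real \<eta> * hs_inner ?P (?B T)
      + complex_of_real \<delta> * hs_inner (?B S) ?P + complex_of_real (\<delta> * \<eta>) * hs_inner (?B S) (?B T))"
  proof -
    let ?c = "complex_of_real (1 / r)"
    have "hs_inner (perturbed_state d r \<delta> m S) (perturbed_state d r \<eta> m T) =
      (\<Sum>i<d. \<Sum>j<d. perturbed_state d r \<delta> m S $$ (i, j) * cnj (perturbed_state d r \<eta> m T $$ (i, j)))"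
      by (simp add: hs_inner_def carrier_matD[OF perturbed_state_carrier])
    also have "\<dots> = (\<Sum>i<d. \<Sum>j<d. ?c\<^sup>2 * (?P $$ (i, j) * cnj (?P $$ (i, j))
      + complex_of_real \<eta> * (?P $$ (i, j) * cnj (?B T $$ (i, j)))
      + complex_of_real \<delta> * (?B S $$ (i, j) * cnj (?P $$ (i, j)))
      + complex_of_real (\<delta> * \<eta>) * (?B S $$ (i, j) * cnj (?B T $$ (i, j)))))"
    proof (intro sum.cong refl)
      fix i j assume ij: "i \<in> {..<d}" "j \<in> {..<d}"
      have "?c * (p + e * q) * cnj (?c * (p' + f * q')) =
        ?c\<^sup>2 * (p * cnj p' + cnj f * (p * cnj q') + e * (q * cnj p') + e * cnj f * (q * cnj q'))" for p q p' q' e f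
        by (simp add: algebra_simps power2_eq_square)
      from this[of "?P $$ (i, j)" "complex_of_real \<delta>" "?B S $$ (i, j)" "?P $$ (i, j)" "complex_of_real \<eta>" "?B T $$ (i, j)"] ij
      show "perturbed_state d r \<delta> m S $$ (i, j) * cnj (perturbed_state d r \<eta> m T $$ (i, j)) = ?c\<^sup>2 * (?P $$ (i, j) * cnj (?P $$ (i, j))
        + complex_of_real \<eta> * (?P $$ (i, j) * cnj (?B T $$ (i, j)))
        + complex_of_real \<delta> * (?B S $$ (i, j) * cnj (?P $$ (i, j)))
        + complex_of_real (\<delta> * \<eta>) * (?B S $$ (i, j) * cnj (?B T $$ (i, j))))"
        by (simp add: perturbed_state_def del: complex_cnj_mult complex_cnj_add)
    qed
    finally show ?thesis
      by (simp only: hs_inner_def carrier_matD[OF mat_diag_dim] carrier_matD[OF signed_hadamard_carrier]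
          sum_distrib_left[symmetric] sum.distrib of_real_power)
  qed
  also have "\<dots> = complex_of_real ((1 / r)\<^sup>2 * (r + \<delta> * \<eta> * ((\<Sum>x<2 ^ m. flip_sign S x * flip_sign T x)\<^sup>2 / 2 ^ m)))"
    using assms by (simp add: PB PP hs_inner_signed_hadamard)
  also have "(1 / r)\<^sup>2 * (r + \<delta> * \<eta> * ((\<Sum>x<2 ^ m. flip_sign S x * flip_sign T x)\<^sup>2 / 2 ^ m)) =
    1 / r + \<delta> * \<eta> / ((real r)\<^sup>2 * 2 ^ m) * (\<Sum>x<2 ^ m. flip_sign S x * flip_sign T x)\<^sup>2"
    using \<open>0 < r\<close> by (simp add: field_simps power2_eq_square)
  finally show ?thesis .
qed

text \<open>Put p = P v and a = B v, where B squares to the projector of a block inside the support.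
  Then a has at most the length of p, so that expanding the squared length of p + a bounds the
  quadratic form of B below by -N. Hence P + \<delta> B is at least (1 - \<delta>) P, without any
  knowledge of the eigenvectors of B.\<close>

lemma perturbed_state_coercive:
  assumes "2 ^ m \<le> r" "r \<le> d" "0 \<le> \<delta>" and v: "v \<in> carrier_vec d"
  shows "(1 - \<delta>) / r * (\<Sum>i<r. (cmod (v $ i))\<^sup>2) \<le> Re ((perturbed_state d r \<delta> m T *\<^sub>v v) \<bullet>c v)"
proof -
  let ?B = "signed_hadamard d m T"
  define N where "N = (\<Sum>i<r. (cmod (v $ i))\<^sup>2)"
  define p where "p = leading_projector d r *\<^sub>v v"
  define a where "a = ?B *\<^sub>v v"
  have c: "p \<in> carrier_vec d" "a \<in> carrier_vec d"
    using v by (auto simp: p_def a_def intro!: mult_mat_vec_carrier[of _ d d])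
  have proj: "(leading_projector d k *\<^sub>v v) \<bullet>c v = complex_of_real (\<Sum>i<k. (cmod (v $ i))\<^sup>2)" if "k \<le> d" for k
  proof -
    have "(leading_projector d k *\<^sub>v v) \<bullet>c v = (\<Sum>i<d. if i < k then complex_of_real ((cmod (v $ i))\<^sup>2) else 0)"
      unfolding mat_diag_mult_vec[OF v] using v
      by (subst cscalar_prod_sum[of _ d]) (auto simp: complex_norm_square[symmetric] intro!: sum.cong)
    thus ?thesis by (simp only: sum_if_less[OF that] of_real_sum)
  qed
  have p: "p $ i = (if i < r then v $ i else 0)" if "i < d" for i
    using that v by (simp add: p_def mat_diag_mult_vec)
  have a0: "a $ i = 0" if "i < d" "r \<le> i" for i
    unfolding a_def using that assms(1)
    by (simp add: index_mult_mat_vec_sum[of _ d d] v signed_hadamard_def del: index_mult_mat_vec)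
  have pp: "p \<bullet>c p = p \<bullet>c v" "a \<bullet>c p = a \<bullet>c v"
    using c v p a0 by (auto simp: cscalar_prod_sum[of _ d] intro!: sum.cong)
  have pv: "p \<bullet>c v = complex_of_real N" by (simp only: p_def N_def proj[OF assms(2)])
  have pa: "p \<bullet>c a = cnj (a \<bullet>c p)"
    using c by (simp add: cscalar_prod_sum[of _ d] mult.commute)
  have "a \<bullet>c a = (?B *\<^sub>v a) \<bullet>c v"
    using cscalar_prod_mat_adjoint[OF signed_hadamard_carrier c(2) v] by (simp add: mat_adjoint_signed_hadamard a_def)
  also have "?B *\<^sub>v a = leading_projector d (2 ^ m) *\<^sub>v v"
    unfolding a_def using assms v signed_hadamard_square[of m d T]
    by (subst assoc_mult_mat_vec[symmetric, of _ d d _ d]) auto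
  also have "(leading_projector d (2 ^ m) *\<^sub>v v) \<bullet>c v = complex_of_real (\<Sum>i<2 ^ m. (cmod (v $ i))\<^sup>2)"
    using proj assms by simp
  finally have aa: "Re (a \<bullet>c a) \<le> N"
    unfolding N_def using assms(1) by (auto intro!: sum_mono2)
  have "0 \<le> Re ((p + a) \<bullet>c (p + a))" unfolding cscalar_prod_self by (simp add: sum_nonneg)
  also have "(p + a) \<bullet>c (p + a) = p \<bullet>c p + a \<bullet>c p + p \<bullet>c a + a \<bullet>c a"
    using c by (simp add: cscalar_prod_sum[of _ d] algebra_simps sum.distrib)
  finally have "0 \<le> 2 * N + 2 * Re (a \<bullet>c v)"
    using aa by (simp add: pa pp pv)
  hence "- (\<delta> * N) \<le> \<delta> * Re (a \<bullet>c v)"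
    using mult_left_mono[of "- N" "Re (a \<bullet>c v)" \<delta>] assms(3) by simp
  moreover have "(perturbed_state d r \<delta> m T *\<^sub>v v) \<bullet>c v = complex_of_real (1 / r) * (p \<bullet>c v + complex_of_real \<delta> * (a \<bullet>c v))"
  proof -
    let ?c = "complex_of_real (1 / r)" and ?\<delta> = "complex_of_real \<delta>" and ?P = "leading_projector d r"
    define w where "w = perturbed_state d r \<delta> m T *\<^sub>v v"
    have wc: "w \<in> carrier_vec d" unfolding w_def using v by (intro mult_mat_vec_carrier) auto
    have wi: "w $ i = ?c * (p $ i + ?\<delta> * a $ i)" if i: "i < d" for i
    proof -
      have "w $ i = (\<Sum>j<d. perturbed_state d r \<delta> m T $$ (i, j) * v $ j)"
        unfolding w_def by (rule index_mult_mat_vec_sum[OF perturbed_state_carrier v i])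
      also have "\<dots> = (\<Sum>j<d. ?c * (?P $$ (i, j) + ?\<delta> * ?B $$ (i, j)) * v $ j)"
        using i by (intro sum.cong refl) (simp add: perturbed_state_def)
      also have "\<dots> = ?c * ((\<Sum>j<d. ?P $$ (i, j) * v $ j) + ?\<delta> * (\<Sum>j<d. ?B $$ (i, j) * v $ j))"
        by (simp only: distrib_left distrib_right sum.distrib sum_distrib_left mult.assoc)
      finally show ?thesis
        by (simp only: p_def a_def index_mult_mat_vec_sum[OF mat_diag_dim v i] index_mult_mat_vec_sum[OF signed_hadamard_carrier v i])
    qed
    have "w \<bullet>c v = (\<Sum>i<d. ?c * (p $ i + ?\<delta> * a $ i) * cnj (v $ i))"
      using wi by (simp add: cscalar_prod_sum[OF wc v])
    also have "\<dots> = ?c * ((\<Sum>i<d. p $ i * cnj (v $ i)) + ?\<delta> * (\<Sum>i<d. a $ i * cnj (v $ i)))"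
      by (simp only: distrib_left distrib_right sum.distrib sum_distrib_left mult.assoc)
    finally show ?thesis unfolding w_def by (simp only: cscalar_prod_sum[OF c(1) v] cscalar_prod_sum[OF c(2) v])
  qed
  hence "Re ((perturbed_state d r \<delta> m T *\<^sub>v v) \<bullet>c v) = (N + \<delta> * Re (a \<bullet>c v)) / r"
    by (simp add: pv)
  ultimately show ?thesis
    unfolding N_def[symmetric] by (simp add: divide_right_mono left_diff_distrib)
qed

text \<open>The difference from the uniform state has 2^m singular values \<delta>/r and no other
  nonzero ones, because B squares to a projector of rank 2^m. The value of \<Lambda>_\<alpha> is the
  same for every T, so a single test serves the whole ensemble.\<close>

lemma perturbed_state:
  fixes T :: "nat set"
  assumes m: "0 < m" "2 ^ m \<le> r" and r: "r \<le> 2 ^ n" and \<delta>: "0 \<le> \<delta>" "\<delta> < 1"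
  defines "\<rho> \<equiv> perturbed_state (2 ^ n) r \<delta> m T"
  shows "admissible_state n r \<rho>" "uniform_on_support \<rho> = uniform_state (2 ^ n) r"
    and "Lambda \<alpha> \<rho> (uniform_state (2 ^ n) r) = 1 / 2 * (2 ^ m * (\<delta> / r) powr \<alpha>)"
proof -
  have "0 < r" using m(2) by (metis gr0I le_zero_eq power_not_zero zero_neq_numeral)
  have carr: "\<rho> \<in> carrier_mat (2 ^ n) (2 ^ n)" and herm: "mat_adjoint \<rho> = \<rho>"
    by (simp_all add: \<rho>_def mat_adjoint_perturbed_state)
  have tr: "trace \<rho> = 1" unfolding \<rho>_def using m r by (intro trace_perturbed_state)
  have zero: "\<rho> $$ (x, y) = 0" if "x < 2 ^ n" "y < 2 ^ n" "r \<le> y" for x y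
    using that m by (auto simp: \<rho>_def perturbed_state_def signed_hadamard_def mat_diag_def)
  have \<kappa>: "0 < (1 - \<delta>) / r" using \<delta> \<open>0 < r\<close> by simp
  have coercive: "(1 - \<delta>) / r * (\<Sum>i<r. (cmod (v $ i))\<^sup>2) \<le> Re ((\<rho> *\<^sub>v v) \<bullet>c v)"
    if "v \<in> carrier_vec (2 ^ n)" for v
    unfolding \<rho>_def using perturbed_state_coercive[OF m(2) r \<delta>(1) that] .
  show "admissible_state n r \<rho>" "uniform_on_support \<rho> = uniform_state (2 ^ n) r"
    by (rule leading_support_state[OF carr herm tr r zero \<kappa> coercive]; assumption)+
  let ?B = "signed_hadamard (2 ^ n) m T" and ?c = "complex_of_real (\<delta> / r)"
  let ?x = "\<lambda>i::nat. if i < 2 ^ m then \<delta> / r else 0"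
  have md: "2 ^ m \<le> (2 ^ n :: nat)" using m(2) r by (rule order_trans)
  have diff: "\<rho> - uniform_state (2 ^ n) r = ?c \<cdot>\<^sub>m ?B"
    by (rule eq_matI) (auto simp: \<rho>_def perturbed_state_def mat_diag_def signed_hadamard_def field_simps)
  have adj: "mat_adjoint (?c \<cdot>\<^sub>m ?B) = ?c \<cdot>\<^sub>m ?B"
    by (rule eq_matI) (auto simp: signed_hadamard_def hadamard_commute mult_ac)
  have "(?c \<cdot>\<^sub>m ?B) * (?c \<cdot>\<^sub>m ?B) = (?c * ?c) \<cdot>\<^sub>m (?B * ?B)"
  proof -
    have "(?c \<cdot>\<^sub>m ?B) * (?c \<cdot>\<^sub>m ?B) = ?c \<cdot>\<^sub>m (?c \<cdot>\<^sub>m (?B * ?B))"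
      by (simp only: mult_smult_assoc_mat[OF signed_hadamard_carrier smult_carrier_mat[OF signed_hadamard_carrier]]
          mult_smult_distrib[OF signed_hadamard_carrier signed_hadamard_carrier])
    thus ?thesis by (intro eq_matI) auto
  qed
  also have "\<dots> = mat_diag (2 ^ n) (\<lambda>i. complex_of_real ((?x i)\<^sup>2))"
    unfolding signed_hadamard_square[OF md] by (rule eq_matI) (auto simp: mat_diag_def power2_eq_square)
  finally have "Lambda \<alpha> \<rho> (uniform_state (2 ^ n) r) = 1 / 2 * (\<Sum>i<2 ^ n. \<bar>?x i\<bar> powr \<alpha>)"
    by (intro Lambda_eq_sum) (simp only: diff adj)
  also have "(\<Sum>i<2 ^ n. \<bar>?x i\<bar> powr \<alpha>) = (\<Sum>i::nat<2 ^ n. if i < 2 ^ m then (\<delta> / r) powr \<alpha> else 0)"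
    using \<delta> by (intro sum.cong) auto
  also have "\<dots> = 2 ^ m * (\<delta> / r) powr \<alpha>" by (simp add: sum_if_less[OF md])
  finally show "Lambda \<alpha> \<rho> (uniform_state (2 ^ n) r) = 1 / 2 * (2 ^ m * (\<delta> / r) powr \<alpha>)" .
qed

lemma uniform_state_admissible:
  assumes r: "2 \<le> r" "r \<le> 2 ^ n"
  shows "admissible_state n r (uniform_state (2 ^ n) r)"
    and "uniform_on_support (uniform_state (2 ^ n) r) = uniform_state (2 ^ n) r"
    and "Lambda \<alpha> (uniform_state (2 ^ n) r) (uniform_state (2 ^ n) r) = 0"
  \<comment> \<open>For \<delta> = 0 the block size does not affect the state; m = 1 is a legal
    choice as soon as 2 \<le> r.\<close>
  using perturbed_state(1,2)[where m = 1 and r = r and n = n and \<delta> = 0]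
    perturbed_state(3)[where m = 1 and r = r and n = n and \<delta> = 0 and \<alpha> = \<alpha>] r
  by (simp_all only: perturbed_state_0) auto

section \<open>Sample lower bound\<close>

definition sum_mats :: "nat \<Rightarrow> nat set \<Rightarrow> (nat \<Rightarrow> complex mat) \<Rightarrow> complex mat" where
  "sum_mats d G E = mat d d (\<lambda>x. \<Sum>i\<in>G. E i $$ x)"

lemma sum_mats_carrier [simp]: "sum_mats d G E \<in> carrier_mat d d"
  by (simp add: sum_mats_def)

lemma trace_sum_mats_mult:
  assumes "\<And>i. i \<in> G \<Longrightarrow> E i \<in> carrier_mat d d" and X: "X \<in> carrier_mat d d"
  shows "trace (sum_mats d G E * X) = (\<Sum>i\<in>G. trace (E i * X))"
proof -
  have tr: "trace (Y * X) = (\<Sum>x<d. \<Sum>y<d. Y $$ (x, y) * X $$ (y, x))" if "Y \<in> carrier_mat d d" for Y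
    using that X by (simp add: trace_def index_mult_mat_sum[OF that X] del: index_mult_mat(1))
  have "trace (sum_mats d G E * X) = (\<Sum>x<d. \<Sum>y<d. \<Sum>i\<in>G. E i $$ (x, y) * X $$ (y, x))"
    unfolding tr[OF sum_mats_carrier] by (simp add: sum_mats_def sum_distrib_right)
  also have "\<dots> = (\<Sum>x<d. \<Sum>i\<in>G. \<Sum>y<d. E i $$ (x, y) * X $$ (y, x))"
    by (intro sum.cong refl sum.swap)
  also have "\<dots> = (\<Sum>i\<in>G. \<Sum>x<d. \<Sum>y<d. E i $$ (x, y) * X $$ (y, x))"
    by (rule sum.swap)
  finally show ?thesis using assms by (simp add: tr)
qed

lemma sum_mats_quadratic_form:
  assumes E: "\<And>i. i \<in> G \<Longrightarrow> E i \<in> carrier_mat d d" and v: "v \<in> carrier_vec d"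
  shows "(sum_mats d G E *\<^sub>v v) \<bullet>c v = (\<Sum>i\<in>G. (E i *\<^sub>v v) \<bullet>c v)"
proof -
  have form: "(Y *\<^sub>v v) \<bullet>c v = (\<Sum>x<d. \<Sum>y<d. Y $$ (x, y) * v $ y * cnj (v $ x))" if Y: "Y \<in> carrier_mat d d" for Y
    using v by (simp add: cscalar_prod_sum[OF mult_mat_vec_carrier[OF Y v] v] index_mult_mat_vec_sum[OF Y v]
        sum_distrib_right del: index_mult_mat_vec)
  have "(sum_mats d G E *\<^sub>v v) \<bullet>c v = (\<Sum>x<d. \<Sum>y<d. \<Sum>i\<in>G. E i $$ (x, y) * v $ y * cnj (v $ x))"
    unfolding form[OF sum_mats_carrier] by (simp add: sum_mats_def sum_distrib_right)
  also have "\<dots> = (\<Sum>x<d. \<Sum>i\<in>G. \<Sum>y<d. E i $$ (x, y) * v $ y * cnj (v $ x))"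
    by (intro sum.cong refl sum.swap)
  also have "\<dots> = (\<Sum>i\<in>G. \<Sum>x<d. \<Sum>y<d. E i $$ (x, y) * v $ y * cnj (v $ x))"
    by (rule sum.swap)
  finally show ?thesis using E by (simp add: form)
qed

lemma test_mat_sum_povm:
  assumes povm: "povm d k E" and G: "G \<subseteq> {..<k}"
  shows "test_mat d (sum_mats d G E)"
proof -
  have psd: "psd_mat d (E i)" if "i < k" for i using povm that by (auto simp: povm_def)
  hence Ec: "E i \<in> carrier_mat d d" if "i < k" for i using that by (auto simp: psd_mat_def)
  have herm: "cnj (E i $$ (y, x)) = E i $$ (x, y)" if "i < k" "x < d" "y < d" for i x y
    using psd[OF that(1)] that index_mat_adjoint[of x "E i" y] by (auto simp: psd_mat_def)
  have nonneg: "0 \<le> Re ((E i *\<^sub>v v) \<bullet>c v)" if "i < k" "v \<in> carrier_vec d" for i v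
    using psd that by (auto simp: psd_mat_def)
  have total: "sum_mats d {..<k} E = 1\<^sub>m d"
    using povm unfolding povm_def sum_mats_def by blast
  have "mat_adjoint (sum_mats d G E) = sum_mats d G E"
    using G by (intro eq_matI) (auto simp: sum_mats_def intro!: sum.cong herm)
  moreover have "0 \<le> Re ((sum_mats d G E *\<^sub>v v) \<bullet>c v)"
    and "Re ((sum_mats d G E *\<^sub>v v) \<bullet>c v) \<le> Re (v \<bullet>c v)" if v: "v \<in> carrier_vec d" for v
  proof -
    have G': "(sum_mats d G E *\<^sub>v v) \<bullet>c v = (\<Sum>i\<in>G. (E i *\<^sub>v v) \<bullet>c v)"
      by (rule sum_mats_quadratic_form) (use Ec G v in auto)
    show "0 \<le> Re ((sum_mats d G E *\<^sub>v v) \<bullet>c v)"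
      unfolding G' Re_sum by (rule sum_nonneg) (use nonneg G v in auto)
    have "Re ((sum_mats d G E *\<^sub>v v) \<bullet>c v) \<le> (\<Sum>i<k. Re ((E i *\<^sub>v v) \<bullet>c v))"
      unfolding G' Re_sum by (rule sum_mono2) (use nonneg G v in auto)
    also have "\<dots> = Re ((sum_mats d {..<k} E *\<^sub>v v) \<bullet>c v)"
      by (subst sum_mats_quadratic_form) (use Ec v in auto)
    finally show "Re ((sum_mats d G E *\<^sub>v v) \<bullet>c v) \<le> Re (v \<bullet>c v)" using v by (simp add: total)
  qed
  ultimately show ?thesis by (auto simp: test_mat_def psd_mat_def)
qed

section \<open>The joint state of all copies and its support\<close>

definition joint_state :: "nat \<Rightarrow> nat \<Rightarrow> sample_algorithm \<Rightarrow> complex mat \<Rightarrow> complex mat" where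
  "joint_state n r A \<rho> = kron (kron_power \<rho> (state_copies A)) (kron_power (uniform_state (2 ^ n) r) (uniform_copies A))"

abbreviation joint_dim :: "nat \<Rightarrow> sample_algorithm \<Rightarrow> nat" where
  "joint_dim n A \<equiv> (2 ^ n) ^ copies A"

text \<open>Its multiple by 1 / r^copies is the joint state belonging to the uniform \<rho>. Its
  range contains the supports of all perturbed joint states, and it takes the place of P in
  \<open>chi_square_bound\<close>.\<close>

definition joint_projector :: "nat \<Rightarrow> nat \<Rightarrow> sample_algorithm \<Rightarrow> complex mat" where
  "joint_projector n r A =
     kron (kron_power (leading_projector (2 ^ n) r) (state_copies A)) (kron_power (leading_projector (2 ^ n) r) (uniform_copies A))"

lemma joint_dim_eq: "joint_dim n A = (2 ^ n) ^ state_copies A * (2 ^ n) ^ uniform_copies A"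
  by (simp add: copies_def power_add)

lemma leading_projector_adjoint: "mat_adjoint (leading_projector d r) = leading_projector d r"
  by (simp add: mat_adjoint_diag if_distrib cong: if_cong)

lemma leading_projector_idem: "leading_projector d r * leading_projector d r = leading_projector d r"
  by (simp add: if_distrib cong: if_cong)

lemma uniform_state_adjoint: "mat_adjoint (uniform_state d r) = uniform_state d r"
  by (simp add: mat_adjoint_diag if_distrib cong: if_cong)

lemma uniform_state_eq_smult: "uniform_state d r = complex_of_real (1 / r) \<cdot>\<^sub>m leading_projector d r"
  by (rule eq_matI) (auto simp: mat_diag_def)

lemma leading_projector_mult_uniform_state: "leading_projector d r * uniform_state d r = uniform_state d r"
  by (simp add: if_distrib cong: if_cong)

lemma joint_projector:
  shows "joint_projector n r A \<in> carrier_mat (joint_dim n A) (joint_dim n A)"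
    and "mat_adjoint (joint_projector n r A) = joint_projector n r A"
    and "joint_projector n r A * joint_projector n r A = joint_projector n r A"
proof -
  let ?N = "(2::nat) ^ n"
  show "joint_projector n r A \<in> carrier_mat (joint_dim n A) (joint_dim n A)"
    unfolding joint_projector_def joint_dim_eq by (intro kron_carrier kron_power_carrier mat_diag_dim)
  show "mat_adjoint (joint_projector n r A) = joint_projector n r A"
    unfolding joint_projector_def by (simp only: mat_adjoint_kron mat_adjoint_kron_power leading_projector_adjoint)
  show "joint_projector n r A * joint_projector n r A = joint_projector n r A"
    unfolding joint_projector_def
    by (subst kron_mult[of _ "?N ^ state_copies A" "?N ^ state_copies A" _ "?N ^ uniform_copies A" "?N ^ uniform_copies A"
          _ "?N ^ state_copies A" _ "?N ^ uniform_copies A"])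
      (simp_all only: kron_power_carrier mat_diag_dim kron_power_mult[OF mat_diag_dim mat_diag_dim] leading_projector_idem)
qed

lemma joint_state:
  assumes \<rho>: "\<rho> \<in> carrier_mat (2 ^ n) (2 ^ n)"
  shows "joint_state n r A \<rho> \<in> carrier_mat (joint_dim n A) (joint_dim n A)"
    and "mat_adjoint \<rho> = \<rho> \<Longrightarrow> mat_adjoint (joint_state n r A \<rho>) = joint_state n r A \<rho>"
    and "leading_projector (2 ^ n) r * \<rho> = \<rho> \<Longrightarrow> joint_projector n r A * joint_state n r A \<rho> = joint_state n r A \<rho>"
proof -
  let ?N = "(2::nat) ^ n"
  show "joint_state n r A \<rho> \<in> carrier_mat (joint_dim n A) (joint_dim n A)"
    unfolding joint_state_def joint_dim_eq by (intro kron_carrier kron_power_carrier mat_diag_dim \<rho>)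
  show "mat_adjoint (joint_state n r A \<rho>) = joint_state n r A \<rho>" if "mat_adjoint \<rho> = \<rho>"
    unfolding joint_state_def by (simp only: mat_adjoint_kron mat_adjoint_kron_power uniform_state_adjoint that)
  show "joint_projector n r A * joint_state n r A \<rho> = joint_state n r A \<rho>" if "leading_projector (2 ^ n) r * \<rho> = \<rho>"
    unfolding joint_projector_def joint_state_def
    by (subst kron_mult[of _ "?N ^ state_copies A" "?N ^ state_copies A" _ "?N ^ uniform_copies A" "?N ^ uniform_copies A"
          _ "?N ^ state_copies A" _ "?N ^ uniform_copies A"])
      (simp_all only: kron_power_carrier mat_diag_dim \<rho> kron_power_mult[OF mat_diag_dim mat_diag_dim]
        kron_power_mult[OF mat_diag_dim \<rho>] leading_projector_mult_uniform_state that)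
qed

lemma hs_inner_joint_state:
  assumes "\<rho> \<in> carrier_mat (2 ^ n) (2 ^ n)" "\<sigma> \<in> carrier_mat (2 ^ n) (2 ^ n)"
  shows "hs_inner (joint_state n r A \<rho>) (joint_state n r A \<sigma>) =
    hs_inner \<rho> \<sigma> ^ state_copies A * hs_inner (uniform_state (2 ^ n) r) (uniform_state (2 ^ n) r) ^ uniform_copies A"
proof -
  let ?N = "(2::nat) ^ n"
  show ?thesis unfolding joint_state_def
    by (subst hs_inner_kron[of _ "?N ^ state_copies A" "?N ^ state_copies A" _ "?N ^ uniform_copies A" "?N ^ uniform_copies A"])
      (simp_all only: kron_power_carrier assms mat_diag_dim hs_inner_kron_power[OF assms]
        hs_inner_kron_power[OF mat_diag_dim mat_diag_dim])
qed

lemma hs_inner_leading_projector: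
  assumes "r \<le> d"
  shows "hs_inner (leading_projector d r) (leading_projector d r) = of_nat r"
proof -
  have "hs_inner (leading_projector d r) (leading_projector d r) = trace (leading_projector d r * leading_projector d r)"
    by (rule trace_mult_hermitian[of _ d, symmetric]) (simp_all only: mat_diag_dim leading_projector_adjoint)
  thus ?thesis
    using sum_if_less[OF assms, of "\<lambda>_. 1::complex"] by (simp only: leading_projector_idem trace_mat_diag) simp
qed

lemma hs_inner_joint_projector:
  assumes "r \<le> 2 ^ n"
  shows "hs_inner (joint_projector n r A) (joint_projector n r A) = of_nat (r ^ copies A)"
proof -
  let ?N = "(2::nat) ^ n"
  have "hs_inner (joint_projector n r A) (joint_projector n r A) =
    hs_inner (leading_projector ?N r) (leading_projector ?N r) ^ state_copies A *
    hs_inner (leading_projector ?N r) (leading_projector ?N r) ^ uniform_copies A"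
    unfolding joint_projector_def
    by (subst hs_inner_kron[of _ "?N ^ state_copies A" "?N ^ state_copies A" _ "?N ^ uniform_copies A" "?N ^ uniform_copies A"])
      (simp_all only: kron_power_carrier mat_diag_dim hs_inner_kron_power[OF mat_diag_dim mat_diag_dim])
  thus ?thesis by (simp add: hs_inner_leading_projector[OF assms] copies_def power_add)
qed

lemma trace_psd_joint_uniform_nonneg:
  assumes "psd_mat (joint_dim n A) E"
  shows "0 \<le> Re (trace (E * joint_state n r A (uniform_state (2 ^ n) r)))"
proof -
  define c where "c = (1 / real r) ^ state_copies A * (1 / real r) ^ uniform_copies A"
  have Ec: "E \<in> carrier_mat (joint_dim n A) (joint_dim n A)" using assms by (auto simp: psd_mat_def)
  have "joint_state n r A (uniform_state (2 ^ n) r) = complex_of_real c \<cdot>\<^sub>m joint_projector n r A"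
    unfolding joint_state_def joint_projector_def uniform_state_eq_smult kron_power_smult kron_smult c_def by simp
  hence "E * joint_state n r A (uniform_state (2 ^ n) r) = complex_of_real c \<cdot>\<^sub>m (E * joint_projector n r A)"
    using mult_smult_distrib[OF Ec joint_projector(1)] by simp
  hence "trace (E * joint_state n r A (uniform_state (2 ^ n) r)) = complex_of_real c * trace (E * joint_projector n r A)"
    using Ec carrier_matD[OF joint_projector(1)[of n r A]] by (simp add: trace_def sum_distrib_left)
  moreover have "0 \<le> Re (trace (E * joint_projector n r A))"
    by (rule trace_mult_projector_nonneg[OF assms joint_projector])
  ultimately show ?thesis by (simp add: c_def)
qed

lemma trace_kron: "trace (kron A B) = trace A * trace B"
  if "A \<in> carrier_mat a a" "B \<in> carrier_mat b b"
proof -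
  have "trace (kron A B) = (\<Sum>k<a * b. (\<lambda>i j. A $$ (i, i) * B $$ (j, j)) (k div b) (k mod b))"
    using that by (auto simp: trace_def index_kron[OF that])
  also have "\<dots> = (\<Sum>i<a. \<Sum>j<b. A $$ (i, i) * B $$ (j, j))" by (rule sum_div_mod)
  finally show ?thesis using that by (simp add: trace_def sum_product)
qed

lemma trace_kron_power: "trace (kron_power A k) = trace A ^ k" if A: "A \<in> carrier_mat d d"
proof (induction k)
  case 0
  show ?case by (simp add: trace_def)
next
  case (Suc k)
  thus ?case using trace_kron[OF A kron_power_carrier[OF A], of k] by simp
qed

text \<open>The test accepts when the estimate is within \<epsilon> of L. For the uniform state
  \<Lambda>_\<alpha> is 0, so estimates within \<epsilon> of 0 already have probability 2/3; they
  are disjoint from the accepting ones because L > 2 \<epsilon>, which leaves at most 1/3. Fixing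
  the value L instead of the state makes the test valid for all members of the ensemble at
  once.\<close>

lemma sample_test:
  fixes L :: real
  assumes est: "sample_estimator \<alpha> \<epsilon> n r A" and r: "2 \<le> r" "r \<le> 2 ^ n" and L: "2 * \<epsilon> < L"
  obtains E where "test_mat (joint_dim n A) E"
    and "Re (trace (E * joint_state n r A (uniform_state (2 ^ n) r))) \<le> 1 / 3"
    and "\<And>\<rho>. \<lbrakk>admissible_state n r \<rho>; uniform_on_support \<rho> = uniform_state (2 ^ n) r;
        Lambda \<alpha> \<rho> (uniform_state (2 ^ n) r) = L\<rbrakk> \<Longrightarrow> 2 / 3 \<le> Re (trace (E * joint_state n r A \<rho>))"
proof -
  let ?u = "uniform_state (2 ^ n) r" and ?K = "joint_dim n A"
  define G where "G x = {i. i < outcomes A \<and> \<bar>estimate_of A i - x\<bar> \<le> \<epsilon>}" for x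
  have povm: "povm ?K (outcomes A) (effect A)" using est by (simp add: sample_estimator_def)
  hence psd: "psd_mat ?K (effect A i)" if "i < outcomes A" for i using that by (auto simp: povm_def)
  hence Ec: "effect A i \<in> carrier_mat ?K ?K" if "i < outcomes A" for i using that by (auto simp: psd_mat_def)
  define \<tau> where "\<tau> i = Re (trace (effect A i * joint_state n r A ?u))" for i
  have succ: "2 / 3 \<le> (\<Sum>i\<in>G (Lambda \<alpha> \<rho> ?u). Re (trace (effect A i * joint_state n r A \<rho>)))"
    if "admissible_state n r \<rho>" "uniform_on_support \<rho> = ?u" for \<rho>
    using est that unfolding sample_estimator_def sample_success_prob_def G_def joint_state_def by auto
  have sums: "Re (trace (sum_mats ?K H (effect A) * joint_state n r A \<rho>)) =
      (\<Sum>i\<in>H. Re (trace (effect A i * joint_state n r A \<rho>)))"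
    if "H \<subseteq> {..<outcomes A}" "\<rho> \<in> carrier_mat (2 ^ n) (2 ^ n)" for H \<rho>
    by (subst trace_sum_mats_mult[OF _ joint_state(1)[OF that(2)]]) (use that Ec in auto)
  note u = uniform_state_admissible[OF r]
  have Gsub: "G x \<subseteq> {..<outcomes A}" for x by (auto simp: G_def)
  have disj: "G 0 \<inter> G L = {}" using L by (auto simp: G_def abs_le_iff)
  have \<tau>0: "0 \<le> \<tau> i" if "i < outcomes A" for i
    unfolding \<tau>_def using trace_psd_joint_uniform_nonneg[OF psd[OF that]] .
  have "(\<Sum>i<outcomes A. \<tau> i) = 1"
  proof -
    have "sum_mats ?K {..<outcomes A} (effect A) = 1\<^sub>m ?K"
      using povm unfolding povm_def sum_mats_def by blast
    hence "(\<Sum>i<outcomes A. \<tau> i) = Re (trace (1\<^sub>m ?K * joint_state n r A ?u))"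
      unfolding \<tau>_def using sums[of "{..<outcomes A}" ?u] by simp
    also have "1\<^sub>m ?K * joint_state n r A ?u = joint_state n r A ?u"
      by (rule left_mult_one_mat[OF joint_state(1)[OF mat_diag_dim]])
    also have "trace (joint_state n r A ?u) = 1"
    proof -
      have "trace ?u = 1" using u(1) by (simp add: admissible_state_def density_mat_def)
      thus ?thesis unfolding joint_state_def
        by (simp only: trace_kron[OF kron_power_carrier[OF mat_diag_dim] kron_power_carrier[OF mat_diag_dim]]
            trace_kron_power[OF mat_diag_dim] power_one mult_1)
    qed
    finally show ?thesis by simp
  qed
  moreover have "(\<Sum>i\<in>G 0. \<tau> i) + (\<Sum>i\<in>G L. \<tau> i) \<le> (\<Sum>i<outcomes A. \<tau> i)"
  proof -
    have "(\<Sum>i\<in>G 0. \<tau> i) + (\<Sum>i\<in>G L. \<tau> i) = (\<Sum>i\<in>G 0 \<union> G L. \<tau> i)"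
      by (rule sum.union_disjoint[symmetric]) (use disj in \<open>auto simp: G_def\<close>)
    also have "\<dots> \<le> (\<Sum>i<outcomes A. \<tau> i)"
      by (rule sum_mono2) (use Gsub \<tau>0 in auto)
    finally show ?thesis .
  qed
  moreover have "2 / 3 \<le> (\<Sum>i\<in>G 0. \<tau> i)" using succ[OF u(1,2)] by (simp only: u(3) \<tau>_def)
  ultimately have "(\<Sum>i\<in>G L. \<tau> i) \<le> 1 / 3" by simp
  show ?thesis
  proof
    show "test_mat ?K (sum_mats ?K (G L) (effect A))" by (rule test_mat_sum_povm[OF povm Gsub])
    show "Re (trace (sum_mats ?K (G L) (effect A) * joint_state n r A ?u)) \<le> 1 / 3"
      using \<open>(\<Sum>i\<in>G L. \<tau> i) \<le> 1 / 3\<close> by (simp only: sums[OF Gsub mat_diag_dim] \<tau>_def)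
    fix \<rho> assume \<rho>: "admissible_state n r \<rho>" "uniform_on_support \<rho> = ?u" "Lambda \<alpha> \<rho> ?u = L"
    hence "\<rho> \<in> carrier_mat (2 ^ n) (2 ^ n)"
      by (simp add: admissible_state_def density_mat_def psd_mat_def)
    thus "2 / 3 \<le> Re (trace (sum_mats ?K (G L) (effect A) * joint_state n r A \<rho>))"
      using succ[OF \<rho>(1,2)] by (simp only: sums[OF Gsub] \<rho>(3))
  qed
qed

text \<open>Without copies of \<rho> the joint state is that of the uniform state. This weak bound
  takes over where r is bounded in terms of \<alpha>.\<close>

lemma sample_copies_pos:
  assumes est: "sample_estimator \<alpha> \<epsilon> n r A" and r: "2 \<le> r" "r \<le> 2 ^ n"
    and \<rho>: "admissible_state n r \<rho>" "uniform_on_support \<rho> = uniform_state (2 ^ n) r"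
      "2 * \<epsilon> < Lambda \<alpha> \<rho> (uniform_state (2 ^ n) r)"
  shows "1 \<le> copies A"
proof (rule ccontr)
  assume "\<not> 1 \<le> copies A"
  hence "state_copies A = 0" by (simp add: copies_def)
  hence "joint_state n r A \<rho> = joint_state n r A (uniform_state (2 ^ n) r)" by (simp add: joint_state_def)
  moreover obtain E where "Re (trace (E * joint_state n r A (uniform_state (2 ^ n) r))) \<le> 1 / 3"
    "2 / 3 \<le> Re (trace (E * joint_state n r A \<rho>))"
    using sample_test[OF est r \<rho>(3)] \<rho>(1,2) by metis
  ultimately show False by simp
qed

text \<open>If \<open>40 * copies A * \<delta>\<^sup>2\<close> is at most r, the \<chi>^2 distance
  is at most exp(1/20) - 1, which is below 1/9, the square of the gap 2/3 - 1/3. The same assumption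
  gives \<open>8 * a * D \<le> 1\<close>, the range in which \<open>sum_exp_sign_sum_le\<close>
  applies.\<close>

lemma sample_copies_bound:
  fixes \<alpha> \<delta> \<epsilon> :: real
  assumes est: "sample_estimator \<alpha> \<epsilon> n r A" and m: "0 < m" "2 ^ m \<le> r" and r: "r \<le> 2 ^ n"
    and \<delta>: "0 < \<delta>" "\<delta> < 1" and L: "2 * \<epsilon> < 1 / 2 * (2 ^ m * (\<delta> / r) powr \<alpha>)"
  shows "real r < 40 * copies A * \<delta>\<^sup>2"
proof (rule ccontr)
  assume few: "\<not> real r < 40 * copies A * \<delta>\<^sup>2"
  have "2 \<le> (2::nat) ^ m" using m(1) by (cases m) auto
  hence r2: "2 \<le> r" using m(2) by linarith
  define u where "u = uniform_state (2 ^ n) r"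
  define \<rho> where "\<rho> T = perturbed_state (2 ^ n) r \<delta> m T" for T
  define N where "N = state_copies A"
  define D :: nat where "D = 2 ^ m"
  define S where "S = Pow {..<D}"
  define X where "X s t = (\<Sum>x<D. flip_sign s x * flip_sign t x)" for s t
  define g where "g s t = (1 / r + \<delta>\<^sup>2 / ((real r)\<^sup>2 * D) * (X s t)\<^sup>2) ^ N * (1 / real r) ^ uniform_copies A" for s t
  define q where "q = (1 / real r) ^ N * (1 / real r) ^ uniform_copies A"
  \<comment> \<open>The coefficient of the squared sign sum after the N-th power of 1 + x has been
    replaced by exp (N x).\<close>
  define a where "a = N * \<delta>\<^sup>2 / (r * D)"
  have D0: "0 < D" by (simp add: D_def)
  obtain E where E: "test_mat (joint_dim n A) E"
    and E0: "Re (trace (E * joint_state n r A u)) \<le> 1 / 3"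
    and E1: "\<And>\<rho>. \<lbrakk>admissible_state n r \<rho>; uniform_on_support \<rho> = u; Lambda \<alpha> \<rho> u = 1 / 2 * (2 ^ m * (\<delta> / r) powr \<alpha>)\<rbrakk>
      \<Longrightarrow> 2 / 3 \<le> Re (trace (E * joint_state n r A \<rho>))"
    using sample_test[OF est r2 r L] unfolding u_def by metis
  have uc: "u \<in> carrier_mat (2 ^ n) (2 ^ n)" "mat_adjoint u = u" "leading_projector (2 ^ n) r * u = u"
    unfolding u_def by (simp_all only: mat_diag_dim uniform_state_adjoint leading_projector_mult_uniform_state)
  have \<rho>c: "\<rho> T \<in> carrier_mat (2 ^ n) (2 ^ n)" "mat_adjoint (\<rho> T) = \<rho> T" "leading_projector (2 ^ n) r * \<rho> T = \<rho> T" for T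
    unfolding \<rho>_def
    by (simp_all only: perturbed_state_carrier mat_adjoint_perturbed_state leading_projector_mult_perturbed_state[OF m(2)])
  have u_perturbed: "u = perturbed_state (2 ^ n) r 0 m {}" by (simp only: u_def perturbed_state_0)
  have hs_uu: "hs_inner u u = complex_of_real (1 / r)"
    unfolding u_perturbed hs_inner_perturbed_state[OF m(2) r m(1)] by simp
  have hs_\<rho>u: "hs_inner (\<rho> T) u = complex_of_real (1 / r)" for T
    unfolding u_perturbed \<rho>_def hs_inner_perturbed_state[OF m(2) r m(1)] by simp
  have hs_\<rho>\<rho>: "hs_inner (\<rho> s) (\<rho> t) = complex_of_real (1 / r + \<delta>\<^sup>2 / ((real r)\<^sup>2 * D) * (X s t)\<^sup>2)" for s t
    unfolding \<rho>_def hs_inner_perturbed_state[OF m(2) r m(1)] X_def D_def by (simp add: power2_eq_square)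
  \<comment> \<open>Multiplication by the rank r^copies cancels the contribution of the uniform
    copies, so that only the copies of \<rho> remain in the exponent N.\<close>
  have g_eq: "real (r ^ copies A) * g s t = (1 + \<delta>\<^sup>2 / (r * D) * (X s t)\<^sup>2) ^ N" for s t
  proof -
    have "real (r ^ copies A) * g s t = (real r * (1 / r + \<delta>\<^sup>2 / ((real r)\<^sup>2 * D) * (X s t)\<^sup>2)) ^ N"
      using r2 by (simp add: g_def N_def copies_def power_add power_divide power_mult_distrib)
    also have "real r * (1 / r + \<delta>\<^sup>2 / ((real r)\<^sup>2 * D) * (X s t)\<^sup>2) = 1 + \<delta>\<^sup>2 / (r * D) * (X s t)\<^sup>2"
      using r2 by (simp add: field_simps power2_eq_square)
    finally show ?thesis .
  qed
  have "(1 / 3 * card S)\<^sup>2 \<le> Re (hs_inner (joint_projector n r A) (joint_projector n r A)) *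
      ((\<Sum>s\<in>S. \<Sum>t\<in>S. g s t) - (card S)\<^sup>2 * q)"
  proof (rule chi_square_bound[OF E joint_projector(1), where \<sigma> = "\<lambda>T. joint_state n r A (\<rho> T)"
        and \<tau> = "joint_state n r A u"])
    fix s
    have "2 / 3 \<le> Re (trace (E * joint_state n r A (\<rho> s)))"
      unfolding \<rho>_def u_def using perturbed_state(1,2)[OF m r, where \<delta> = \<delta> and T = s]
        perturbed_state(3)[OF m r, where \<delta> = \<delta> and T = s and \<alpha> = \<alpha>] \<delta> by (intro E1[unfolded u_def]) simp_all
    thus "1 / 3 \<le> Re (trace (E * joint_state n r A (\<rho> s))) - Re (trace (E * joint_state n r A u))"
      using E0 by simp
  next
    fix s t
    show "hs_inner (joint_state n r A (\<rho> s)) (joint_state n r A (\<rho> t)) = complex_of_real (g s t)"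
      unfolding hs_inner_joint_state[OF \<rho>c(1) \<rho>c(1)] u_def[symmetric] hs_uu hs_\<rho>\<rho> g_def N_def
      by (simp only: of_real_mult of_real_power)
  next
    show "hs_inner (joint_state n r A u) (joint_state n r A u) = complex_of_real q"
      unfolding hs_inner_joint_state[OF uc(1) uc(1)] u_def[symmetric] hs_uu q_def N_def
      by (simp only: of_real_mult of_real_power)
  next
    fix s
    show "hs_inner (joint_state n r A (\<rho> s)) (joint_state n r A u) = complex_of_real q"
      unfolding hs_inner_joint_state[OF \<rho>c(1) uc(1)] u_def[symmetric] hs_uu hs_\<rho>u q_def N_def
      by (simp only: of_real_mult of_real_power)
  qed (use joint_state[OF uc(1)] joint_state[OF \<rho>c(1)] uc \<rho>c in \<open>auto simp: S_def\<close>)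
  also have "hs_inner (joint_projector n r A) (joint_projector n r A) = of_nat (r ^ copies A)"
    by (rule hs_inner_joint_projector[OF r])
  also have "Re (of_nat (r ^ copies A)) * ((\<Sum>s\<in>S. \<Sum>t\<in>S. g s t) - (card S)\<^sup>2 * q) =
    (\<Sum>s\<in>S. \<Sum>t\<in>S. real (r ^ copies A) * g s t) - (card S)\<^sup>2 * (real (r ^ copies A) * q)"
    by (simp add: right_diff_distrib sum_distrib_left)
  also have "real (r ^ copies A) * q = 1"
    using r2 by (simp add: q_def N_def copies_def power_add power_divide)
  also have "(\<Sum>s\<in>S. \<Sum>t\<in>S. real (r ^ copies A) * g s t) =
    (\<Sum>s\<in>S. \<Sum>t\<in>S. (1 + \<delta>\<^sup>2 / (r * D) * (X s t)\<^sup>2) ^ N)"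
    by (intro sum.cong refl g_eq)
  also have "(\<Sum>s\<in>S. \<Sum>t\<in>S. (1 + \<delta>\<^sup>2 / (r * D) * (X s t)\<^sup>2) ^ N) \<le> (\<Sum>s\<in>S. \<Sum>t\<in>S. exp (a * (X s t)\<^sup>2))"
  proof (intro sum_mono)
    fix s t
    have "(1 + \<delta>\<^sup>2 / (r * D) * (X s t)\<^sup>2) ^ N \<le> exp (\<delta>\<^sup>2 / (r * D) * (X s t)\<^sup>2) ^ N"
      by (intro power_mono exp_ge_add_one_self) auto
    also have "\<dots> = exp (a * (X s t)\<^sup>2)" by (simp add: a_def exp_of_nat_mult[symmetric] mult_ac)
    finally show "(1 + \<delta>\<^sup>2 / (r * D) * (X s t)\<^sup>2) ^ N \<le> exp (a * (X s t)\<^sup>2)" .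
  qed
  \<comment> \<open>For fixed s the signs of s serve as the coefficients c of modulus 1, so the sum
    over t has a bound that is uniform in s.\<close>
  also have "(\<Sum>s\<in>S. \<Sum>t\<in>S. exp (a * (X s t)\<^sup>2)) \<le> (\<Sum>s\<in>S. card S * exp (2 * a * D))"
  proof (rule sum_mono)
    fix s
    have "8 * a * D \<le> 1"
    proof -
      have "8 * N * \<delta>\<^sup>2 \<le> 40 * copies A * \<delta>\<^sup>2" by (intro mult_right_mono) (auto simp: N_def copies_def)
      also have "\<dots> \<le> r" using few by simp
      finally show ?thesis using r2 D0 by (simp add: a_def field_simps)
    qed
    moreover have "0 \<le> a" by (simp add: a_def)
    ultimately have "(\<Sum>t\<in>Pow {..<D}. exp (a * (0 + (\<Sum>x<D. flip_sign t x * flip_sign s x))\<^sup>2))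
      \<le> 2 ^ D * exp (2 * a * D + a * (1 + 8 * a * D) * 0\<^sup>2)"
      by (intro sum_exp_sign_sum_le) auto
    thus "(\<Sum>t\<in>S. exp (a * (X s t)\<^sup>2)) \<le> card S * exp (2 * a * D)"
      by (simp add: S_def X_def mult.commute card_Pow)
  qed
  finally have "(1 / 3 * card S)\<^sup>2 \<le> (card S)\<^sup>2 * (exp (2 * a * D) - 1)"
    by (simp add: algebra_simps power2_eq_square)
  moreover have "0 < card S" by (simp add: S_def card_Pow)
  ultimately have "1 / 9 \<le> exp (2 * a * D) - 1" by (simp add: power_mult_distrib power_divide)
  moreover have aD: "2 * a * D \<le> 1 / 20"
  proof -
    have "N * \<delta>\<^sup>2 * 40 \<le> 40 * copies A * \<delta>\<^sup>2" by (simp add: N_def copies_def algebra_simps)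
    also have "\<dots> \<le> r" using few by simp
    finally show ?thesis using r2 D0 by (simp add: a_def field_simps)
  qed
  moreover have "exp (1 / 20 :: real) \<le> 1 + 1 / 20 + (1 / 20)\<^sup>2" by (rule exp_bound) auto
  moreover have "exp (2 * a * D) \<le> exp (1 / 20)"
    using aD by (simp only: exp_le_cancel_iff)
  ultimately show False by (simp add: power2_eq_square)
qed

section \<open>Query lower bound\<close>

definition vnorm :: "complex vec \<Rightarrow> real" where
  "vnorm v = L2_set (\<lambda>i. cmod (v $ i)) {..<dim_vec v}"

lemma vnorm_nonneg [simp]: "0 \<le> vnorm v"
  by (simp add: vnorm_def)

lemma vnorm_square: "(vnorm v)\<^sup>2 = Re (v \<bullet>c v)"
  by (simp add: vnorm_def L2_set_def cscalar_prod_self sum_nonneg)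

lemma vnorm_eqI: "Re (v \<bullet>c v) = Re (w \<bullet>c w) \<Longrightarrow> vnorm v = vnorm w"
  by (metis vnorm_square power2_eq_iff_nonneg vnorm_nonneg)

lemma vnorm_add_le:
  assumes "v \<in> carrier_vec n" "w \<in> carrier_vec n"
  shows "vnorm (v + w) \<le> vnorm v + vnorm w"
proof -
  have "vnorm (v + w) \<le> L2_set (\<lambda>i. cmod (v $ i) + cmod (w $ i)) {..<n}"
    using assms by (auto simp: vnorm_def intro!: L2_set_mono norm_triangle_ineq)
  also have "\<dots> \<le> vnorm v + vnorm w"
    using assms L2_set_triangle_ineq[of "\<lambda>i. cmod (v $ i)" "\<lambda>i. cmod (w $ i)" "{..<n}"] by (simp add: vnorm_def)
  finally show ?thesis .
qed

lemma unitary_mat_carrier: "unitary_mat d U \<Longrightarrow> U \<in> carrier_mat d d"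
  by (simp add: unitary_mat_def)

lemma vnorm_unitary:
  assumes U: "unitary_mat d U" and v: "v \<in> carrier_vec d"
  shows "vnorm (U *\<^sub>v v) = vnorm v"
proof -
  have Uc: "U \<in> carrier_mat d d" and U1: "mat_adjoint U * U = 1\<^sub>m d" using U by (auto simp: unitary_mat_def)
  have "(U *\<^sub>v v) \<bullet>c (U *\<^sub>v v) = v \<bullet>c (mat_adjoint U *\<^sub>v (U *\<^sub>v v))"
    using cscalar_prod_mat_adjoint[OF Uc v] Uc v by simp
  also have "mat_adjoint U *\<^sub>v (U *\<^sub>v v) = v"
    using assoc_mult_mat_vec[OF mat_adjoint_carrier[OF Uc] Uc v] U1 v by simp
  finally show ?thesis by (intro vnorm_eqI) simp
qed

lemma unitary_mat_adjoint: "unitary_mat d U \<Longrightarrow> unitary_mat d (mat_adjoint U)"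
  by (auto simp: unitary_mat_def)

lemma unitary_mat_kron_one:
  assumes "unitary_mat g G"
  shows "unitary_mat (g * h) (kron G (1\<^sub>m h))"
proof -
  have G: "G \<in> carrier_mat g g" "mat_adjoint G * G = 1\<^sub>m g" "G * mat_adjoint G = 1\<^sub>m g"
    using assms by (auto simp: unitary_mat_def)
  have o: "(1\<^sub>m h :: complex mat) \<in> carrier_mat h h" by simp
  show ?thesis unfolding unitary_mat_def mat_adjoint_kron mat_adjoint_one
    using kron_mult[OF mat_adjoint_carrier[OF G(1)] o G(1) o] kron_mult[OF G(1) o mat_adjoint_carrier[OF G(1)] o]
    by (simp add: G kron_one)
qed

lemma controlled_carrier: "U \<in> carrier_mat d d \<Longrightarrow> controlled U \<in> carrier_mat (d + d) (d + d)"
  by (auto simp: controlled_def)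

lemma mat_adjoint_controlled:
  assumes "U \<in> carrier_mat d d"
  shows "mat_adjoint (controlled U) = controlled (mat_adjoint U)"
  by (rule eq_matI) (use assms in \<open>auto simp: controlled_def\<close>)

lemma controlled_mult:
  assumes "U \<in> carrier_mat d d" "V \<in> carrier_mat d d"
  shows "controlled U * controlled V = controlled (U * V)"
proof -
  have z: "(0\<^sub>m d d :: complex mat) \<in> carrier_mat d d" and o: "(1\<^sub>m d :: complex mat) \<in> carrier_mat d d" by auto
  have "controlled U * controlled V = four_block_mat (1\<^sub>m d) (0\<^sub>m d d) (0\<^sub>m d d) U * four_block_mat (1\<^sub>m d) (0\<^sub>m d d) (0\<^sub>m d d) V"
    using assms by (simp add: controlled_def)
  also have "\<dots> = four_block_mat (1\<^sub>m d) (0\<^sub>m d d) (0\<^sub>m d d) (U * V)"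
    using assms mult_carrier_mat[OF assms]
    by (simp add: mult_four_block_mat[OF o z z assms(1) o z z assms(2)])
  finally show ?thesis using assms by (simp add: controlled_def)
qed

lemma unitary_mat_controlled:
  assumes "unitary_mat d U"
  shows "unitary_mat (d + d) (controlled U)"
proof -
  have U: "U \<in> carrier_mat d d" "mat_adjoint U * U = 1\<^sub>m d" "U * mat_adjoint U = 1\<^sub>m d"
    using assms by (auto simp: unitary_mat_def)
  have "controlled (1\<^sub>m d) = 1\<^sub>m (d + d)" by (simp add: controlled_def)
  thus ?thesis unfolding unitary_mat_def mat_adjoint_controlled[OF U(1)]
    using controlled_mult[OF mat_adjoint_carrier[OF U(1)] U(1)] controlled_mult[OF U(1) mat_adjoint_carrier[OF U(1)]]
    by (simp add: U controlled_carrier)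
qed

text \<open>This is the square of the Frobenius norm; roots are taken where a length is
  required.\<close>

definition frobenius :: "complex mat \<Rightarrow> real" where
  "frobenius A = (\<Sum>i<dim_row A. \<Sum>j<dim_col A. (cmod (A $$ (i, j)))\<^sup>2)"

lemma frobenius_nonneg: "0 \<le> frobenius A"
  by (simp add: frobenius_def sum_nonneg)

lemma frobenius_minus_adjoint:
  assumes "U \<in> carrier_mat d d" "V \<in> carrier_mat d d"
  shows "frobenius (mat_adjoint U - mat_adjoint V) = frobenius (U - V)"
proof -
  have "frobenius (mat_adjoint U - mat_adjoint V) = (\<Sum>i<d. \<Sum>j<d. (cmod (U $$ (j, i) - V $$ (j, i)))\<^sup>2)"
    using assms by (simp add: frobenius_def flip: complex_cnj_diff)
  also have "\<dots> = (\<Sum>j<d. \<Sum>i<d. (cmod (U $$ (j, i) - V $$ (j, i)))\<^sup>2)" by (rule sum.swap)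
  finally show ?thesis using assms by (simp add: frobenius_def)
qed

lemma frobenius_minus_controlled:
  assumes "U \<in> carrier_mat d d" "V \<in> carrier_mat d d"
  shows "frobenius (controlled U - controlled V) = frobenius (U - V)"
proof -
  let ?D = "controlled U - controlled V"
  have split: "(\<Sum>i<d + d. f i) = (\<Sum>i<d. f i) + (\<Sum>i<d. f (d + i))" for f :: "nat \<Rightarrow> real"
    using sum_div_mod[where f = "\<lambda>i j. f (i * d + j)" and a = 2 and b = d]
    by (simp add: div_mult_mod_eq mult_2 numeral_2_eq_2)
  have z: "?D $$ (i, j) = 0" if "i < d" "j < d + d" for i j
    using that assms by (auto simp: controlled_def)
  have z': "?D $$ (d + i, j) = 0" if "i < d" "j < d" for i j
    using that assms by (auto simp: controlled_def)
  have e: "?D $$ (d + i, d + j) = (U - V) $$ (i, j)" if "i < d" "j < d" for i j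
    using that assms by (auto simp: controlled_def)
  have "dim_row ?D = d + d" "dim_col ?D = d + d" using assms by (auto simp: controlled_def)
  thus ?thesis using assms unfolding frobenius_def by (simp only: split) (simp add: z z' e del: index_minus_mat(1))
qed

lemma cmod_sum_mult_square_le:
  "(cmod (\<Sum>i\<in>A. f i * g i))\<^sup>2 \<le> (\<Sum>i\<in>A. (cmod (f i))\<^sup>2) * (\<Sum>i\<in>A. (cmod (g i))\<^sup>2)"
proof -
  have "cmod (\<Sum>i\<in>A. f i * g i) \<le> (\<Sum>i\<in>A. cmod (f i * g i))" by (rule norm_sum)
  also have "\<dots> \<le> L2_set (\<lambda>i. cmod (f i)) A * L2_set (\<lambda>i. cmod (g i)) A"
    using L2_set_mult_ineq[of "\<lambda>i. cmod (f i)" "\<lambda>i. cmod (g i)" A] by (simp add: norm_mult)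
  finally have "(cmod (\<Sum>i\<in>A. f i * g i))\<^sup>2 \<le> (L2_set (\<lambda>i. cmod (f i)) A * L2_set (\<lambda>i. cmod (g i)) A)\<^sup>2"
    by (intro power_mono) auto
  thus ?thesis by (simp add: power_mult_distrib L2_set_def sum_nonneg)
qed

text \<open>Cauchy-Schwarz is applied separately for each value \<open>k mod h\<close> of the idle
  index, so the factor is that of D alone. The Frobenius norm of \<open>kron D (1\<^sub>m h)\<close>
  itself would grow with h.\<close>

lemma vnorm_kron_one_le:
  assumes D: "D \<in> carrier_mat g g" and x: "x \<in> carrier_vec (g * h)"
  shows "vnorm (kron D (1\<^sub>m h) *\<^sub>v x) \<le> sqrt (frobenius D) * vnorm x"
proof -
  let ?y = "kron D (1\<^sub>m h) *\<^sub>v x" and ?X = "\<lambda>i j. x $ (i * h + j)"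
  have o: "(1\<^sub>m h :: complex mat) \<in> carrier_mat h h" by simp
  have yc: "?y \<in> carrier_vec (g * h)" using kron_carrier[OF D o] x by (rule mult_mat_vec_carrier)
  have y: "?y $ k = (\<Sum>i<g. D $$ (k div h, i) * ?X i (k mod h))" if k: "k < g * h" for k
  proof -
    have "?y $ k = (\<Sum>l<g * h. kron D (1\<^sub>m h) $$ (k, l) * x $ l)"
      by (rule index_mult_mat_vec_sum[OF kron_carrier[OF D o] x k])
    also have "\<dots> = (\<Sum>l<g * h. (\<lambda>i j. D $$ (k div h, i) * (if k mod h = j then 1 else 0) * ?X i j) (l div h) (l mod h))"
    proof (rule sum.cong[OF refl])
      fix l assume "l \<in> {..<g * h}"
      hence l: "l < g * h" by simp
      have "kron D (1\<^sub>m h) $$ (k, l) = D $$ (k div h, l div h) * (if k mod h = l mod h then 1 else 0)"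
        using k l div_mod_less_mult[OF k] div_mod_less_mult[OF l] by (simp add: index_kron[OF D o])
      thus "kron D (1\<^sub>m h) $$ (k, l) * x $ l =
        (\<lambda>i j. D $$ (k div h, i) * (if k mod h = j then 1 else 0) * ?X i j) (l div h) (l mod h)"
        by (simp only: div_mult_mod_eq)
    qed
    also have "\<dots> = (\<Sum>i<g. \<Sum>j<h. D $$ (k div h, i) * (if k mod h = j then 1 else 0) * ?X i j)"
      by (rule sum_div_mod)
    also have "\<dots> = (\<Sum>i<g. D $$ (k div h, i) * ?X i (k mod h))"
    proof (rule sum.cong[OF refl])
      fix i
      have "(\<Sum>j<h. D $$ (k div h, i) * (if k mod h = j then 1 else 0) * ?X i j)
        = (\<Sum>j<h. if j = k mod h then D $$ (k div h, i) * ?X i j else 0)"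
        by (rule sum.cong) auto
      thus "(\<Sum>j<h. D $$ (k div h, i) * (if k mod h = j then 1 else 0) * ?X i j) = D $$ (k div h, i) * ?X i (k mod h)"
        using div_mod_less_mult[OF k] by simp
    qed
    finally show ?thesis .
  qed
  have sq: "(vnorm v)\<^sup>2 = (\<Sum>i<n. (cmod (v $ i))\<^sup>2)" if "v \<in> carrier_vec n" for v n
    using that by (simp add: vnorm_square cscalar_prod_self)
  have x_sq: "(vnorm x)\<^sup>2 = (\<Sum>i<g. \<Sum>j<h. (cmod (?X i j))\<^sup>2)"
    using sum_div_mod[where f = "\<lambda>i j. (cmod (?X i j))\<^sup>2" and a = g and b = h] by (simp add: sq[OF x] div_mult_mod_eq)
  have "(vnorm ?y)\<^sup>2 = (\<Sum>k<g * h. (cmod (?y $ k))\<^sup>2)" by (rule sq[OF yc])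
  also have "\<dots> \<le> (\<Sum>k<g * h. (\<lambda>i j. (\<Sum>l<g. (cmod (D $$ (i, l)))\<^sup>2) * (\<Sum>l<g. (cmod (?X l j))\<^sup>2)) (k div h) (k mod h))"
    by (rule sum_mono) (use y in \<open>simp del: index_mult_mat_vec add: cmod_sum_mult_square_le\<close>)
  also have "\<dots> = (\<Sum>i<g. \<Sum>j<h. (\<Sum>l<g. (cmod (D $$ (i, l)))\<^sup>2) * (\<Sum>l<g. (cmod (?X l j))\<^sup>2))"
    by (rule sum_div_mod)
  also have "\<dots> = frobenius D * (\<Sum>j<h. \<Sum>l<g. (cmod (?X l j))\<^sup>2)"
    using D by (simp add: frobenius_def sum_product)
  also have "(\<Sum>j<h. \<Sum>l<g. (cmod (?X l j))\<^sup>2) = (vnorm x)\<^sup>2" unfolding x_sq by (rule sum.swap)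
  finally have "(vnorm ?y)\<^sup>2 \<le> (sqrt (frobenius D) * vnorm x)\<^sup>2"
    by (simp add: power_mult_distrib frobenius_nonneg)
  thus ?thesis by (rule power2_le_imp_le) (simp add: frobenius_nonneg)
qed

text \<open>Inversion and control preserve the Frobenius distance, and queries to the uniform state
  use the same R on both sides. The exponent k is one larger when a control qubit is added, for
  which the width leaves room.\<close>

lemma query_unitary_close:
  assumes U: "unitary_mat (2 ^ p) Q" "unitary_mat (2 ^ p) Q'" "unitary_mat (2 ^ s) R"
    and w: "p + 1 \<le> w" "s + 1 \<le> w"
  obtains k where "k \<le> w" "unitary_mat (2 ^ k) (query_unitary Q R q)" "unitary_mat (2 ^ k) (query_unitary Q' R q)"
    "frobenius (query_unitary Q R q - query_unitary Q' R q) \<le> frobenius (Q - Q')"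
proof -
  have core: "\<exists>k\<le>w. unitary_mat (2 ^ k) (if c then controlled X else X) \<and>
      unitary_mat (2 ^ k) (if c then controlled Y else Y) \<and>
      frobenius ((if c then controlled X else X) - (if c then controlled Y else Y)) = frobenius (X - Y)"
    if XY: "unitary_mat (2 ^ l) X" "unitary_mat (2 ^ l) Y" and l: "l + 1 \<le> w" for l X Y c
  proof (cases c)
    case True
    have "unitary_mat (2 ^ Suc l) (controlled X)" "unitary_mat (2 ^ Suc l) (controlled Y)"
      using XY[THEN unitary_mat_controlled] by (simp_all add: mult_2)
    thus ?thesis using True l frobenius_minus_controlled[OF XY[THEN unitary_mat_carrier]]
      by (intro exI[of _ "Suc l"]) simp
  next
    case False
    thus ?thesis using XY l by (intro exI[of _ l]) simp
  qed
  have self: "frobenius (X - X) = 0" for X :: "complex mat" by (simp add: frobenius_def)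
  have "\<exists>k\<le>w. unitary_mat (2 ^ k) (query_unitary Q R q) \<and> unitary_mat (2 ^ k) (query_unitary Q' R q) \<and>
    frobenius (query_unitary Q R q - query_unitary Q' R q) \<le> frobenius (Q - Q')"
  proof (cases "target q")
    case Prepare_State
    let ?i = "\<lambda>X. if inverted q then mat_adjoint X else X"
    have "unitary_mat (2 ^ p) (?i Q)" "unitary_mat (2 ^ p) (?i Q')"
      using U by (auto intro: unitary_mat_adjoint)
    moreover have "frobenius (?i Q - ?i Q') = frobenius (Q - Q')"
      using frobenius_minus_adjoint[OF U(1,2)[THEN unitary_mat_carrier]] by simp
    ultimately show ?thesis
      using core[of p "?i Q" "?i Q'" "with_control q"] w by (auto simp: query_unitary_def Prepare_State Let_def)
  next
    case Prepare_Uniform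
    let ?i = "\<lambda>X. if inverted q then mat_adjoint X else X"
    have "unitary_mat (2 ^ s) (?i R)" using U by (auto intro: unitary_mat_adjoint)
    thus ?thesis
      using core[of s "?i R" "?i R" "with_control q"] w frobenius_nonneg[of "Q - Q'"]
      by (auto simp: query_unitary_def Prepare_Uniform Let_def self)
  qed
  thus ?thesis using that by blast
qed

lemma on_leading_qubits_unitary:
  assumes "unitary_mat (2 ^ k) G" "k \<le> w"
  shows "unitary_mat (2 ^ w) (on_leading_qubits w G)"
proof -
  have "(2::nat) ^ w = 2 ^ k * 2 ^ (w - k)" using assms(2) by (simp add: power_add[symmetric])
  thus ?thesis using unitary_mat_kron_one[OF assms(1), of "2 ^ (w - k)"] unitary_mat_carrier[OF assms(1)]
    by (simp add: on_leading_qubits_def)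
qed

lemma on_leading_qubits_close:
  assumes G: "G \<in> carrier_mat (2 ^ k) (2 ^ k)" and H: "H \<in> carrier_mat (2 ^ k) (2 ^ k)" and k: "k \<le> w"
    and x: "x \<in> carrier_vec (2 ^ w)"
  shows "vnorm (on_leading_qubits w G *\<^sub>v x - on_leading_qubits w H *\<^sub>v x) \<le> sqrt (frobenius (G - H)) * vnorm x"
proof -
  let ?h = "2 ^ (w - k)" and ?o = "1\<^sub>m (2 ^ (w - k)) :: complex mat"
  have w: "(2::nat) ^ w = 2 ^ k * ?h" using k by (simp add: power_add[symmetric])
  have lead: "on_leading_qubits w X = kron X ?o" if "X \<in> carrier_mat (2 ^ k) (2 ^ k)" for X
    using that w by (simp add: on_leading_qubits_def)
  have o: "?o \<in> carrier_mat ?h ?h" by simp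
  have diff: "kron G ?o - kron H ?o = kron (G - H) ?o"
  proof (rule eq_matI)
    fix i j assume "i < dim_row (kron (G - H) ?o)" "j < dim_col (kron (G - H) ?o)"
    hence "i < 2 ^ k * ?h" "j < 2 ^ k * ?h" using H by auto
    with this[THEN div_mod_less_mult(1)] this[THEN div_mod_less_mult(2)]
    show "(kron G ?o - kron H ?o) $$ (i, j) = kron (G - H) ?o $$ (i, j)"
      using G H by (simp add: kron_def algebra_simps)
  qed (use G H in auto)
  have "on_leading_qubits w G *\<^sub>v x - on_leading_qubits w H *\<^sub>v x = kron (G - H) ?o *\<^sub>v x"
    unfolding lead[OF G] lead[OF H] diff[symmetric] using x w
    by (subst minus_mult_distrib_mat_vec[OF kron_carrier[OF G o] kron_carrier[OF H o]]) auto
  thus ?thesis using vnorm_kron_one_le[OF minus_carrier_mat[OF H, of G], of x ?h] x w by simp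
qed

section \<open>The hybrid argument over the sequence of queries\<close>

definition query_step :: "nat \<Rightarrow> complex mat \<Rightarrow> complex mat \<Rightarrow> complex vec \<Rightarrow> query \<times> complex mat \<Rightarrow> complex vec" where
  "query_step w Q R = (\<lambda>\<psi> (q, V). V *\<^sub>v (on_leading_qubits w (query_unitary Q R q) *\<^sub>v \<psi>))"

text \<open>One step is split as G (\<phi> - \<phi>') + (G - G') \<phi>'. Unitarity of G keeps the
  first term at the old distance, and the second costs at most the distance of the oracles because
  \<phi>' is a unit vector. The norms and carriers are therefore part of the induction.\<close>

lemma foldl_query_step_close:
  assumes U: "unitary_mat (2 ^ p) Q" "unitary_mat (2 ^ p) Q'" "unitary_mat (2 ^ s) R"
    and w: "p + 1 \<le> w" "s + 1 \<le> w"
    and V: "\<forall>(q, V) \<in> set qs. unitary_mat (2 ^ w) V"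
    and \<phi>: "\<phi> \<in> carrier_vec (2 ^ w)" "\<phi>' \<in> carrier_vec (2 ^ w)" "vnorm \<phi> = 1" "vnorm \<phi>' = 1"
  shows "foldl (query_step w Q R) \<phi> qs \<in> carrier_vec (2 ^ w) \<and> foldl (query_step w Q' R) \<phi>' qs \<in> carrier_vec (2 ^ w) \<and>
    vnorm (foldl (query_step w Q R) \<phi> qs) = 1 \<and> vnorm (foldl (query_step w Q' R) \<phi>' qs) = 1 \<and>
    vnorm (foldl (query_step w Q R) \<phi> qs - foldl (query_step w Q' R) \<phi>' qs)
      \<le> vnorm (\<phi> - \<phi>') + length qs * sqrt (frobenius (Q - Q'))"
  using V \<phi>
proof (induction qs arbitrary: \<phi> \<phi>')
  case Nil
  thus ?case by simp
next
  case (Cons qV qs)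
  obtain q V where qV: "qV = (q, V)" by (cases qV)
  have V: "unitary_mat (2 ^ w) V" using Cons.prems(1) qV by auto
  note \<phi> = Cons.prems(2-5)
  obtain k where k: "k \<le> w" "unitary_mat (2 ^ k) (query_unitary Q R q)" "unitary_mat (2 ^ k) (query_unitary Q' R q)"
    "frobenius (query_unitary Q R q - query_unitary Q' R q) \<le> frobenius (Q - Q')"
    using query_unitary_close[OF U w] .
  let ?G = "on_leading_qubits w (query_unitary Q R q)" and ?G' = "on_leading_qubits w (query_unitary Q' R q)"
  have G: "unitary_mat (2 ^ w) ?G" "unitary_mat (2 ^ w) ?G'"
    using k by (auto intro: on_leading_qubits_unitary)
  note Gc = G[THEN unitary_mat_carrier] and Vc = V[THEN unitary_mat_carrier]
  have c: "?G *\<^sub>v \<phi> \<in> carrier_vec (2 ^ w)" "?G' *\<^sub>v \<phi>' \<in> carrier_vec (2 ^ w)" "?G *\<^sub>v \<phi>' \<in> carrier_vec (2 ^ w)"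
    using mult_mat_vec_carrier Gc \<phi>(1,2) by blast+
  have step: "query_step w Q R \<phi> qV = V *\<^sub>v (?G *\<^sub>v \<phi>)" "query_step w Q' R \<phi>' qV = V *\<^sub>v (?G' *\<^sub>v \<phi>')"
    by (simp_all add: query_step_def qV)
  have step_c: "query_step w Q R \<phi> qV \<in> carrier_vec (2 ^ w)" "query_step w Q' R \<phi>' qV \<in> carrier_vec (2 ^ w)"
    unfolding step using mult_mat_vec_carrier[OF Vc] c by blast+
  have step_n: "vnorm (query_step w Q R \<phi> qV) = 1" "vnorm (query_step w Q' R \<phi>' qV) = 1"
    unfolding step using vnorm_unitary[OF V] vnorm_unitary[OF G(1)] vnorm_unitary[OF G(2)] c \<phi> by simp_all
  have "vnorm (query_step w Q R \<phi> qV - query_step w Q' R \<phi>' qV) = vnorm (V *\<^sub>v (?G *\<^sub>v \<phi> - ?G' *\<^sub>v \<phi>'))"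
    unfolding step mult_minus_distrib_mat_vec[OF Vc c(1,2)] ..
  also have "\<dots> = vnorm (?G *\<^sub>v \<phi> - ?G' *\<^sub>v \<phi>')"
    by (rule vnorm_unitary[OF V]) (use c in simp)
  also have "?G *\<^sub>v \<phi> - ?G' *\<^sub>v \<phi>' = ?G *\<^sub>v (\<phi> - \<phi>') + (?G *\<^sub>v \<phi>' - ?G' *\<^sub>v \<phi>')"
  proof -
    have "x - y = (x - z) + (z - y)" if "x \<in> carrier_vec d" "y \<in> carrier_vec d" "z \<in> carrier_vec d" for x y z :: "complex vec" and d
      using that by (intro eq_vecI) auto
    thus ?thesis unfolding mult_minus_distrib_mat_vec[OF Gc(1) \<phi>(1,2)] using c by blast
  qed
  also have "vnorm \<dots> \<le> vnorm (?G *\<^sub>v (\<phi> - \<phi>')) + vnorm (?G *\<^sub>v \<phi>' - ?G' *\<^sub>v \<phi>')"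
    by (rule vnorm_add_le[of _ "2 ^ w"]) (use mult_mat_vec_carrier[OF Gc(1), of "\<phi> - \<phi>'"] c \<phi> in auto)
  also have "vnorm (?G *\<^sub>v (\<phi> - \<phi>')) = vnorm (\<phi> - \<phi>')"
    by (rule vnorm_unitary[OF G(1)]) (use \<phi> in simp)
  also have "vnorm (?G *\<^sub>v \<phi>' - ?G' *\<^sub>v \<phi>') \<le> sqrt (frobenius (query_unitary Q R q - query_unitary Q' R q)) * vnorm \<phi>'"
    by (rule on_leading_qubits_close[OF k(2,3)[THEN unitary_mat_carrier] k(1) \<phi>(2)])
  also have "\<dots> \<le> sqrt (frobenius (Q - Q'))" using k(4) \<phi>(4) by simp
  finally have close: "vnorm (query_step w Q R \<phi> qV - query_step w Q' R \<phi>' qV) \<le> vnorm (\<phi> - \<phi>') + sqrt (frobenius (Q - Q'))"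
    by simp
  have "\<forall>(q, V) \<in> set qs. unitary_mat (2 ^ w) V" using Cons.prems(1) by simp
  from Cons.IH[OF this step_c step_n] close show ?case by (simp add: algebra_simps)
qed

text \<open>On the outcomes close to x' the first final state has length at most sqrt(1/3), since
  its outcomes close to x already take probability 2/3, and the second has length at least
  sqrt(2/3). The triangle inequality turns this into a distance of the final states of at least 4/5
  - 3/5, which exceeds 1/6.\<close>

lemma query_count_bound:
  fixes x x' \<epsilon> :: real
  assumes wf: "query_algorithm_wf (n + max a b + 1) A"
    and U: "unitary_mat (2 ^ (n + a)) Q" "unitary_mat (2 ^ (n + a)) Q'" "unitary_mat (2 ^ (n + b)) R"
    and succ: "2 / 3 \<le> query_success_prob A Q R x \<epsilon>" "2 / 3 \<le> query_success_prob A Q' R x' \<epsilon>"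
    and sep: "2 * \<epsilon> < \<bar>x - x'\<bar>"
  shows "1 / 6 \<le> length (steps A) * sqrt (frobenius (Q - Q'))"
proof -
  let ?w = "width A"
  have w: "n + a + 1 \<le> ?w" "n + b + 1 \<le> ?w" using wf by (auto simp: query_algorithm_wf_def)
  have I: "unitary_mat (2 ^ ?w) (initial A)" and V: "\<forall>(q, V) \<in> set (steps A). unitary_mat (2 ^ ?w) V"
    using wf by (auto simp: query_algorithm_wf_def)
  define \<phi>0 where "\<phi>0 = initial A *\<^sub>v unit_vec (2 ^ ?w) 0"
  have \<phi>0: "\<phi>0 \<in> carrier_vec (2 ^ ?w)" unfolding \<phi>0_def
    using mult_mat_vec_carrier[OF unitary_mat_carrier[OF I]] by simp
  have "vnorm (unit_vec (2 ^ ?w) 0) = 1"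
    by (simp add: vnorm_def L2_set_def unit_vec_def if_distrib[of cmod] if_distrib[of "\<lambda>x. x\<^sup>2"] cong: if_cong)
  hence \<phi>0n: "vnorm \<phi>0 = 1" unfolding \<phi>0_def using vnorm_unitary[OF I] by simp
  define \<phi> where "\<phi> = final_state A Q R"
  define \<phi>' where "\<phi>' = final_state A Q' R"
  have final: "final_state A X R = foldl (query_step ?w X R) \<phi>0 (steps A)" for X
    by (simp add: final_state_def query_step_def \<phi>0_def)
  have "vnorm (\<phi>0 - \<phi>0) = 0" using \<phi>0 by (simp add: vnorm_def L2_set_def)
  with foldl_query_step_close[OF U w V \<phi>0 \<phi>0 \<phi>0n \<phi>0n]
  have \<phi>: "\<phi> \<in> carrier_vec (2 ^ ?w)" "\<phi>' \<in> carrier_vec (2 ^ ?w)" "vnorm \<phi> = 1" "vnorm \<phi>' = 1"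
    and close: "vnorm (\<phi> - \<phi>') \<le> length (steps A) * sqrt (frobenius (Q - Q'))"
    by (simp_all add: \<phi>_def \<phi>'_def final)
  define G where "G x = {i. i < 2 ^ ?w \<and> \<bar>estimate A i - x\<bar> \<le> \<epsilon>}" for x
  have G: "finite (G y)" "G y \<subseteq> {..<2 ^ ?w}" for y by (auto simp: G_def)
  have disj: "G x \<inter> G x' = {}" using sep by (auto simp: G_def abs_le_iff abs_less_iff)
  have "(\<Sum>i\<in>G x. (cmod (\<phi> $ i))\<^sup>2) + (\<Sum>i\<in>G x'. (cmod (\<phi> $ i))\<^sup>2) = (\<Sum>i\<in>G x \<union> G x'. (cmod (\<phi> $ i))\<^sup>2)"
    by (rule sum.union_disjoint[symmetric]) (use G disj in auto)
  also have "\<dots> \<le> (\<Sum>i<2 ^ ?w. (cmod (\<phi> $ i))\<^sup>2)" by (rule sum_mono2) (use G in auto)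
  also have "\<dots> = (vnorm \<phi>)\<^sup>2" unfolding vnorm_square cscalar_prod_self using \<phi>(1) by simp
  finally have "(\<Sum>i\<in>G x. (cmod (\<phi> $ i))\<^sup>2) + (\<Sum>i\<in>G x'. (cmod (\<phi> $ i))\<^sup>2) \<le> 1" using \<phi> by simp
  moreover have "2 / 3 \<le> (\<Sum>i\<in>G x. (cmod (\<phi> $ i))\<^sup>2)"
    using succ(1) by (simp add: query_success_prob_def G_def \<phi>_def)
  ultimately have small: "L2_set (\<lambda>i. cmod (\<phi> $ i)) (G x') \<le> sqrt (1 / 3)" by (simp add: L2_set_def)
  have "sqrt (2 / 3) \<le> L2_set (\<lambda>i. cmod (\<phi>' $ i)) (G x')"
    using succ(2) by (simp add: query_success_prob_def G_def \<phi>'_def L2_set_def)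
  also have "\<dots> \<le> L2_set (\<lambda>i. cmod (\<phi> $ i) + cmod ((\<phi> - \<phi>') $ i)) (G x')"
  proof (rule L2_set_mono)
    fix i assume "i \<in> G x'"
    hence "i < 2 ^ ?w" using G by auto
    thus "cmod (\<phi>' $ i) \<le> cmod (\<phi> $ i) + cmod ((\<phi> - \<phi>') $ i)"
      using \<phi> norm_triangle_ineq4[of "\<phi> $ i" "\<phi> $ i - \<phi>' $ i"] by simp
  qed simp
  also have "\<dots> \<le> L2_set (\<lambda>i. cmod (\<phi> $ i)) (G x') + L2_set (\<lambda>i. cmod ((\<phi> - \<phi>') $ i)) (G x')"
    by (rule L2_set_triangle_ineq)
  also have "L2_set (\<lambda>i. cmod ((\<phi> - \<phi>') $ i)) (G x') \<le> vnorm (\<phi> - \<phi>')"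
    unfolding vnorm_def L2_set_def using \<phi> G by (intro real_sqrt_le_mono sum_mono2) auto
  finally have "sqrt (2 / 3) - sqrt (1 / 3) \<le> vnorm (\<phi> - \<phi>')" using small by simp
  moreover have "1 / 6 \<le> sqrt (2 / 3) - sqrt (1 / 3)"
  proof -
    have "sqrt (1 / 3) \<le> 3 / 5" by (rule real_le_lsqrt) (auto simp: power2_eq_square)
    moreover have "4 / 5 \<le> sqrt (2 / 3)" by (rule real_le_rsqrt) (auto simp: power2_eq_square)
    ultimately show ?thesis by simp
  qed
  ultimately show ?thesis using close by simp
qed

section \<open>Purifications prepared by reflections\<close>

text \<open>The Householder reflection without its normalising denominator, which is why the normal
  vector has to have squared length 2.\<close>

definition reflection_mat :: "nat \<Rightarrow> (nat \<Rightarrow> real) \<Rightarrow> complex mat" where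
  "reflection_mat d v = mat d d (\<lambda>(x, y). complex_of_real ((if x = y then 1 else 0) - v x * v y))"

lemma reflection_mat_carrier [simp]: "reflection_mat d v \<in> carrier_mat d d"
  by (simp add: reflection_mat_def)

lemma unitary_reflection_mat:
  assumes v: "(\<Sum>x<d. (v x)\<^sup>2) = 2"
  shows "unitary_mat d (reflection_mat d v)"
proof -
  have adj: "mat_adjoint (reflection_mat d v) = reflection_mat d v"
    by (rule eq_matI) (auto simp: reflection_mat_def mult.commute)
  have "reflection_mat d v * reflection_mat d v = 1\<^sub>m d"
  proof (rule eq_matI)
    fix x y assume "x < dim_row (1\<^sub>m d)" "y < dim_col (1\<^sub>m d)"
    hence xy: "x < d" "y < d" by auto
    have "(reflection_mat d v * reflection_mat d v) $$ (x, y)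
      = (\<Sum>z<d. reflection_mat d v $$ (x, z) * reflection_mat d v $$ (z, y))"
      by (rule index_mult_mat_sum[OF reflection_mat_carrier reflection_mat_carrier xy])
    also have "\<dots> = (\<Sum>z<d. complex_of_real (((if x = z then 1 else 0) - v x * v z) * ((if z = y then 1 else 0) - v z * v y)))"
      using xy by (intro sum.cong refl) (simp add: reflection_mat_def)
    also have "\<dots> = complex_of_real (\<Sum>z<d. (if z = x then (if x = y then 1 else 0) else 0)
        - (if z = x then v x * v y else 0) - (if z = y then v x * v y else 0) + v x * v y * (v z)\<^sup>2)"
      unfolding of_real_sum by (intro sum.cong refl arg_cong[where f = of_real]) (auto simp: algebra_simps power2_eq_square)
    also have "\<dots> = complex_of_real ((if x = y then 1 else 0) - v x * v y - v x * v y + v x * v y * (\<Sum>z<d. (v z)\<^sup>2))"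
      using xy by (simp add: sum.distrib sum_subtractf sum_distrib_left[symmetric])
    also have "\<dots> = 1\<^sub>m d $$ (x, y)" using xy by (simp add: v)
    finally show "(reflection_mat d v * reflection_mat d v) $$ (x, y) = 1\<^sub>m d $$ (x, y)" .
  qed (auto simp: reflection_mat_def)
  thus ?thesis by (simp add: unitary_mat_def adj)
qed

text \<open>The difference of the rank-one parts is w (w - v)^T + (w - v) v^T. Each of the two terms
  contributes a factor 2 from squaring a sum and a factor 2 from the squared length of w or v, which
  makes 8.\<close>

lemma frobenius_minus_reflection_mat:
  assumes v: "(\<Sum>x<d. (v x)\<^sup>2) = 2" and w: "(\<Sum>x<d. (w x)\<^sup>2) = 2"
  shows "frobenius (reflection_mat d v - reflection_mat d w) \<le> 8 * (\<Sum>x<d. (v x - w x)\<^sup>2)"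
proof -
  let ?s = "\<Sum>x<d. (v x - w x)\<^sup>2"
  have "frobenius (reflection_mat d v - reflection_mat d w) = (\<Sum>x<d. \<Sum>y<d. (w x * w y - v x * v y)\<^sup>2)"
  proof -
    have "(cmod ((reflection_mat d v - reflection_mat d w) $$ (x, y)))\<^sup>2 = (w x * w y - v x * v y)\<^sup>2"
      if "x < d" "y < d" for x y
    proof -
      have "(reflection_mat d v - reflection_mat d w) $$ (x, y) = complex_of_real (w x * w y - v x * v y)"
        using that by (simp add: reflection_mat_def)
      thus ?thesis by (simp only: norm_of_real power2_abs)
    qed
    moreover have "dim_row (reflection_mat d v - reflection_mat d w) = d" "dim_col (reflection_mat d v - reflection_mat d w) = d"
      by (auto simp: reflection_mat_def)
    ultimately show ?thesis unfolding frobenius_def by simp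
  qed
  also have "\<dots> \<le> (\<Sum>x<d. \<Sum>y<d. 2 * ((w x)\<^sup>2 * (v y - w y)\<^sup>2) + 2 * ((v x - w x)\<^sup>2 * (v y)\<^sup>2))"
  proof (intro sum_mono)
    fix x y
    have "(p + q)\<^sup>2 \<le> 2 * p\<^sup>2 + 2 * q\<^sup>2" for p q :: real
      using sum_squares_bound[of p q] by (simp add: power2_sum)
    from this[of "w x * (w y - v y)" "(w x - v x) * v y"]
    have "(w x * (w y - v y) + (w x - v x) * v y)\<^sup>2 \<le> 2 * ((w x)\<^sup>2 * (v y - w y)\<^sup>2) + 2 * ((v x - w x)\<^sup>2 * (v y)\<^sup>2)"
      by (simp only: power_mult_distrib power2_commute[of "w y" "v y"] power2_commute[of "w x" "v x"])
    thus "(w x * w y - v x * v y)\<^sup>2 \<le> 2 * ((w x)\<^sup>2 * (v y - w y)\<^sup>2) + 2 * ((v x - w x)\<^sup>2 * (v y)\<^sup>2)"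
      by (simp only: right_diff_distrib left_diff_distrib) simp
  qed
  also have "\<dots> = 2 * ((\<Sum>x<d. (w x)\<^sup>2) * ?s) + 2 * (?s * (\<Sum>y<d. (v y)\<^sup>2))"
    by (simp only: sum.distrib sum_distrib_left[symmetric] sum_product)
  finally show ?thesis by (simp add: v w)
qed

text \<open>
  The vector \<open>\<Sum>\<^sub>i sqrt (p i) |i\<rangle>|i + 1 mod r\<rangle>\<close> purifies \<open>diag p\<close>. Because of the shift it is orthogonal to the
  all-zero state, so that the reflection exchanging the two has a normal vector of squared length \<open>2\<close>.
\<close>

definition purification :: "nat \<Rightarrow> nat \<Rightarrow> (nat \<Rightarrow> real) \<Rightarrow> nat \<Rightarrow> real" where
  "purification a r p x =
     (if x div 2 ^ a < r \<and> x mod 2 ^ a = (x div 2 ^ a + 1) mod r then sqrt (p (x div 2 ^ a)) else 0)"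

definition purification_normal :: "nat \<Rightarrow> nat \<Rightarrow> (nat \<Rightarrow> real) \<Rightarrow> nat \<Rightarrow> real" where
  "purification_normal a r p x = (if x = 0 then 1 else 0) - purification a r p x"

lemma purification_0: "2 \<le> r \<Longrightarrow> purification a r p 0 = 0"
  by (simp add: purification_def)

text \<open>For each i < r exactly one purifying index is occupied; it is below r and hence below
  2^a.\<close>

lemma sum_purification:
  fixes f :: "nat \<Rightarrow> real"
  assumes r: "1 \<le> r" "r \<le> 2 ^ n" "r \<le> 2 ^ a"
  shows "(\<Sum>x<2 ^ (n + a). if x div 2 ^ a < r \<and> x mod 2 ^ a = (x div 2 ^ a + 1) mod r then f (x div 2 ^ a) else 0) = (\<Sum>i<r. f i)"
proof -
  have "(\<Sum>x<2 ^ (n + a). if x div 2 ^ a < r \<and> x mod 2 ^ a = (x div 2 ^ a + 1) mod r then f (x div 2 ^ a) else 0)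
    = (\<Sum>i<2 ^ n. \<Sum>k<2 ^ a. if i < r \<and> k = (i + 1) mod r then f i else 0)"
    unfolding power_add
    by (rule sum_div_mod[where f = "\<lambda>i k. if i < r \<and> k = (i + 1) mod r then f i else 0"])
  also have "\<dots> = (\<Sum>i<2 ^ n. if i < r then f i else 0)"
  proof (rule sum.cong[OF refl])
    fix i
    have "(i + 1) mod r < r" using r(1) by simp
    hence "(i + 1) mod r < 2 ^ a" using r(3) by linarith
    thus "(\<Sum>k<2 ^ a. if i < r \<and> k = (i + 1) mod r then f i else 0) = (if i < r then f i else 0)"
      by (cases "i < r") simp_all
  qed
  finally show ?thesis by (simp add: sum_if_less[OF r(2)])
qed

lemma sum_purification_normal_square:
  assumes r: "2 \<le> r" "r \<le> 2 ^ n" "r \<le> 2 ^ a" and p: "\<And>i. i < r \<Longrightarrow> 0 \<le> p i" "(\<Sum>i<r. p i) = 1"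
  shows "(\<Sum>x<2 ^ (n + a). (purification_normal a r p x)\<^sup>2) = 2"
proof -
  have "(\<Sum>x<2 ^ (n + a). (purification_normal a r p x)\<^sup>2) =
    (\<Sum>x<2 ^ (n + a). (if x = 0 then 1 else 0) + (if x div 2 ^ a < r \<and> x mod 2 ^ a = (x div 2 ^ a + 1) mod r then p (x div 2 ^ a) else 0))"
  proof (rule sum.cong[OF refl])
    fix x
    show "(purification_normal a r p x)\<^sup>2 = (if x = 0 then 1 else 0) + (if x div 2 ^ a < r \<and> x mod 2 ^ a = (x div 2 ^ a + 1) mod r then p (x div 2 ^ a) else 0)"
      using r(1) p(1) by (cases "x = 0") (simp_all add: purification_normal_def purification_def)
  qed
  also have "\<dots> = 1 + (\<Sum>i<r. p i)"
    unfolding sum.distrib using r by (subst sum_purification) simp_all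
  finally show ?thesis by (simp add: p)
qed

lemma sum_purification_normal_diff:
  assumes r: "2 \<le> r" "r \<le> 2 ^ n" "r \<le> 2 ^ a"
  shows "(\<Sum>x<2 ^ (n + a). (purification_normal a r p x - purification_normal a r q x)\<^sup>2) = (\<Sum>i<r. (sqrt (p i) - sqrt (q i))\<^sup>2)"
proof -
  have "(\<Sum>x<2 ^ (n + a). (purification_normal a r p x - purification_normal a r q x)\<^sup>2) =
    (\<Sum>x<2 ^ (n + a). if x div 2 ^ a < r \<and> x mod 2 ^ a = (x div 2 ^ a + 1) mod r then (sqrt (p (x div 2 ^ a)) - sqrt (q (x div 2 ^ a)))\<^sup>2 else 0)"
    by (rule sum.cong) (auto simp: purification_normal_def purification_def power2_commute)
  also have "\<dots> = (\<Sum>i<r. (sqrt (p i) - sqrt (q i))\<^sup>2)"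
    by (rule sum_purification) (use r in auto)
  finally show ?thesis .
qed

definition purifier :: "nat \<Rightarrow> nat \<Rightarrow> nat \<Rightarrow> (nat \<Rightarrow> real) \<Rightarrow> complex mat" where
  "purifier n a r p = reflection_mat (2 ^ (n + a)) (purification_normal a r p)"

text \<open>Column 0 of the reflection is e_0 - v_0 v with v = e_0 - \<psi>, and v_0 = 1 because the
  purification \<psi> vanishes at 0; so the column is \<psi>. The cyclic shift is injective below r,
  so different i have orthogonal partners and the partial trace is diagonal.\<close>

lemma purifier_prepares:
  assumes r: "2 \<le> r" "r \<le> 2 ^ n" "r \<le> 2 ^ a"
    and p: "\<And>i. i < r \<Longrightarrow> 0 \<le> p i" "\<And>i. r \<le> i \<Longrightarrow> p i = 0" "(\<Sum>i<r. p i) = 1"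
  shows "prepares_purification n a (purifier n a r p) (mat_diag (2 ^ n) (\<lambda>i. complex_of_real (p i)))"
proof -
  let ?d = "(2::nat) ^ (n + a)" and ?\<psi> = "purification a r p"
  have unit: "unitary_mat ?d (purifier n a r p)"
    unfolding purifier_def by (rule unitary_reflection_mat) (rule sum_purification_normal_square[OF r p(1,3)])
  have \<psi>: "purifier n a r p *\<^sub>v unit_vec ?d 0 = vec ?d (\<lambda>x. complex_of_real (?\<psi> x))"
  proof (rule eq_vecI)
    fix x assume "x < dim_vec (vec ?d (\<lambda>x. complex_of_real (?\<psi> x)))"
    hence x: "x < ?d" by simp
    have "(purifier n a r p *\<^sub>v unit_vec ?d 0) $ x = purifier n a r p $$ (x, 0)"
      using x unitary_mat_carrier[OF unit] by simp
    also have "\<dots> = complex_of_real (?\<psi> x)"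
      using x purification_0[OF r(1)] by (simp add: purifier_def reflection_mat_def purification_normal_def)
    finally show "(purifier n a r p *\<^sub>v unit_vec ?d 0) $ x = vec ?d (\<lambda>x. complex_of_real (?\<psi> x)) $ x" using x by simp
  qed (simp add: purifier_def reflection_mat_def)
  have "partial_trace (2 ^ n) (2 ^ a) (pure_state (vec ?d (\<lambda>x. complex_of_real (?\<psi> x)))) = mat_diag (2 ^ n) (\<lambda>i. complex_of_real (p i))"
  proof (rule eq_matI)
    fix i j assume "i < dim_row (mat_diag (2 ^ n) (\<lambda>i. complex_of_real (p i)))" "j < dim_col (mat_diag (2 ^ n) (\<lambda>i. complex_of_real (p i)))"
    hence ij: "i < 2 ^ n" "j < 2 ^ n" by (auto simp: mat_diag_def)
    have idx: "u * 2 ^ a + k < ?d" if "u < 2 ^ n" "k < 2 ^ a" for u k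
    proof -
      have "u * 2 ^ a + k < (u + 1) * 2 ^ a" using that by simp
      also have "\<dots> \<le> 2 ^ n * 2 ^ a" using that by (intro mult_right_mono) auto
      finally show ?thesis by (simp add: power_add)
    qed
    have \<psi>_val: "?\<psi> (u * 2 ^ a + k) = (if u < r \<and> k = (u + 1) mod r then sqrt (p u) else 0)" if "k < 2 ^ a" for u k
      using that by (simp add: purification_def)
    have "partial_trace (2 ^ n) (2 ^ a) (pure_state (vec ?d (\<lambda>x. complex_of_real (?\<psi> x)))) $$ (i, j)
      = (\<Sum>k<2 ^ a. complex_of_real (?\<psi> (i * 2 ^ a + k) * ?\<psi> (j * 2 ^ a + k)))"
      using ij by (simp add: partial_trace_def pure_state_def idx)
    also have "\<dots> = (\<Sum>k<2 ^ a. if k = (i + 1) mod r then (if i = j then complex_of_real (p i) else 0) else 0)"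
    proof (intro sum.cong refl)
      fix k :: nat assume k: "k \<in> {..<2 ^ a}"
      have "(u + 1) mod r = (if u + 1 = r then 0 else u + 1)" if "u < r" for u
        using that by auto
      hence inj: "i = j" if "i < r" "j < r" "(i + 1) mod r = (j + 1) mod r"
        using that by (simp split: if_splits)
      show "complex_of_real (?\<psi> (i * 2 ^ a + k) * ?\<psi> (j * 2 ^ a + k)) =
        (if k = (i + 1) mod r then (if i = j then complex_of_real (p i) else 0) else 0)"
      proof (cases "i < r \<and> j < r \<and> k = (i + 1) mod r")
        case True
        hence "?\<psi> (i * 2 ^ a + k) * ?\<psi> (j * 2 ^ a + k) = (if i = j then p i else 0)"
          using k p(1)[of i] inj by (auto simp: \<psi>_val)
        thus ?thesis using True by simp
      next
        case False
        hence "?\<psi> (i * 2 ^ a + k) * ?\<psi> (j * 2 ^ a + k) = 0" using k by (auto simp: \<psi>_val)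
        moreover have "\<not> (k = (i + 1) mod r \<and> i = j) \<or> p i = 0" using False p(2)[of i] by (auto simp: not_less)
        ultimately show ?thesis by auto
      qed
    qed
    also have "\<dots> = (if i = j then complex_of_real (p i) else 0)"
    proof -
      have "(i + 1) mod r < r" using r(1) by simp
      hence "(i + 1) mod r < 2 ^ a" using r(3) by linarith
      thus ?thesis by simp
    qed
    finally show "partial_trace (2 ^ n) (2 ^ a) (pure_state (vec ?d (\<lambda>x. complex_of_real (?\<psi> x)))) $$ (i, j) =
      mat_diag (2 ^ n) (\<lambda>i. complex_of_real (p i)) $$ (i, j)" using ij by (simp add: mat_diag_def)
  qed (auto simp: partial_trace_def mat_diag_def)
  thus ?thesis unfolding prepares_purification_def \<psi> using unit by simp
qed


section \<open>The two-level spectrum\<close>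

text \<open>Rounding up makes the lowered part of the spectrum the larger one. The upper level,
  which restores trace 1, is then raised by at least \<delta>/r, so every eigenvalue in the support
  is at least \<delta>/r away from 1/r.\<close>

definition low_count :: "nat \<Rightarrow> nat" where
  "low_count r = (r + 1) div 2"

definition two_level :: "nat \<Rightarrow> real \<Rightarrow> nat \<Rightarrow> real" where
  "two_level r \<delta> i = (if i < low_count r then (1 - \<delta>) / r
     else if i < r then (1 + \<delta> * low_count r / (r - low_count r)) / r else 0)"

lemma sum_two_level:
  fixes f :: "real \<Rightarrow> real" and \<delta> :: real
  assumes "4 \<le> r"
  shows "(\<Sum>i<r. f (two_level r \<delta> i)) = low_count r * f ((1 - \<delta>) / r) +
    (real r - low_count r) * f ((1 + \<delta> * low_count r / (r - low_count r)) / r)"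
proof -
  have le: "low_count r \<le> r" using assms by (simp add: low_count_def)
  have "(\<Sum>i<r. f (two_level r \<delta> i)) = (\<Sum>i<low_count r. f (two_level r \<delta> i)) + (\<Sum>i = low_count r..<r. f (two_level r \<delta> i))"
    using sum.atLeastLessThan_concat[of 0 "low_count r" r "\<lambda>i. f (two_level r \<delta> i)"] le by (simp only: atLeast0LessThan)
  also have "(\<Sum>i<low_count r. f (two_level r \<delta> i)) = (\<Sum>i<low_count r. f ((1 - \<delta>) / r))"
    by (rule sum.cong) (auto simp: two_level_def)
  also have "(\<Sum>i = low_count r..<r. f (two_level r \<delta> i)) =
      (\<Sum>i = low_count r..<r. f ((1 + \<delta> * low_count r / (r - low_count r)) / r))"
    by (rule sum.cong) (auto simp: two_level_def)
  finally show ?thesis using le by (simp only: sum_constant card_lessThan card_atLeastLessThan of_nat_diff)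
qed

lemma two_level:
  fixes \<alpha> \<delta> :: real
  assumes r: "4 \<le> r" and \<delta>: "0 < \<delta>" "\<delta> < 1"
  shows "\<And>i. i < r \<Longrightarrow> 0 < two_level r \<delta> i" "\<And>i. r \<le> i \<Longrightarrow> two_level r \<delta> i = 0"
    and "(\<Sum>i<r. two_level r \<delta> i) = 1"
    and "0 < \<alpha> \<Longrightarrow> r * (\<delta> / r) powr \<alpha> \<le> (\<Sum>i<r. \<bar>two_level r \<delta> i - 1 / r\<bar> powr \<alpha>)"
    and "(\<Sum>i<r. (sqrt (two_level r \<delta> i) - sqrt (1 / r))\<^sup>2) \<le> 2 * \<delta>\<^sup>2"
proof -
  define M where "M = real (low_count r)"
  define k where "k = real r - M"
  have "real r \<le> 2 * M" "2 * M \<le> real r + 1"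
    unfolding M_def low_count_def by linarith+
  \<comment> \<open>\<open>k \<le> M\<close> is responsible for the separation of the spectra,
    \<open>M \<le> 2 * k\<close> for the factor 2 in the distance of the purifications.\<close>
  hence k: "k \<le> M" "M \<le> 2 * k" "0 < k" "0 < M" "real r = M + k" using r by (auto simp: k_def)
  have diff: "real (r - low_count r) = k" by (simp add: k_def M_def low_count_def)
  define \<delta>' where "\<delta>' = \<delta> * M / k"
  have \<delta>': "\<delta> \<le> \<delta>'" "0 < \<delta>'" using k \<delta> by (auto simp: \<delta>'_def field_simps)
  have sum: "(\<Sum>i<r. f (two_level r \<delta> i)) = M * f ((1 - \<delta>) / r) + k * f ((1 + \<delta>') / r)" for f :: "real \<Rightarrow> real"
    using sum_two_level[OF r, of f \<delta>] by (simp add: M_def[symmetric] k_def[symmetric] diff \<delta>'_def)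
  show pos: "0 < two_level r \<delta> i" if "i < r" for i
    using that \<delta> \<delta>' r unfolding two_level_def M_def[symmetric] diff \<delta>'_def[symmetric] by auto
  show "two_level r \<delta> i = 0" if "r \<le> i" for i
    using that r by (auto simp: two_level_def low_count_def)
  show "(\<Sum>i<r. two_level r \<delta> i) = 1"
  proof -
    have "(\<Sum>i<r. two_level r \<delta> i) = M * ((1 - \<delta>) / r) + k * ((1 + \<delta>') / r)" by (rule sum)
    also have "\<dots> = (M + k + (k * \<delta>' - M * \<delta>)) / r" by (simp add: add_divide_distrib diff_divide_distrib algebra_simps)
    also have "k * \<delta>' = M * \<delta>" using k by (simp add: \<delta>'_def)
    finally show ?thesis using k by simp
  qed
  show "r * (\<delta> / r) powr \<alpha> \<le> (\<Sum>i<r. \<bar>two_level r \<delta> i - 1 / r\<bar> powr \<alpha>)" if \<alpha>: "0 < \<alpha>"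
  proof -
    have "(1 - \<delta>) / r - 1 / r = - (\<delta> / r)" "(1 + \<delta>') / r - 1 / r = \<delta>' / r"
      by (simp_all add: diff_divide_distrib add_divide_distrib)
    hence abs: "\<bar>(1 - \<delta>) / r - 1 / r\<bar> = \<delta> / r" "\<bar>(1 + \<delta>') / r - 1 / r\<bar> = \<delta>' / r"
      using \<delta> \<delta>' by simp_all
    have "r * (\<delta> / r) powr \<alpha> = M * (\<delta> / r) powr \<alpha> + k * (\<delta> / r) powr \<alpha>" by (simp add: k(5) algebra_simps)
    also have "\<dots> \<le> M * (\<delta> / r) powr \<alpha> + k * (\<delta>' / r) powr \<alpha>"
      using \<delta> \<delta>' \<alpha> k by (intro add_left_mono mult_left_mono powr_mono2 divide_right_mono) auto
    finally show ?thesis using sum[of "\<lambda>x. \<bar>x - 1 / r\<bar> powr \<alpha>"] by (simp only: abs)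
  qed
  show "(\<Sum>i<r. (sqrt (two_level r \<delta> i) - sqrt (1 / r))\<^sup>2) \<le> 2 * \<delta>\<^sup>2"
  proof -
    have "(\<Sum>i<r. (sqrt (two_level r \<delta> i) - sqrt (1 / r))\<^sup>2) \<le> (\<Sum>i<r. r * (two_level r \<delta> i - 1 / r)\<^sup>2)"
    proof (rule sum_mono)
      fix i assume "i \<in> {..<r}"
      hence p: "0 < two_level r \<delta> i" by (simp add: pos)
      define s where "s = sqrt (two_level r \<delta> i)"
      define t where "t = sqrt (1 / r)"
      have st: "0 \<le> s" "0 < t" "s\<^sup>2 = two_level r \<delta> i" "t\<^sup>2 = 1 / r"
        using p r by (auto simp: s_def t_def)
      \<comment> \<open>Only s + t \<ge> t matters here: multiplying by t^2 = 1/r trades the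
        difference of the square roots for that of the eigenvalues.\<close>
      have "(s - t)\<^sup>2 * t\<^sup>2 \<le> (s - t)\<^sup>2 * (s + t)\<^sup>2"
        using st by (intro mult_left_mono power_mono) auto
      also have "\<dots> = (s\<^sup>2 - t\<^sup>2)\<^sup>2" by (simp add: power2_eq_square algebra_simps)
      finally have "(s - t)\<^sup>2 / r \<le> (two_level r \<delta> i - 1 / r)\<^sup>2" by (simp add: st)
      thus "(sqrt (two_level r \<delta> i) - sqrt (1 / r))\<^sup>2 \<le> r * (two_level r \<delta> i - 1 / r)\<^sup>2"
        using r by (simp add: s_def t_def field_simps)
    qed
    also have "\<dots> = M * (r * ((1 - \<delta>) / r - 1 / r)\<^sup>2) + k * (r * ((1 + \<delta>') / r - 1 / r)\<^sup>2)"
      by (rule sum)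
    also have "\<dots> = (M * \<delta>\<^sup>2 + k * \<delta>'\<^sup>2) / r"
    proof -
      have "r * ((1 - \<delta>) / r - 1 / r)\<^sup>2 = \<delta>\<^sup>2 / r" "r * ((1 + \<delta>') / r - 1 / r)\<^sup>2 = \<delta>'\<^sup>2 / r"
        using r by (simp_all add: diff_divide_distrib[symmetric] power_divide power2_eq_square)
      thus ?thesis by (simp only: add_divide_distrib times_divide_eq_right)
    qed
    \<comment> \<open>The second term equals \<open>M\<^sup>2 / k * \<delta>\<^sup>2\<close>, and
      \<open>M + k = r\<close> collects both.\<close>
    also have "M * \<delta>\<^sup>2 + k * \<delta>'\<^sup>2 = M / k * \<delta>\<^sup>2 * r"
      unfolding k(5) \<delta>'_def using k by (simp add: field_simps power2_eq_square)
    also have "M / k * \<delta>\<^sup>2 * r / r = M / k * \<delta>\<^sup>2" using r by simp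
    also have "\<dots> \<le> 2 * \<delta>\<^sup>2" using k by (intro mult_right_mono) (auto simp: field_simps)
    finally show ?thesis .
  qed
qed

section \<open>The lower bounds\<close>

lemma uniform_state_purifier:
  assumes r: "2 \<le> r" "r \<le> 2 ^ n" "r \<le> 2 ^ a"
  shows "prepares_purification n a (purifier n a r (\<lambda>i. if i < r then 1 / r else 0)) (uniform_state (2 ^ n) r)"
proof -
  have "uniform_state (2 ^ n) r = mat_diag (2 ^ n) (\<lambda>i. complex_of_real (if i < r then 1 / r else 0))"
    by (rule eq_matI) (auto simp: mat_diag_def)
  thus ?thesis using r by (simp only:) (rule purifier_prepares, auto)
qed

lemma two_level_state:
  fixes \<alpha> \<delta> :: real
  assumes r: "4 \<le> r" "r \<le> 2 ^ n" and \<delta>: "0 < \<delta>" "\<delta> < 1" and \<alpha>: "0 < \<alpha>"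
  defines "\<rho> \<equiv> mat_diag (2 ^ n) (\<lambda>i. complex_of_real (two_level r \<delta> i))"
  shows "admissible_state n r \<rho>" "uniform_on_support \<rho> = uniform_state (2 ^ n) r"
    and "1 / 2 * (r * (\<delta> / r) powr \<alpha>) \<le> Lambda \<alpha> \<rho> (uniform_state (2 ^ n) r)"
proof -
  note tl = two_level[OF r(1) \<delta>]
  show "admissible_state n r \<rho>" "uniform_on_support \<rho> = uniform_state (2 ^ n) r"
    unfolding \<rho>_def by (rule diag_state[OF r(2) tl(1,2,3)]; assumption)+
  have "Lambda \<alpha> \<rho> (uniform_state (2 ^ n) r) = 1 / 2 * (\<Sum>i<r. \<bar>two_level r \<delta> i - 1 / r\<bar> powr \<alpha>)"
    unfolding \<rho>_def by (rule diag_state(3)[OF r(2) tl(1,2,3)]; assumption)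
  thus "1 / 2 * (r * (\<delta> / r) powr \<alpha>) \<le> Lambda \<alpha> \<rho> (uniform_state (2 ^ n) r)"
    using tl(4)[OF \<alpha>] by simp
qed

text \<open>The squared Frobenius distance of the two preparations of \<rho> is at most 8 times 2
  \<delta>^2, so each query moves the state by at most 4 \<delta>. Together with the total of 1/6
  this produces the constant 24.\<close>

lemma query_estimator_bound:
  fixes \<alpha> \<delta> \<epsilon> :: real
  assumes est: "query_estimator \<alpha> \<epsilon> n r a b A" and r: "4 \<le> r" "r \<le> 2 ^ n" "r \<le> 2 ^ a" "r \<le> 2 ^ b"
    and \<delta>: "0 < \<delta>" "\<delta> < 1" and \<alpha>: "0 < \<alpha>" and sep: "4 * \<epsilon> < r * (\<delta> / r) powr \<alpha>"
  shows "1 / \<delta> \<le> 24 * length (steps A)"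
proof -
  let ?u = "uniform_state (2 ^ n) r" and ?pu = "\<lambda>i. if i < r then 1 / real r else 0"
  let ?\<rho> = "mat_diag (2 ^ n) (\<lambda>i. complex_of_real (two_level r \<delta> i))"
  let ?Q = "purifier n a r (two_level r \<delta>)" and ?Q' = "purifier n a r ?pu" and ?R = "purifier n b r ?pu"
  have r2: "2 \<le> r" using r by simp
  note tl = two_level[OF r(1) \<delta>]
  have tl0: "0 \<le> two_level r \<delta> i" if "i < r" for i using tl(1)[OF that] by simp
  note \<rho> = two_level_state[OF r(1,2) \<delta> \<alpha>] and u = uniform_state_admissible[OF r2 r(2)]
  have Q: "prepares_purification n a ?Q ?\<rho>"
    by (rule purifier_prepares[OF r2 r(2,3) tl0 tl(2,3)]; assumption)
  have Q': "prepares_purification n a ?Q' ?u" by (rule uniform_state_purifier[OF r2 r(2,3)])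
  have R: "prepares_purification n b ?R ?u" by (rule uniform_state_purifier[OF r2 r(2,4)])
  have succ: "2 / 3 \<le> query_success_prob A X ?R (Lambda \<alpha> \<sigma> ?u) \<epsilon>"
    if "admissible_state n r \<sigma>" "uniform_on_support \<sigma> = ?u" "prepares_purification n a X \<sigma>" for X \<sigma>
    using est that R unfolding query_estimator_def by metis
  have count: "1 / 6 \<le> length (steps A) * sqrt (frobenius (?Q - ?Q'))"
  proof (rule query_count_bound)
    show "query_algorithm_wf (n + max a b + 1) A" using est by (simp add: query_estimator_def)
    show "unitary_mat (2 ^ (n + a)) ?Q" "unitary_mat (2 ^ (n + a)) ?Q'" "unitary_mat (2 ^ (n + b)) ?R"
      using Q Q' R by (simp_all add: prepares_purification_def)
    show "2 / 3 \<le> query_success_prob A ?Q ?R (Lambda \<alpha> ?\<rho> ?u) \<epsilon>" by (rule succ[OF \<rho>(1,2) Q])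
    show "2 / 3 \<le> query_success_prob A ?Q' ?R (Lambda \<alpha> ?u ?u) \<epsilon>" by (rule succ[OF u(1,2) Q'])
    show "2 * \<epsilon> < \<bar>Lambda \<alpha> ?\<rho> ?u - Lambda \<alpha> ?u ?u\<bar>" using \<rho>(3) sep unfolding u(3) by linarith
  qed
  have "frobenius (?Q - ?Q') \<le> 8 * (\<Sum>i<r. (sqrt (two_level r \<delta> i) - sqrt (1 / r))\<^sup>2)"
  proof -
    have "frobenius (?Q - ?Q') \<le>
      8 * (\<Sum>x<2 ^ (n + a). (purification_normal a r (two_level r \<delta>) x - purification_normal a r ?pu x)\<^sup>2)"
      unfolding purifier_def using r tl0 tl(3)
      by (intro frobenius_minus_reflection_mat sum_purification_normal_square) auto
    also have "(\<Sum>x<2 ^ (n + a). (purification_normal a r (two_level r \<delta>) x - purification_normal a r ?pu x)\<^sup>2) =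
      (\<Sum>i<r. (sqrt (two_level r \<delta> i) - sqrt (?pu i))\<^sup>2)"
      by (rule sum_purification_normal_diff[OF r2 r(2,3)])
    finally show ?thesis by simp
  qed
  also have "\<dots> \<le> 8 * (2 * \<delta>\<^sup>2)" using tl(5) by simp
  finally have "sqrt (frobenius (?Q - ?Q')) \<le> sqrt (8 * (2 * \<delta>\<^sup>2))" by simp
  also have "\<dots> = 4 * \<delta>"
    using \<delta> by (intro real_sqrt_unique) (simp_all add: power_mult_distrib)
  finally have "length (steps A) * sqrt (frobenius (?Q - ?Q')) \<le> length (steps A) * (4 * \<delta>)"
    by (rule mult_left_mono) simp
  with count show ?thesis using \<delta> by (simp add: field_simps)
qed

text \<open>Here \<delta> is the solution of
  \<open>r * (\<delta> / r) powr \<alpha> = K * \<epsilon>\<close>. K stays free because the two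
  bounds lose different constants. The last two equations express the claimed rates as multiples of
  1/\<delta> and r/\<delta>^2.\<close>

lemma perturbation_scale:
  fixes \<alpha> \<epsilon> K r :: real
  assumes pos: "0 < \<alpha>" "0 < \<epsilon>" "0 < K" "0 < r"
  defines "\<delta> \<equiv> (K * \<epsilon>) powr (1 / \<alpha>) * r powr (1 - 1 / \<alpha>)"
  shows "0 < \<delta>" "\<delta> powr \<alpha> = K * \<epsilon> * r powr (\<alpha> - 1)" "r * (\<delta> / r) powr \<alpha> = K * \<epsilon>"
    and "r powr (1 / \<alpha> - 1) / \<epsilon> powr (1 / \<alpha>) = K powr (1 / \<alpha>) / \<delta>"
    and "r powr (2 / \<alpha> - 1) / \<epsilon> powr (2 / \<alpha>) = (K powr (1 / \<alpha>))\<^sup>2 * (r / \<delta>\<^sup>2)"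
proof -
  show \<delta>: "0 < \<delta>" using pos by (simp add: \<delta>_def)
  have "(1 - 1 / \<alpha>) * \<alpha> = \<alpha> - 1" using pos by (simp add: field_simps)
  thus p: "\<delta> powr \<alpha> = K * \<epsilon> * r powr (\<alpha> - 1)"
    using pos by (simp add: \<delta>_def powr_mult powr_powr)
  have "r * (\<delta> / r) powr \<alpha> = K * \<epsilon> * (r powr (\<alpha> - 1) * r powr 1 / r powr \<alpha>)"
    using pos \<delta> by (simp add: powr_divide p)
  also have "r powr (\<alpha> - 1) * r powr 1 = r powr \<alpha>" by (simp only: powr_add[symmetric]) simp
  finally show "r * (\<delta> / r) powr \<alpha> = K * \<epsilon>" using pos by simp
  have inv: "r powr (1 / \<alpha> - 1) * r powr (1 - 1 / \<alpha>) = 1"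
    using pos by (simp only: powr_add[symmetric]) simp
  show first: "r powr (1 / \<alpha> - 1) / \<epsilon> powr (1 / \<alpha>) = K powr (1 / \<alpha>) / \<delta>"
    using pos inv by (simp add: \<delta>_def powr_mult field_simps)
  have sq: "x powr (2 * y) = (x powr y)\<^sup>2" for x y :: real
    by (simp add: power2_eq_square powr_add[symmetric])
  have "r powr (2 / \<alpha> - 1) = r powr (2 * (1 / \<alpha> - 1)) * r powr 1"
    by (simp only: powr_add[symmetric]) (simp add: algebra_simps)
  hence "r powr (2 / \<alpha> - 1) / \<epsilon> powr (2 / \<alpha>) = r * (r powr (1 / \<alpha> - 1) / \<epsilon> powr (1 / \<alpha>))\<^sup>2"
    using pos sq[of r "1 / \<alpha> - 1"] sq[of \<epsilon> "1 / \<alpha>"] by (simp add: power_divide)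
  thus "r powr (2 / \<alpha> - 1) / \<epsilon> powr (2 / \<alpha>) = (K powr (1 / \<alpha>))\<^sup>2 * (r / \<delta>\<^sup>2)"
    unfolding first by (simp add: power_divide)
qed

text \<open>The worst case is \<epsilon> = 1/4 and r = 4, where \<delta>^\<alpha> is 2^(1-\<alpha>)
  4^(\<alpha>-1) = 2^(\<alpha>-1) < 1. The factor 2^(1-\<alpha>) exceeds 1 and thereby makes the
  separation demanded in \<open>query_estimator_bound\<close> strict.\<close>

lemma admissible_scale_less_1:
  fixes \<alpha> \<epsilon> r :: real
  assumes \<alpha>: "0 < \<alpha>" "\<alpha> < 1" and \<epsilon>: "0 < \<epsilon>" "\<epsilon> \<le> 1 / 4" and r: "4 \<le> r"
  shows "(4 * 2 powr (1 - \<alpha>) * \<epsilon>) powr (1 / \<alpha>) * r powr (1 - 1 / \<alpha>) < 1" (is "?\<delta> < 1")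
proof (rule ccontr)
  assume "\<not> ?\<delta> < 1"
  hence "1 \<le> ?\<delta> powr \<alpha>" using \<alpha> by (intro ge_one_powr_ge_zero) auto
  also have "?\<delta> powr \<alpha> = 4 * 2 powr (1 - \<alpha>) * \<epsilon> * r powr (\<alpha> - 1)"
    using \<alpha> \<epsilon> r by (intro perturbation_scale(2)) auto
  also have "\<dots> \<le> 2 powr (1 - \<alpha>) * 4 powr (\<alpha> - 1)"
  proof (rule mult_mono)
    show "4 * 2 powr (1 - \<alpha>) * \<epsilon> \<le> 2 powr (1 - \<alpha>)"
      using mult_left_mono[OF \<epsilon>(2), of "4 * 2 powr (1 - \<alpha>)"] by simp
    show "r powr (\<alpha> - 1) \<le> 4 powr (\<alpha> - 1)" using \<alpha> r by (intro powr_mono2') auto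
  qed auto
  also have "(4 :: real) powr (\<alpha> - 1) = 2 powr (2 * (\<alpha> - 1))"
    using powr_powr[of 2 2 "\<alpha> - 1"] by simp
  also have "2 powr (1 - \<alpha>) * 2 powr (2 * (\<alpha> - 1)) = 2 powr (\<alpha> - 1)"
    by (simp only: powr_add[symmetric]) (simp add: algebra_simps)
  also have "\<dots> < 2 powr 0" using \<alpha> by (intro powr_less_mono) auto
  finally show False by simp
qed

text \<open>The infimum is infinite for the empty set and attained otherwise, so a bound for each
  single algorithm carries over to the complexity.\<close>

lemma ereal_le_Inf_enat:
  assumes "\<And>x. P x \<Longrightarrow> c \<le> real (f x)"
  shows "ereal c \<le> ereal_of_enat (Inf {enat (f x) | x. P x})"
proof (cases "{enat (f x) | x. P x} = {}")
  case True
  thus ?thesis by (simp only: Inf_enat_def) simp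
next
  case False
  hence "Inf {enat (f x) | x. P x} \<in> {enat (f x) | x. P x}"
    by (simp only: Inf_enat_def if_False) (metis (mono_tags, lifting) LeastI ex_in_conv)
  then obtain x where "P x" "Inf {enat (f x) | x. P x} = enat (f x)" by auto
  thus ?thesis using assms[of x] by simp
qed

lemma query_complexity_bound:
  fixes \<alpha> \<epsilon> :: real
  assumes \<alpha>: "0 < \<alpha>" "\<alpha> < 1" and \<epsilon>: "0 < \<epsilon>" "\<epsilon> \<le> 1 / 4"
    and r: "4 \<le> r" "r \<le> 2 ^ n" "r \<le> 2 ^ a" "r \<le> 2 ^ b"
  shows "ereal (1 / (24 * (4 * 2 powr (1 - \<alpha>)) powr (1 / \<alpha>)) * (real r powr (1 / \<alpha> - 1) / \<epsilon> powr (1 / \<alpha>)))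
    \<le> ereal_of_enat (query_complexity \<alpha> \<epsilon> n r a b)"
  unfolding query_complexity_def
proof (rule ereal_le_Inf_enat)
  fix A assume est: "query_estimator \<alpha> \<epsilon> n r a b A"
  let ?K = "4 * 2 powr (1 - \<alpha>)"
  define \<delta> where "\<delta> = (?K * \<epsilon>) powr (1 / \<alpha>) * real r powr (1 - 1 / \<alpha>)"
  have K: "0 < ?K" and r0: "0 < real r" using r by simp_all
  note scale = perturbation_scale[OF \<alpha>(1) \<epsilon>(1) K r0, folded \<delta>_def]
  have "\<delta> < 1" unfolding \<delta>_def using \<alpha> \<epsilon> r by (intro admissible_scale_less_1) auto
  moreover have "4 * \<epsilon> < r * (\<delta> / r) powr \<alpha>"
    unfolding scale(3) using \<epsilon> \<alpha> powr_less_mono[of 0 "1 - \<alpha>" 2] by simp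
  ultimately have "1 / \<delta> \<le> 24 * length (steps A)"
    by (intro query_estimator_bound[OF est r scale(1) _ \<alpha>(1)])
  thus "1 / (24 * ?K powr (1 / \<alpha>)) * (real r powr (1 / \<alpha> - 1) / \<epsilon> powr (1 / \<alpha>)) \<le> real (length (steps A))"
    unfolding scale(4) using K by simp
qed

text \<open>The block has size 2^m > r/2, so \<Lambda>_\<alpha> exceeds r (\<delta>/r)^\<alpha> / 4,
  which is 2 \<epsilon> for K = 8. In the constant, 40 comes from the case \<delta> < 1, and the
  summand 2^(1/(1-\<alpha>)) accounts for the bounded r with \<delta> \<ge> 1.\<close>

lemma sample_complexity_bound:
  fixes \<alpha> \<epsilon> :: real
  assumes \<alpha>: "0 < \<alpha>" "\<alpha> < 1" and \<epsilon>: "0 < \<epsilon>" "\<epsilon> \<le> 1 / 4" and r: "4 \<le> r" "r \<le> 2 ^ n"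
  shows "ereal (1 / ((8 powr (1 / \<alpha>))\<^sup>2 * (40 + 2 powr (1 / (1 - \<alpha>)))) * (real r powr (2 / \<alpha> - 1) / \<epsilon> powr (2 / \<alpha>)))
    \<le> ereal_of_enat (sample_complexity \<alpha> \<epsilon> n r)"
  unfolding sample_complexity_def
proof (rule ereal_le_Inf_enat)
  fix A assume est: "sample_estimator \<alpha> \<epsilon> n r A"
  have r2: "2 \<le> r" and r0: "0 < real r" using r by simp_all
  let ?c = "40 + 2 powr (1 / (1 - \<alpha>))"
  define \<delta> where "\<delta> = (8 * \<epsilon>) powr (1 / \<alpha>) * real r powr (1 - 1 / \<alpha>)"
  have eight: "0 < (8 :: real)" by simp
  note scale = perturbation_scale[OF \<alpha>(1) \<epsilon>(1) eight r0, folded \<delta>_def]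
  have c: "0 < ?c" by (intro add_pos_pos) auto
  have bound: "real r / \<delta>\<^sup>2 \<le> ?c * copies A"
  proof (cases "\<delta> < 1")
    case True
    obtain m where m: "2 ^ m \<le> r" "r < 2 ^ (m + 1)"
      using ex_power_ivl1[of 2 r] r by auto
    have m0: "0 < m" using m(2) r by (cases m) auto
    have "4 * \<epsilon> = 1 / 2 * (r * (\<delta> / r) powr \<alpha>)" using scale(3) by simp
    also have "\<dots> < 2 ^ m * (\<delta> / r) powr \<alpha>"
    proof -
      have "real r < 2 * 2 ^ m" using m(2) by (simp flip: of_nat_less_iff[where 'a = real])
      moreover have "0 < (\<delta> / r) powr \<alpha>" using scale(1) r0 by simp
      ultimately show ?thesis by (simp add: field_simps)
    qed
    finally have "real r < 40 * copies A * \<delta>\<^sup>2"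
      by (intro sample_copies_bound[OF est m0 m(1) r(2) scale(1) True]) simp
    hence "real r / \<delta>\<^sup>2 \<le> 40 * real (copies A)" using scale(1) by (simp add: field_simps)
    also have "\<dots> \<le> ?c * copies A" by (intro mult_right_mono) auto
    finally show ?thesis .
  next
    case False
    \<comment> \<open>With \<delta> \<ge> 1 the ensemble may leave the set of states of rank r. A
      two-level state at the smaller scale \<eta> < 1 still has \<Lambda>_\<alpha> above 2
      \<epsilon>, which excludes zero copies.\<close>
    define \<eta> where "\<eta> = (4 * 2 powr (1 - \<alpha>) * \<epsilon>) powr (1 / \<alpha>) * real r powr (1 - 1 / \<alpha>)"
    have K: "0 < 4 * 2 powr (1 - \<alpha>)" by simp
    note \<eta> = perturbation_scale[OF \<alpha>(1) \<epsilon>(1) K r0, folded \<eta>_def]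
    have "\<eta> < 1" unfolding \<eta>_def using \<alpha> \<epsilon> r by (intro admissible_scale_less_1) auto
    note \<rho> = two_level_state[OF r \<eta>(1) this \<alpha>(1)]
    have "4 * \<epsilon> < 4 * 2 powr (1 - \<alpha>) * \<epsilon>"
      using \<epsilon> \<alpha> powr_less_mono[of 0 "1 - \<alpha>" 2] by simp
    hence copies: "1 \<le> copies A"
      using \<rho>(3) by (intro sample_copies_pos[OF est r2 r(2) \<rho>(1,2)]) (simp only: \<eta>(3))
    \<comment> \<open>From \<delta> \<ge> 1 and 8 \<epsilon> \<le> 2 follows r^(1-\<alpha>) \<le> 2,
      a bound on r by \<alpha> alone; this uses \<alpha> < 1.\<close>
    have "1 \<le> \<delta> powr \<alpha>" using False \<alpha> by (intro ge_one_powr_ge_zero) auto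
    also have "\<dots> \<le> 2 * r powr (\<alpha> - 1)" unfolding scale(2) using \<epsilon> by (intro mult_right_mono) auto
    finally have "r powr (1 - \<alpha>) \<le> 2 * (r powr (\<alpha> - 1) * r powr (1 - \<alpha>))"
      using mult_right_mono[of 1 "2 * r powr (\<alpha> - 1)" "r powr (1 - \<alpha>)"] by simp
    also have "r powr (\<alpha> - 1) * r powr (1 - \<alpha>) = 1" using r0 by (simp only: powr_add[symmetric]) simp
    finally have "(r powr (1 - \<alpha>)) powr (1 / (1 - \<alpha>)) \<le> 2 powr (1 / (1 - \<alpha>))"
      using \<alpha> by (intro powr_mono2) auto
    hence "real r \<le> 2 powr (1 / (1 - \<alpha>))" using \<alpha> r0 by (simp add: powr_powr)
    also have "\<dots> \<le> ?c * 1" by simp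
    also have "\<dots> \<le> ?c * copies A" using copies c by (intro mult_left_mono) auto
    finally have "real r \<le> ?c * copies A" .
    moreover have "real r / \<delta>\<^sup>2 \<le> real r / 1"
      using False by (intro divide_left_mono) auto
    ultimately show ?thesis by simp
  qed
  have ratio: "1 / (P * c) * (P * x) \<le> N" if "x \<le> c * N" "0 < P" "0 < c" for P c x N :: real
    using that by (simp add: field_simps)
  show "1 / ((8 powr (1 / \<alpha>))\<^sup>2 * ?c) * (real r powr (2 / \<alpha> - 1) / \<epsilon> powr (2 / \<alpha>)) \<le> real (copies A)"
    unfolding scale(5) by (rule ratio[OF bound]) (use c in simp_all)
qed

text \<open>A state of rank r has a purification with a further qubits only if r \<le> 2^a, and
  likewise for b; with fewer no oracle exists and the condition on estimators would hold vacuously.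
  Both constants depend on \<alpha> only, not on the numbers of qubits.\<close>

theorem theorem5p7:
  fixes \<alpha> :: real
  assumes "0 < \<alpha>" and "\<alpha> < 1"
  shows
    "(\<exists>c>0. \<forall>(\<epsilon>::real) (r::nat) (n::nat) (a::nat) (b::nat).
        0 < \<epsilon> \<and> \<epsilon> \<le> 1 / 4 \<and> 4 \<le> r \<and> r \<le> 2 ^ n \<and> r \<le> 2 ^ a \<and> r \<le> 2 ^ b \<longrightarrow>
        ereal (c * (real r powr (1 / \<alpha> - 1) / \<epsilon> powr (1 / \<alpha>)))
          \<le> ereal_of_enat (query_complexity \<alpha> \<epsilon> n r a b)) \<and>
     (\<exists>c>0. \<forall>(\<epsilon>::real) (r::nat) (n::nat).
        0 < \<epsilon> \<and> \<epsilon> \<le> 1 / 4 \<and> 4 \<le> r \<and> r \<le> 2 ^ n \<longrightarrow>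
        ereal (c * (real r powr (2 / \<alpha> - 1) / \<epsilon> powr (2 / \<alpha>)))
          \<le> ereal_of_enat (sample_complexity \<alpha> \<epsilon> n r))"
proof (intro conjI exI allI impI)
  show "0 < 1 / (24 * (4 * 2 powr (1 - \<alpha>)) powr (1 / \<alpha>))" by simp
  have "0 < 40 + 2 powr (1 / (1 - \<alpha>))" by (intro add_pos_pos) auto
  thus "0 < 1 / ((8 powr (1 / \<alpha>))\<^sup>2 * (40 + 2 powr (1 / (1 - \<alpha>))))" by simp
qed (elim conjE, rule query_complexity_bound[OF assms] sample_complexity_bound[OF assms]; assumption)+

end
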